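(* Assume (H1) and (H4). Then for every $\epsilon>0$, $U^\epsilon_{n,d}$ converges to $U^\epsilon$ uniformly on $\Theta$ in probability as $n,d\to\infty$, i.e. $\sup_{\xi\in\Theta}|U^\epsilon_{n,d}(\xi)-U^\epsilon(\xi)|\to0$ in probability, where \[ U^\epsilon(\xi)=\int_0^1\Big[\log\Big(\int_0^1\sigma_t^x(\xi)^2\mu(dx)+\epsilon\Big)+\frac{\int_0^1\sigma_t^x(\theta)^2\mu(dx)+\epsilon}{\int_0^1\sigma_t^x(\xi)^2\mu(dx)+\epsilon}\Big]dt . \]
   Context: Let $\Theta\subset\mathbb{R}^q$ be compact and convex. Let $(\Omega,\mathscr F,(\mathscr F_t)_{t\in[0,1]},P)$ be a filtered probability space carrying a one-dimensional $(\mathscr F_t)$-standard Brownian motion $W$. Let $k:\Theta\times[0,1]\to\mathbb{R}$ be a kernel, extended by $k(\xi,t)=0$ for $t<0$. Fix a true parameter $\theta\in\Theta$ and a deterministic, continuous, strictly positive function $u\mapsto V_0^u$ on $[0,1]$. For $0\le t\le u\le1$ set $V_t^u=V_0^u\exp\big(\int_0^t k(\theta,u-s)\,dW_s-\tfrac12\int_0^t k(\theta,u-s)^2ds\big)$, $V_t^u=0$ for $t>u$. For $0\le t<T\le 1$ let $I_t^T=\int_t^T V_t^u\,du$, and $I_t^T=0$ for $t\ge T$. For $\xi\in\Theta$, $0\le t<x\le1$ let $\sigma_t^x(\xi)=\int_t^x k(\xi,u-t)V_t^u\,du$, and $\sigma_t^x(\xi)=0$ for $t\ge x$. For each $d\ge1$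 a grid $0=T_0<T_1<\dots<T_d\le1$ is given; for $n\ge1$ let $\Delta=1/n$, $t_i=i\Delta$. Put $\hat\sigma_t^j(\xi)=\sum_{l=1}^j k(\xi,T_l-t)(I_t^{T_l}-I_t^{T_{l-1}})$, $\hat\sigma_t(\xi)=(\hat\sigma^j_t(\xi))_{j=1}^d$, $\Delta I_i^d=\big((I_{t_i}^{T_j}-I_{t_{i-1}}^{T_j})/\sqrt\Delta\big)_{j=1}^d$. For $\epsilon>0$, $x\in\mathbb{R}^d$: $F_\epsilon(\xi,t,x)=\log\big(|\hat\sigma_t(\xi)|^2/d+\epsilon\big)+\dfrac{|x|^2+\epsilon d}{|\hat\sigma_t(\xi)|^2+\epsilon d}$ and $U^\epsilon_{n,d}(\xi)=\frac1n\sum_{i=1}^nF_\epsilon(\xi,t_{i-1},\Delta I_i^d)$. $|\cdot|$ is the Euclidean norm. Hypothesis (H1): $k\in C^{2,2}(\Theta\times[0,1])$ and $k>0$ on $\Theta\times[0,1]$. Hypothesis (H4): there is a probability measure $\mu$ on $[0,1]$ with a strictly positive Lebesgue density such that $\mu_d:=\frac1d\sum_{j=1}^d\delta_{T_j}$ converges weakly to $\mu$ as $d\to\infty$. *)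

theory Defs
  imports "HOL-Probability.Probability"
begin

definition std_brownian_motion ::
  "'a measure \<Rightarrow> (real \<Rightarrow> 'a measure) \<Rightarrow> (real \<Rightarrow> 'a \<Rightarrow> real) \<Rightarrow> bool" where
  "std_brownian_motion M F W \<longleftrightarrow>
     prob_space M \<and>
     (\<forall>t\<in>{0..1}. subalgebra M (F t)) \<and>
     (\<forall>s\<in>{0..1}. \<forall>t\<in>{0..1}. s \<le> t \<longrightarrow> sets (F s) \<subseteq> sets (F t)) \<and>
     (\<forall>t\<in>{0..1}. W t \<in> borel_measurable (F t)) \<and>
     (AE \<omega> in M. W 0 \<omega> = 0) \<and>
     (AE \<omega> in M. continuous_on {0..1} (\<lambda>t. W t \<omega>)) \<and>
     (\<forall>s\<in>{0..1}. \<forall>t\<in>{0..1}. s < t \<longrightarrow>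
        distributed M lborel (\<lambda>\<omega>. W t \<omega> - W s \<omega>)
          (\<lambda>x. ennreal (normal_density 0 (sqrt (t - s)) x)) \<and>
        prob_space.indep_sets M
          (\<lambda>b. if b then sets (F s)
               else {(\<lambda>\<omega>. W t \<omega> - W s \<omega>) -` A \<inter> space M | A. A \<in> sets borel})
          UNIV)"

definition conv_in_prob :: "'a measure \<Rightarrow> (nat \<Rightarrow> 'a \<Rightarrow> real) \<Rightarrow> ('a \<Rightarrow> real) \<Rightarrow> bool" where
  "conv_in_prob M Y Z \<longleftrightarrow>
     (\<forall>\<eta>>0. (\<lambda>m. measure M {\<omega>\<in>space M. \<bar>Y m \<omega> - Z \<omega>\<bar> > \<eta>}) \<longlonglongrightarrow> 0)"

text \<open>The stochastic integral of the continuous deterministic integrand f over [0,t]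
  with respect to W, characterised as the limit in probability of the left-point
  Riemann(-Ito) sums along uniform partitions.\<close>
definition wiener_integral ::
  "'a measure \<Rightarrow> (real \<Rightarrow> 'a \<Rightarrow> real) \<Rightarrow> (real \<Rightarrow> real) \<Rightarrow> real \<Rightarrow> ('a \<Rightarrow> real) \<Rightarrow> bool" where
  "wiener_integral M W f t Z \<longleftrightarrow>
     Z \<in> borel_measurable M \<and>
     conv_in_prob M
       (\<lambda>m \<omega>. \<Sum>i<m. f (t * real i / real m) *
                  (W (t * real (Suc i) / real m) \<omega> - W (t * real i / real m) \<omega>)) Z"

definition pdir :: "'p::euclidean_space option \<Rightarrow> 'p \<times> real" where
  "pdir o' = (case o' of None \<Rightarrow> (0, 1) | Some b \<Rightarrow> (b, 0))"

definition pd :: "'p::euclidean_space option \<Rightarrow> ('p \<times> real \<Rightarrow> real) \<Rightarrow> ('p \<times> real \<Rightarrow> real)" where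
  "pd o' g = (\<lambda>x. deriv (\<lambda>h. g (x + h *\<^sub>R pdir o')) 0)"

fun iter_pd :: "'p::euclidean_space option list \<Rightarrow> ('p \<times> real \<Rightarrow> real) \<Rightarrow> ('p \<times> real \<Rightarrow> real)" where
  "iter_pd [] g = g"
| "iter_pd (o' # os) g = pd o' (iter_pd os g)"

definition adm_word :: "'p::euclidean_space option list \<Rightarrow> bool" where
  "adm_word os \<longleftrightarrow> set os \<subseteq> insert None (Some ` Basis) \<and>
     length (filter (\<lambda>o'. o' = None) os) \<le> 2 \<and>
     length (filter (\<lambda>o'. o' \<noteq> None) os) \<le> 2"

definition C22_on :: "('p::euclidean_space \<times> real) set \<Rightarrow> ('p \<times> real \<Rightarrow> real) \<Rightarrow> bool" where
  "C22_on S g \<longleftrightarrow> open S \<and>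
     (\<forall>os. adm_word os \<longrightarrow> continuous_on S (iter_pd os g)) \<and>
     (\<forall>os o'. adm_word (o' # os) \<longrightarrow>
        (\<forall>x\<in>S. (\<lambda>h. iter_pd os g (x + h *\<^sub>R pdir o')) differentiable (at 0)))"

text \<open>(H1): k is C^{2,2} on Theta x [0,1] (i.e. it agrees there with a function whose
  partial derivatives up to order 2 in each variable exist and are continuous on an open
  neighbourhood) and k > 0 on Theta x [0,1].\<close>
definition H1 :: "'p::euclidean_space set \<Rightarrow> ('p \<Rightarrow> real \<Rightarrow> real) \<Rightarrow> bool" where
  "H1 \<Theta> k \<longleftrightarrow>
     (\<exists>S g. \<Theta> \<times> {0..1} \<subseteq> S \<and> C22_on S g \<and> (\<forall>\<xi>\<in>\<Theta>. \<forall>t\<in>{0..1}. g (\<xi>, t) = k \<xi> t)) \<and>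
     (\<forall>\<xi>\<in>\<Theta>. \<forall>t\<in>{0..1}. k \<xi> t > 0)"

definition H4 :: "real measure \<Rightarrow> (nat \<Rightarrow> nat \<Rightarrow> real) \<Rightarrow> bool" where
  "H4 \<mu> T \<longleftrightarrow>
     prob_space \<mu> \<and>
     (\<exists>f. f \<in> borel_measurable borel \<and> (\<forall>x\<in>{0..1}. f x > 0) \<and>
          \<mu> = density lborel (\<lambda>x. ennreal (f x) * indicator {0..1} x)) \<and>
     (\<forall>h. continuous_on UNIV h \<and> bounded (range h) \<longrightarrow>
        (\<lambda>d. (1 / real d) * (\<Sum>j\<in>{1..d}. h (T d j))) \<longlonglongrightarrow> integral\<^sup>L \<mu> h)"

definition Iint :: "(real \<Rightarrow> real \<Rightarrow> 'a \<Rightarrow> real) \<Rightarrow> real \<Rightarrow> real \<Rightarrow> 'a \<Rightarrow> real" where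
  "Iint V t T \<omega> = (if t < T then set_lebesgue_integral lborel {t..T} (\<lambda>u. V t u \<omega>) else 0)"

definition sig :: "('p \<Rightarrow> real \<Rightarrow> real) \<Rightarrow> (real \<Rightarrow> real \<Rightarrow> 'a \<Rightarrow> real) \<Rightarrow> 'p \<Rightarrow> real \<Rightarrow> real \<Rightarrow> 'a \<Rightarrow> real" where
  "sig k V \<xi> t x \<omega> =
     (if t < x then set_lebesgue_integral lborel {t..x} (\<lambda>u. k \<xi> (u - t) * V t u \<omega>) else 0)"

definition sig_hat :: "('p \<Rightarrow> real \<Rightarrow> real) \<Rightarrow> (real \<Rightarrow> real \<Rightarrow> 'a \<Rightarrow> real) \<Rightarrow> (nat \<Rightarrow> nat \<Rightarrow> real)
    \<Rightarrow> nat \<Rightarrow> 'p \<Rightarrow> real \<Rightarrow> nat \<Rightarrow> 'a \<Rightarrow> real" where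
  "sig_hat k V T d \<xi> t j \<omega> =
     (\<Sum>l\<in>{1..j}. k \<xi> (T d l - t) * (Iint V t (T d l) \<omega> - Iint V t (T d (l - 1)) \<omega>))"

definition sqnorm :: "nat \<Rightarrow> (nat \<Rightarrow> real) \<Rightarrow> real" where
  "sqnorm d x = (\<Sum>j\<in>{1..d}. (x j)\<^sup>2)"

definition Feps :: "real \<Rightarrow> nat \<Rightarrow> (nat \<Rightarrow> real) \<Rightarrow> (nat \<Rightarrow> real) \<Rightarrow> real" where
  "Feps \<epsilon> d sh x =
     ln (sqnorm d sh / real d + \<epsilon>) + (sqnorm d x + \<epsilon> * real d) / (sqnorm d sh + \<epsilon> * real d)"

definition Und :: "('p \<Rightarrow> real \<Rightarrow> real) \<Rightarrow> (real \<Rightarrow> real \<Rightarrow> 'a \<Rightarrow> real) \<Rightarrow> (nat \<Rightarrow> nat \<Rightarrow> real)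
    \<Rightarrow> real \<Rightarrow> nat \<Rightarrow> nat \<Rightarrow> 'p \<Rightarrow> 'a \<Rightarrow> real" where
  "Und k V T \<epsilon> n d \<xi> \<omega> =
     (1 / real n) * (\<Sum>i\<in>{1..n}.
        Feps \<epsilon> d (\<lambda>j. sig_hat k V T d \<xi> (real (i - 1) / real n) j \<omega>)
          (\<lambda>j. (Iint V (real i / real n) (T d j) \<omega> - Iint V (real (i - 1) / real n) (T d j) \<omega>)
                / sqrt (1 / real n)))"

definition Ulim :: "('p \<Rightarrow> real \<Rightarrow> real) \<Rightarrow> (real \<Rightarrow> real \<Rightarrow> 'a \<Rightarrow> real) \<Rightarrow> real measure
    \<Rightarrow> 'p \<Rightarrow> real \<Rightarrow> 'p \<Rightarrow> 'a \<Rightarrow> real" where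
  "Ulim k V \<mu> \<theta> \<epsilon> \<xi> \<omega> =
     (let S = (\<lambda>\<zeta> t. integral\<^sup>L \<mu> (\<lambda>x. (sig k V \<zeta> t x \<omega>)\<^sup>2))
      in set_lebesgue_integral lborel {0..1}
           (\<lambda>t. ln (S \<xi> t + \<epsilon>) + (S \<theta> t + \<epsilon>) / (S \<xi> t + \<epsilon>)))"

end

theory Submission
  imports Defs
begin

text \<open>
  Integration by parts turns the Wiener integral of the smooth kernel into a pathwise expression, so that
  \<open>V\<close> has a version \<open>v\<close> that is continuous in \<open>(t, u)\<close> and satisfies
  \<open>v t' u - v t u = k (u - t) * v t u * (w t' - w t) + O((w t' - w t)\<^sup>2 + (t' - t))\<close> along each path \<open>w\<close>.
  Hence the squared increments of the integrated variances are \<open>\<sigma>\<^sup>2 (\<Delta>w)\<^sup>2\<close> up to a negligible error, and for a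
  fixed path the contrast is a weighted sum of the \<open>(\<Delta>w)\<^sup>2\<close> whose weights converge uniformly in
  \<open>(\<xi>, t)\<close> by compactness and weak convergence of the grids. Along \<open>n \<ge> 2 ^ m\<close> the sums of
  \<open>h(t) (\<Delta>w)\<^sup>2\<close> converge almost surely to \<open>\<integral> h\<close>, simultaneously for all continuous \<open>h\<close>:
  summable second moments give this for the Bernstein polynomials, and their span is dense. The theorem
  follows by contradiction along such a subsequence.
\<close>

section \<open>Riemann sums, parameter integrals and uniform limits\<close>

text \<open>The limits in \<open>n\<close> and \<open>d\<close> are decoupled: along a fixed path
  the passage in \<open>d\<close> is uniform over (\<xi>, t), while the passage in \<open>n\<close>
  sees the path only through sums of h(t) (\<Delta>w)^2. The weights h are themselves random, being
  built from \<sigma>, so these sums must converge off one null set for all h at once. A first-order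
  expansion of \<open>v\<close> suffices because squared increments are multiplied by
  \<open>n\<close> and averaged over \<open>n\<close> times: a remainder of size (\<Delta>w)^2 + 1/n
  in each increment changes the contrast by at most a multiple of max |\<Delta>w| + 1/n times the
  bounded sum of (\<Delta>w)^2 + 1/n. If the theorem fails, bad pairs (n, d) exist beyond every
  bound, so the first index may be taken at least 2^m; second moments of order 1/n are then
  summable. The remaining obstacle is that \<open>V t u\<close> is determined for each (t, u) only
  up to a null set of its own, whereas the contrast and its limit integrate over u and t for a fixed
  outcome; joint measurability of \<open>V\<close> and Fubini exchange the quantifiers.\<close>

lemma continuous_on_section:
  assumes "continuous_on (K \<times> A) (\<lambda>(p, u). g p u)" "p \<in> K"
  shows "continuous_on A (g p)"
proof -
  have "continuous_on A (\<lambda>u. (\<lambda>(p, u). g p u) (p, u))"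
    using assms(2) by (intro continuous_on_compose2[OF assms(1)] continuous_intros) auto
  then show ?thesis by simp
qed

lemma continuous_on_compact_abs_bound:
  fixes f :: "'p::topological_space \<Rightarrow> real"
  assumes "compact K" "continuous_on K f"
  obtains B where "B > 0" "\<And>x. x \<in> K \<Longrightarrow> \<bar>f x\<bar> \<le> B"
proof -
  have "bounded (f ` K)" by (intro compact_imp_bounded compact_continuous_image assms)
  then obtain B where "B > 0" "\<forall>x\<in>K. \<bar>f x\<bar> \<le> B" unfolding bounded_pos by auto
  then show ?thesis using that[of B] by blast
qed

lemma abs_sum_le:
  fixes f g :: "nat \<Rightarrow> real"
  assumes "\<And>i. i < N \<Longrightarrow> \<bar>f i\<bar> \<le> g i"
  shows "\<bar>\<Sum>i<N. f i\<bar> \<le> (\<Sum>i<N. g i)"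
  by (rule order_trans[OF sum_abs sum_mono]) (use assms in auto)

lemma filterlim_at_top_of_ge_power2:
  fixes f :: "nat \<Rightarrow> nat"
  assumes "\<And>m. f m \<ge> 2 ^ m"
  shows "filterlim f at_top sequentially"
proof (rule filterlim_at_top_mono[OF filterlim_ident])
  have "m \<le> f m" for m using assms[of m] less_exp[of m] by linarith
  then show "\<forall>\<^sub>F m in sequentially. m \<le> f m" by simp
qed

lemma uniform_partition_in_unit_interval:
  fixes t :: real
  assumes "t \<in> {0..1}" "i \<le> m"
  shows "t * real i / real m \<in> {0..1}"
proof -
  have "t * real i \<le> 1 * real m" using assms by (intro mult_mono) auto
  then show ?thesis using assms by (cases "m = 0") auto
qed

text \<open>The inequality between the end points belongs to the same induction, because gluing the
  last cell to the earlier ones requires it.\<close>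

lemma sum_integral_partition:
  fixes f :: "real \<Rightarrow> real"
  assumes "\<And>j. j < N \<Longrightarrow> \<tau> j \<le> \<tau> (Suc j)" and "f integrable_on {\<tau> 0..\<tau> N}"
  shows "(\<Sum>j<N. integral {\<tau> j..\<tau> (Suc j)} f) = integral {\<tau> 0..\<tau> N} f \<and> \<tau> 0 \<le> \<tau> N"
  using assms
proof (induction N)
  case (Suc N)
  have le: "\<tau> N \<le> \<tau> (Suc N)" using Suc.prems(1) by simp
  have int: "f integrable_on {\<tau> 0..\<tau> N}"
    using Suc.prems(2) le by (rule_tac integrable_on_subinterval) auto
  note IH = Suc.IH[OF Suc.prems(1) int, simplified]
  have "integral {\<tau> 0..\<tau> N} f + integral {\<tau> N..\<tau> (Suc N)} f = integral {\<tau> 0..\<tau> (Suc N)} f"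
    using IH le Suc.prems(2) by (intro Henstock_Kurzweil_Integration.integral_combine) auto
  with IH le show ?case by simp
qed simp

text \<open>Only the weights are discretised and the cell integrals of \<open>g\<close> stay exact,
  so the oscillation of \<open>f\<close> is the sole error. Cells may be empty, which matters later
  when maturities are clipped at the current time.\<close>

lemma weighted_partition_sum_error:
  fixes f g :: "real \<Rightarrow> real"
  assumes mono: "\<And>j. j < N \<Longrightarrow> \<tau> j \<le> \<tau> (Suc j)"
    and f: "continuous_on {\<tau> 0..\<tau> N} f" and g: "continuous_on {\<tau> 0..\<tau> N} g"
    and c: "\<And>j x. j < N \<Longrightarrow> \<tau> j \<le> x \<Longrightarrow> x \<le> \<tau> (Suc j) \<Longrightarrow> \<bar>c j - f x\<bar> \<le> e"
    and B: "\<And>x. x \<in> {\<tau> 0..\<tau> N} \<Longrightarrow> \<bar>g x\<bar> \<le> B"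
  shows "\<bar>(\<Sum>j<N. c j * integral {\<tau> j..\<tau> (Suc j)} g) - integral {\<tau> 0..\<tau> N} (\<lambda>x. f x * g x)\<bar>
           \<le> e * B * (\<tau> N - \<tau> 0)"
proof -
  have mono': "\<tau> i \<le> \<tau> j" if "i \<le> j" "j \<le> N" for i j
    using that
  proof (induction j)
    case (Suc j)
    then show ?case using mono[of j] by (cases "i = Suc j") auto
  qed simp
  have sub: "{\<tau> j..\<tau> (Suc j)} \<subseteq> {\<tau> 0..\<tau> N}" if "j < N" for j
    using mono'[of 0 j] mono'[of "Suc j" N] that by auto
  have fg: "continuous_on {\<tau> 0..\<tau> N} (\<lambda>x. f x * g x)" using f g by (intro continuous_intros)
  have "integral {\<tau> 0..\<tau> N} (\<lambda>x. f x * g x) = (\<Sum>j<N. integral {\<tau> j..\<tau> (Suc j)} (\<lambda>x. f x * g x))"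
    using sum_integral_partition[of N \<tau> "\<lambda>x. f x * g x"] mono integrable_continuous_interval[OF fg] by simp
  then have "(\<Sum>j<N. c j * integral {\<tau> j..\<tau> (Suc j)} g) - integral {\<tau> 0..\<tau> N} (\<lambda>x. f x * g x)
      = (\<Sum>j<N. c j * integral {\<tau> j..\<tau> (Suc j)} g - integral {\<tau> j..\<tau> (Suc j)} (\<lambda>x. f x * g x))"
    by (simp add: sum_subtractf)
  also have "\<bar>\<dots>\<bar> \<le> (\<Sum>j<N. \<bar>c j * integral {\<tau> j..\<tau> (Suc j)} g - integral {\<tau> j..\<tau> (Suc j)} (\<lambda>x. f x * g x)\<bar>)"
    by (rule sum_abs)
  also have "\<dots> \<le> (\<Sum>j<N. e * B * (\<tau> (Suc j) - \<tau> j))"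
  proof (rule sum_mono)
    fix j assume "j \<in> {..<N}"
    then have j: "j < N" by simp
    have ig: "g integrable_on {\<tau> j..\<tau> (Suc j)}"
      by (intro integrable_continuous_interval continuous_on_subset[OF g] sub j)
    have ifg: "(\<lambda>x. f x * g x) integrable_on {\<tau> j..\<tau> (Suc j)}"
      by (intro integrable_continuous_interval continuous_on_subset[OF fg] sub j)
    have cg: "(\<lambda>x. c j * g x) integrable_on {\<tau> j..\<tau> (Suc j)}"
      using ig by (rule integrable_on_mult_right)
    have "c j * integral {\<tau> j..\<tau> (Suc j)} g - integral {\<tau> j..\<tau> (Suc j)} (\<lambda>x. f x * g x)
        = integral {\<tau> j..\<tau> (Suc j)} (\<lambda>x. c j * g x - f x * g x)"
      using cg ifg ig by (simp add: Henstock_Kurzweil_Integration.integral_diff)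
    also have "norm \<dots> \<le> e * B * (\<tau> (Suc j) - \<tau> j)"
    proof (intro integral_bound ballI mono j)
      show "continuous_on {\<tau> j..\<tau> (Suc j)} (\<lambda>x. c j * g x - f x * g x)"
        using sub[OF j] by (intro continuous_intros continuous_on_subset[OF f] continuous_on_subset[OF g])
      fix x assume x: "x \<in> {\<tau> j..\<tau> (Suc j)}"
      then have "\<bar>c j - f x\<bar> * \<bar>g x\<bar> \<le> e * B"
        using c[OF j, of x] B[of x] sub[OF j] by (intro mult_mono) auto
      then show "norm (c j * g x - f x * g x) \<le> e * B"
        by (simp add: left_diff_distrib[symmetric] abs_mult)
    qed
    finally show "\<bar>c j * integral {\<tau> j..\<tau> (Suc j)} g - integral {\<tau> j..\<tau> (Suc j)} (\<lambda>x. f x * g x)\<bar>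
        \<le> e * B * (\<tau> (Suc j) - \<tau> j)"
      by simp
  qed
  also have "\<dots> = e * B * (\<tau> N - \<tau> 0)"
    by (simp add: sum_distrib_left[symmetric] sum_lessThan_telescope)
  finally show ?thesis .
qed

text \<open>Moves the end points into the integrand, so that continuity in moving end points reduces
  to a parameter integral over a fixed interval.\<close>

lemma integral_rescale_unit_interval:
  fixes f :: "real \<Rightarrow> real"
  assumes "a \<le> b" "continuous_on {a..b} f"
  shows "integral {a..b} f = (b - a) * integral {0..1} (\<lambda>r. f (a + r * (b - a)))"
proof (cases "a = b")
  case False
  with assms have m: "b - a > 0" by simp
  have "(f has_integral integral {a..b} f) (cbox a b)"
    using integrable_integral[OF integrable_continuous_interval[OF assms(2)]] by simp
  from has_integral_affinity'[OF this m, of a] m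
  have "((\<lambda>x. f ((b - a) * x + a)) has_integral (integral {a..b} f / (b - a))) {0..1}"
    by (simp add: field_simps)
  then have "integral {0..1} (\<lambda>r. f (a + r * (b - a))) = integral {a..b} f / (b - a)"
    by (simp add: integral_unique algebra_simps)
  with m show ?thesis by simp
qed simp

lemma continuous_on_integral_moving_interval:
  fixes g :: "'p::topological_space \<Rightarrow> real \<Rightarrow> real"
  assumes a: "continuous_on K a" and b: "continuous_on K b"
    and ab: "\<And>p. p \<in> K \<Longrightarrow> c \<le> a p \<and> a p \<le> b p \<and> b p \<le> d"
    and g: "continuous_on (K \<times> {c..d}) (\<lambda>(p, u). g p u)"
  shows "continuous_on K (\<lambda>p. integral {a p..b p} (g p))"
proof -
  have gp: "continuous_on {a p..b p} (g p)" if "p \<in> K" for p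
    using ab[OF that] by (intro continuous_on_subset[OF continuous_on_section[OF g that]]) auto
  have mem: "a p + r * (b p - a p) \<in> {c..d}" if "p \<in> K" "r \<in> {0..1}" for p r
  proof -
    have "0 \<le> r * (b p - a p)" "r * (b p - a p) \<le> 1 * (b p - a p)"
      using ab[OF that(1)] that(2) by (intro mult_nonneg_nonneg mult_right_mono; simp)+
    then show ?thesis using ab[OF that(1)] by auto
  qed
  have a': "continuous_on (K \<times> {0..1}) (\<lambda>x. a (fst x))"
    and b': "continuous_on (K \<times> {0..1}) (\<lambda>x. b (fst x))"
    by (auto intro!: continuous_on_compose2[OF a] continuous_on_compose2[OF b] continuous_intros)
  have "continuous_on (K \<times> {0..1}) (\<lambda>x. (\<lambda>(p, u). g p u) (fst x, a (fst x) + snd x * (b (fst x) - a (fst x))))"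
    using mem by (intro continuous_on_compose2[OF g] continuous_intros a' b') force
  then have "continuous_on (K \<times> cbox 0 1) (\<lambda>(p, r). g p (a p + r * (b p - a p)))"
    by (simp add: case_prod_beta)
  then have "continuous_on K (\<lambda>p. integral (cbox 0 1) (\<lambda>r. g p (a p + r * (b p - a p))))"
    by (rule integral_continuous_on_param)
  then have "continuous_on K (\<lambda>p. (b p - a p) * integral {0..1} (\<lambda>r. g p (a p + r * (b p - a p))))"
    by (intro continuous_intros a b) simp
  then show ?thesis
    by (rule continuous_on_eq) (use ab gp integral_rescale_unit_interval in metis)
qed

text \<open>By compactness p \<mapsto> \<open>h p\<close> is uniformly continuous into the sup norm,
  and the functionals share one Lipschitz constant, so convergence at a finite net of parameters
  already gives uniform convergence. Instances: averages over maturities, Riemann sums, and sums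
  weighted by squared increments.\<close>

lemma uniform_limit_functional:
  fixes h :: "'p::metric_space \<Rightarrow> real \<Rightarrow> real" and L :: "nat \<Rightarrow> (real \<Rightarrow> real) \<Rightarrow> real"
  assumes K: "compact K" and h: "continuous_on (K \<times> {0..1}) (\<lambda>(p, x). h p x)"
    and lip: "\<And>m f g e. continuous_on {0..1} f \<Longrightarrow> continuous_on {0..1} g \<Longrightarrow>
        (\<And>x. x \<in> {0..1} \<Longrightarrow> \<bar>f x - g x\<bar> \<le> e) \<Longrightarrow> \<bar>L m f - L m g\<bar> \<le> C * e"
    and lip': "\<And>f g e. continuous_on {0..1} f \<Longrightarrow> continuous_on {0..1} g \<Longrightarrow>
        (\<And>x. x \<in> {0..1} \<Longrightarrow> \<bar>f x - g x\<bar> \<le> e) \<Longrightarrow> \<bar>L' f - L' g\<bar> \<le> C * e"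
    and lim: "\<And>f. continuous_on {0..1} f \<Longrightarrow> (\<lambda>m. L m f) \<longlonglongrightarrow> L' f"
  shows "uniform_limit K (\<lambda>m p. L m (h p)) (\<lambda>p. L' (h p)) sequentially"
proof (rule uniform_limitI)
  fix e :: real assume e: "e > 0"
  \<comment> \<open>\<open>\<bar>C\<bar> + 1\<close> is positive whatever the sign of
    \<open>C\<close>. Two Lipschitz errors and one error on the net, each at most e/4, stay below
    \<open>e\<close>.\<close>
  define r where "r = e / (4 * (\<bar>C\<bar> + 1))"
  have r: "r > 0" using e by (simp add: r_def)
  have Cr: "C * r \<le> e / 4"
  proof -
    have "C * r \<le> (\<bar>C\<bar> + 1) * r" using r by (intro mult_right_mono) auto
    also have "\<dots> = e / 4" by (simp add: r_def divide_simps)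
    finally show ?thesis .
  qed
  have hp: "continuous_on {0..1} (h p)" if "p \<in> K" for p
    by (rule continuous_on_section[OF h that])
  have "uniformly_continuous_on (K \<times> {0..1}) (\<lambda>(p, x). h p x)"
    by (intro compact_uniformly_continuous h compact_Times K) auto
  then obtain \<rho> where \<rho>: "\<rho> > 0" and u: "\<And>y z. y \<in> K \<times> {0..1} \<Longrightarrow> z \<in> K \<times> {0..1} \<Longrightarrow> dist y z < \<rho>
      \<Longrightarrow> dist ((\<lambda>(p, x). h p x) y) ((\<lambda>(p, x). h p x) z) < r"
    unfolding uniformly_continuous_on_def using r by metis
  obtain P where P: "finite P" "P \<subseteq> K" "K \<subseteq> (\<Union>p\<in>P. ball p \<rho>)"
    using compactE_image[OF K, of K "\<lambda>p. ball p \<rho>"] \<rho> by force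
  have close: "\<bar>h p x - h q x\<bar> \<le> r" if "p \<in> K" "q \<in> K" "dist p q < \<rho>" "x \<in> {0..1}" for p q x
    using u[of "(p, x)" "(q, x)"] that by (auto simp: dist_Pair_Pair dist_real_def)
  have "eventually (\<lambda>m. \<forall>p\<in>P. \<bar>L m (h p) - L' (h p)\<bar> < e / 4) sequentially"
  proof (intro eventually_ball_finite ballI P(1))
    fix p assume "p \<in> P"
    then have "(\<lambda>m. L m (h p)) \<longlonglongrightarrow> L' (h p)" using lim[OF hp] P(2) by auto
    then have "eventually (\<lambda>m. dist (L m (h p)) (L' (h p)) < e / 4) sequentially"
      using e by (intro tendstoD) auto
    then show "eventually (\<lambda>m. \<bar>L m (h p) - L' (h p)\<bar> < e / 4) sequentially"
      by (simp add: dist_real_def)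
  qed
  then show "\<forall>\<^sub>F m in sequentially. \<forall>p\<in>K. dist (L m (h p)) (L' (h p)) < e"
  proof eventually_elim
    case (elim m)
    show ?case
    proof
      fix q assume q: "q \<in> K"
      then obtain p where p: "p \<in> P" "dist p q < \<rho>" using P(3) by auto
      have pK: "p \<in> K" using p P by auto
      have "\<bar>L m (h p) - L m (h q)\<bar> \<le> C * r" "\<bar>L' (h p) - L' (h q)\<bar> \<le> C * r"
        using close[OF pK q p(2)] by (auto intro!: lip lip' hp pK q)
      moreover have "\<bar>L m (h p) - L' (h p)\<bar> < e / 4" using elim p(1) by blast
      ultimately show "dist (L m (h q)) (L' (h q)) < e"
        using Cr e unfolding dist_real_def by linarith
    qed
  qed
qed

section \<open>Riemann and Riemann-Stieltjes sums on uniform partitions\<close>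

lemma uniform_continuity_real:
  fixes f :: "real \<Rightarrow> real"
  assumes "continuous_on {a..b} f" "e > 0"
  obtains \<rho> where "\<rho> > 0" "\<And>x y. x \<in> {a..b} \<Longrightarrow> y \<in> {a..b} \<Longrightarrow> \<bar>x - y\<bar> < \<rho> \<Longrightarrow> \<bar>f x - f y\<bar> < e"
proof -
  have "uniformly_continuous_on {a..b} f" using assms by (intro compact_uniformly_continuous) auto
  then show ?thesis using that assms(2) unfolding uniformly_continuous_on_def dist_real_def by metis
qed

text \<open>The free evaluation point serves two purposes: Riemann sums evaluate at left end points,
  while summation by parts produces right end points.\<close>

lemma tendsto_weighted_uniform_sum:
  fixes f g :: "real \<Rightarrow> real"
  assumes t: "t \<ge> 0" and f: "continuous_on {0..t} f" and g: "continuous_on {0..t} g"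
    and c: "\<And>m i. i < m \<Longrightarrow> c m i \<in> {t * real i / real m..t * real (Suc i) / real m}"
  shows "(\<lambda>m. \<Sum>i<m. f (c m i) * integral {t * real i / real m..t * real (Suc i) / real m} g)
           \<longlonglongrightarrow> integral {0..t} (\<lambda>x. f x * g x)"
proof (rule LIMSEQ_I)
  fix e :: real assume e: "e > 0"
  obtain B where B: "\<And>x. x \<in> {0..t} \<Longrightarrow> \<bar>g x\<bar> \<le> B" "B > 0"
    by (rule continuous_on_compact_abs_bound[OF compact_Icc g]) blast
  \<comment> \<open>\<open>t + 1\<close> instead of \<open>t\<close> avoids a zero denominator at t
    = 0; the factor 2 makes the final bound strict.\<close>
  define e' where "e' = e / (2 * B * (t + 1))"
  have e': "e' > 0" using e B t by (simp add: e'_def)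
  obtain \<rho> where \<rho>: "\<rho> > 0" "\<And>x y. x \<in> {0..t} \<Longrightarrow> y \<in> {0..t} \<Longrightarrow> \<bar>x - y\<bar> < \<rho> \<Longrightarrow> \<bar>f x - f y\<bar> < e'"
    using uniform_continuity_real[OF f e'] by blast
  obtain N where N: "real N > (t + 1) / \<rho>" using reals_Archimedean2 by blast
  have "norm ((\<Sum>i<m. f (c m i) * integral {t * real i / real m..t * real (Suc i) / real m} g)
          - integral {0..t} (\<lambda>x. f x * g x)) < e" if m: "m \<ge> N" for m
  proof -
    have m0: "real m > (t + 1) / \<rho>" using N m by linarith
    then have mp: "real m > 0" using t \<rho>(1) by (smt (verit) divide_pos_pos)
    have mesh: "t / real m < \<rho>" using m0 mp \<rho>(1) t by (simp add: field_simps)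
    have bnd: "t * real i / real m \<le> t" if "i \<le> m" for i
    proof -
      have "t * real i \<le> t * real m" using that t by (intro mult_left_mono) auto
      then show ?thesis using mp by (simp add: field_simps)
    qed
    have cl: "\<bar>f (c m i) - f x\<bar> \<le> e'" if "i < m" "t * real i / real m \<le> x" "x \<le> t * real (Suc i) / real m" for i x
    proof -
      have "t * real (Suc i) / real m - t * real i / real m = t / real m"
        by (simp add: diff_divide_distrib[symmetric] algebra_simps)
      moreover have "0 \<le> t * real i / real m" using t by simp
      moreover have "t * real (Suc i) / real m \<le> t" using bnd[of "Suc i"] that by simp
      ultimately show ?thesis using \<rho>(2)[of "c m i" x] c[OF that(1)] that mesh by force
    qed
    have "\<bar>(\<Sum>i<m. f (c m i) * integral {t * real i / real m..t * real (Suc i) / real m} g)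
          - integral {t * real 0 / real m..t * real m / real m} (\<lambda>x. f x * g x)\<bar>
        \<le> e' * B * (t * real m / real m - t * real 0 / real m)"
      using cl B(1) t mp f g
      by (intro weighted_partition_sum_error[where \<tau> = "\<lambda>i. t * real i / real m"])
         (auto intro!: divide_right_mono mult_left_mono)
    also have "\<dots> \<le> e' * B * (t + 1)" using e' B mp by simp
    also have "\<dots> = e / 2" using B(2) t by (simp add: e'_def divide_simps)
    also have "\<dots> < e" using e by simp
    finally show ?thesis using mp by simp
  qed
  then show "\<exists>no. \<forall>n\<ge>no. norm ((\<Sum>i<n. f (c n i) * integral {t * real i / real n..t * real (Suc i) / real n} g)
          - integral {0..t} (\<lambda>x. f x * g x)) < e" by blast
qed

lemma riemann_sum_tendsto_integral:
  fixes h :: "real \<Rightarrow> real"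
  assumes h: "continuous_on {0..1} h"
  shows "(\<lambda>n. (\<Sum>i<n. h (real i / real n)) / real n) \<longlonglongrightarrow> integral {0..1} h"
proof -
  have "(\<lambda>n. \<Sum>i<n. h (real i / real n) * integral {1 * real i / real n..1 * real (Suc i) / real n} (\<lambda>_. 1))
      \<longlonglongrightarrow> integral {0..1} (\<lambda>x. h x * 1)"
    using h by (intro tendsto_weighted_uniform_sum) (auto intro!: divide_right_mono)
  moreover have "(\<Sum>i<n. h (real i / real n) * integral {1 * real i / real n..1 * real (Suc i) / real n} (\<lambda>_. 1))
     = (\<Sum>i<n. h (real i / real n)) / real n" for n
    by (auto simp: sum_divide_distrib divide_right_mono diff_divide_distrib[symmetric] intro!: sum.cong)
  ultimately show ?thesis by simp
qed

text \<open>Summation by parts shifts the increments from \<open>w\<close>, which is merely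
  continuous, to the continuously differentiable \<open>f\<close>. What remains is a Riemann sum, so
  the limit exists path by path and not only in probability.\<close>

lemma riemann_stieltjes_by_parts_tendsto:
  fixes f w :: "real \<Rightarrow> real"
  assumes t: "t \<ge> 0" and w: "continuous_on {0..t} w"
    and f: "\<And>s. s \<in> {0..t} \<Longrightarrow> (f has_real_derivative f' s) (at s within {0..t})"
    and f': "continuous_on {0..t} f'"
  shows "(\<lambda>m. \<Sum>i<m. f (t * real i / real m) * (w (t * real (Suc i) / real m) - w (t * real i / real m)))
           \<longlonglongrightarrow> f t * w t - f 0 * w 0 - integral {0..t} (\<lambda>s. w s * f' s)"
proof -
  have parts: "(\<Sum>i<m. f (p i) * (w (p (Suc i)) - w (p i)))
      = f (p m) * w (p m) - f (p 0) * w (p 0) - (\<Sum>i<m. w (p (Suc i)) * (f (p (Suc i)) - f (p i)))"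
    for p :: "nat \<Rightarrow> real" and m
    by (induction m) (auto simp: algebra_simps)
  have lim: "(\<lambda>m. \<Sum>i<m. w (t * real (Suc i) / real m) * integral {t * real i / real m..t * real (Suc i) / real m} f')
           \<longlonglongrightarrow> integral {0..t} (\<lambda>s. w s * f' s)"
    using t by (intro tendsto_weighted_uniform_sum w f') (auto intro!: divide_right_mono mult_left_mono)
  have ftc: "integral {t * real i / real m..t * real (Suc i) / real m} f'
      = f (t * real (Suc i) / real m) - f (t * real i / real m)" if "i < m" for i m
  proof -
    have le: "t * real i / real m \<le> t * real (Suc i) / real m"
      using t by (intro divide_right_mono mult_left_mono) auto
    have "t * real (Suc i) \<le> t * real m" using t that by (intro mult_left_mono) auto
    then have le': "t * real (Suc i) / real m \<le> t" using that by (simp add: field_simps)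
    have sub: "{t * real i / real m..t * real (Suc i) / real m} \<subseteq> {0..t}"
      using t le' by auto
    have "(f' has_integral (f (t * real (Suc i) / real m) - f (t * real i / real m)))
        {t * real i / real m..t * real (Suc i) / real m}"
    proof (intro fundamental_theorem_of_calculus le)
      fix x assume "x \<in> {t * real i / real m..t * real (Suc i) / real m}"
      with sub show "(f has_vector_derivative f' x) (at x within {t * real i / real m..t * real (Suc i) / real m})"
        using DERIV_subset[OF f sub] has_real_derivative_iff_has_vector_derivative by blast
    qed
    then show ?thesis by (rule integral_unique)
  qed
  have "(\<lambda>m. f t * w t - f 0 * w 0 - (\<Sum>i<m. w (t * real (Suc i) / real m) * integral {t * real i / real m..t * real (Suc i) / real m} f'))
      \<longlonglongrightarrow> f t * w t - f 0 * w 0 - integral {0..t} (\<lambda>s. w s * f' s)"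
    by (intro tendsto_intros lim)
  \<comment> \<open>At m = 0 the last partition point \<open>t * real m / real m\<close> is 0 rather
    than \<open>t\<close>, so the identity holds only for positive m.\<close>
  moreover have "eventually (\<lambda>m. f t * w t - f 0 * w 0 - (\<Sum>i<m. w (t * real (Suc i) / real m) * integral {t * real i / real m..t * real (Suc i) / real m} f')
     = (\<Sum>i<m. f (t * real i / real m) * (w (t * real (Suc i) / real m) - w (t * real i / real m)))) sequentially"
    using eventually_gt_at_top[of 0]
  proof eventually_elim
    case (elim m)
    have "(\<Sum>i<m. w (t * real (Suc i) / real m) * integral {t * real i / real m..t * real (Suc i) / real m} f')
        = (\<Sum>i<m. w (t * real (Suc i) / real m) * (f (t * real (Suc i) / real m) - f (t * real i / real m)))"
      by (intro sum.cong refl) (simp only: ftc lessThan_iff)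
    then show ?case
      using parts[of "\<lambda>i. t * real i / real m" m] elim by simp
  qed
  ultimately show ?thesis by (rule Lim_transform_eventually)
qed

section \<open>Averages over the maturity grid\<close>

text \<open>Turns a function continuous on the unit interval into a bounded continuous function on
  the whole line, as weak convergence requires of its test functions. Grid points and \<mu>-almost
  all points lie where nothing is changed.\<close>

abbreviation clamp01 :: "real \<Rightarrow> real" where
  "clamp01 x \<equiv> max 0 (min 1 x)"

lemma clamp01_eq: "x \<in> {0..1} \<Longrightarrow> clamp01 x = x"
  by (auto simp: max_def min_def)

lemma continuous_on_clamp01:
  fixes h :: "real \<Rightarrow> 'b::topological_space"
  assumes "continuous_on {0..1} h"
  shows "continuous_on A (\<lambda>x. h (clamp01 x))"
  by (rule continuous_on_compose2[OF assms]) (auto intro!: continuous_intros)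

lemma bounded_clamp01:
  fixes h :: "real \<Rightarrow> real"
  assumes "continuous_on {0..1} h"
  shows "bounded (range (\<lambda>x. h (clamp01 x)))"
proof -
  have "bounded (h ` {0..1})" using assms by (intro compact_imp_bounded compact_continuous_image) auto
  then show ?thesis by (rule bounded_subset) auto
qed

lemma integrable_clamp01:
  fixes h :: "real \<Rightarrow> real"
  assumes "prob_space \<mu>" "sets \<mu> = sets borel" "continuous_on {0..1} h"
  shows "integrable \<mu> (\<lambda>x. h (clamp01 x))"
proof -
  interpret prob_space \<mu> by fact
  obtain B where B: "\<And>x. \<bar>h (clamp01 x)\<bar> \<le> B"
    using bounded_clamp01[OF assms(3)] unfolding bounded_iff by auto
  have "(\<lambda>x. h (clamp01 x)) \<in> borel_measurable borel"
    by (intro borel_measurable_continuous_onI continuous_on_clamp01 assms)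
  then have "(\<lambda>x. h (clamp01 x)) \<in> borel_measurable \<mu>"
    using measurable_cong_sets[OF assms(2) refl] by blast
  then show ?thesis using B by (intro integrable_const_bound[where B = B]) auto
qed

lemma H4_D:
  assumes "H4 \<mu> T"
  shows "prob_space \<mu>" "sets \<mu> = sets borel" "AE x in \<mu>. x \<in> {0..1}"
    "\<And>h::real\<Rightarrow>real. continuous_on UNIV h \<Longrightarrow> bounded (range h) \<Longrightarrow>
       (\<lambda>d. (\<Sum>j<d. h (T d (Suc j))) / real d) \<longlonglongrightarrow> integral\<^sup>L \<mu> h"
proof -
  obtain f where f: "f \<in> borel_measurable borel" and \<mu>: "\<mu> = density lborel (\<lambda>x. ennreal (f x) * indicator {0..1} x)"
    using assms unfolding H4_def by auto
  show "prob_space \<mu>" using assms by (simp add: H4_def)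
  show "sets \<mu> = sets borel" by (simp add: \<mu>)
  show "AE x in \<mu>. x \<in> {0..1}"
    using f unfolding \<mu> by (subst AE_density) (auto simp: indicator_def)
  fix h :: "real \<Rightarrow> real" assume "continuous_on UNIV h" "bounded (range h)"
  then have "(\<lambda>d. (1 / real d) * (\<Sum>j\<in>{1..d}. h (T d j))) \<longlonglongrightarrow> integral\<^sup>L \<mu> h"
    using assms by (simp add: H4_def)
  then show "(\<lambda>d. (\<Sum>j<d. h (T d (Suc j))) / real d) \<longlonglongrightarrow> integral\<^sup>L \<mu> h"
    by (simp add: sum.atLeast1_atMost_eq)
qed

text \<open>Positivity of the density enters here: a nonnegative \<open>h\<close> with zero integral
  vanishes \<mu>-almost everywhere, hence Lebesgue-almost everywhere on the unit interval, which is
  impossible on (a, b).\<close>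

lemma H4_integral_pos:
  fixes h :: "real \<Rightarrow> real"
  assumes H4: "H4 \<mu> T" and h: "continuous_on UNIV h" "\<And>x. h x \<ge> 0" "bounded (range h)"
    and pos: "\<And>x. a < x \<Longrightarrow> x < b \<Longrightarrow> h x > 0" and ab: "0 \<le> a" "a < b" "b \<le> 1"
  shows "integral\<^sup>L \<mu> h > 0"
proof (rule ccontr)
  assume neg: "\<not> integral\<^sup>L \<mu> h > 0"
  interpret prob_space \<mu> using H4_D(1)[OF H4] .
  obtain f where f[measurable]: "f \<in> borel_measurable borel" and fp: "\<forall>x\<in>{0..1}. f x > 0"
    and \<mu>: "\<mu> = density lborel (\<lambda>x. ennreal (f x) * indicator {0..1} x)"
    using H4 unfolding H4_def by auto
  have hm: "h \<in> borel_measurable borel" using h(1) by (rule borel_measurable_continuous_onI)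
  obtain B where B: "\<And>x. \<bar>h x\<bar> \<le> B" using h(3) unfolding bounded_iff by auto
  have "integrable \<mu> h"
    using B hm by (intro integrable_const_bound[where B = B]) (auto simp: \<mu>)
  moreover have "integral\<^sup>L \<mu> h = 0"
    using neg integral_nonneg_AE[of h \<mu>] h(2) by (simp add: order_antisym)
  ultimately have "AE x in \<mu>. h x = 0"
    using h(2) by (subst (asm) integral_nonneg_eq_0_iff_AE) auto
  then have "AE x in lborel. x \<notin> {a<..<b}"
    unfolding \<mu>
  proof (subst (asm) AE_density, goal_cases)
    case 2
    from 2 show ?case
    proof eventually_elim
      case (elim x)
      show ?case
      proof
        assume x: "x \<in> {a<..<b}"
        then have "f x > 0" "h x > 0" using fp ab pos by auto
        with elim x ab show False by (auto simp: indicator_def)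
      qed
    qed
  qed simp
  then have "emeasure lborel {a<..<b} = 0"
    by (subst (asm) AE_iff_measurable[where N = "{a<..<b}"]) auto
  with ab show False by simp
qed

lemma grid_mono:
  fixes \<tau> :: "nat \<Rightarrow> real"
  assumes "\<forall>j<d. \<tau> j < \<tau> (Suc j)" "i < j" "j \<le> d"
  shows "\<tau> i < \<tau> j"
  using assms(2,3)
proof (induction j)
  case (Suc j)
  moreover have "\<tau> j < \<tau> (Suc j)" using assms(1) Suc.prems by simp
  ultimately show ?case by (cases "i = j") force+
qed simp

lemma grid_in_unit_interval:
  fixes \<tau> :: "nat \<Rightarrow> real"
  assumes "\<tau> 0 = 0 \<and> \<tau> d \<le> 1 \<and> (\<forall>j<d. \<tau> j < \<tau> (Suc j))" "j \<le> d"
  shows "\<tau> j \<in> {0..1}"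
  using grid_mono[of d \<tau> 0 j] grid_mono[of d \<tau> j d] assms by (cases "j = 0"; cases "j = d") auto

text \<open>The limit measure charges every open subinterval, so each of N cells of length 1/N
  eventually contains a grid point. With 2/N < \<rho>, a gap of length at least \<rho> would contain
  a whole cell free of grid points.\<close>

lemma grid_mesh_tendsto_0:
  assumes H4: "H4 \<mu> T"
    and grid: "\<And>d. d \<ge> 1 \<Longrightarrow> T d 0 = 0 \<and> T d d \<le> 1 \<and> (\<forall>j<d. T d j < T d (Suc j))"
    and \<rho>: "\<rho> > 0"
  shows "eventually (\<lambda>d. \<forall>j<d. T d (Suc j) - T d j < \<rho>) sequentially"
proof -
  obtain N0 :: nat where N0: "real N0 > 2 / \<rho>" using reals_Archimedean2 by blast
  define N where "N = Suc N0"
  have N: "real N > 0" "2 / real N < \<rho>"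
    using N0 \<rho> by (auto simp: N_def field_simps intro: less_trans)
  have "eventually (\<lambda>d. \<forall>r\<in>{..<N}. \<exists>j<d. real r / real N < T d (Suc j) \<and> T d (Suc j) < real (Suc r) / real N) sequentially"
  proof (intro eventually_ball_finite ballI finite_lessThan)
    fix r assume r: "r \<in> {..<N}"
    define a b where "a = real r / real N" and "b = real (Suc r) / real N"
    have ab: "0 \<le> a" "a < b" "b \<le> 1" using r N by (auto simp: a_def b_def divide_strict_right_mono)
    \<comment> \<open>A tent supported on the cell: a positive grid average forces a grid point
      strictly inside.\<close>
    define h where "h x = max 0 (min 1 (min (x - a) (b - x)))" for x
    have hc: "continuous_on UNIV h" unfolding h_def by (intro continuous_intros)
    have hb: "bounded (range h)" unfolding bounded_iff h_def by (intro exI[of _ 1]) auto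
    have "integral\<^sup>L \<mu> h > 0"
      by (rule H4_integral_pos[OF H4 hc _ hb _ ab]) (auto simp: h_def)
    from order_tendstoD(1)[OF H4_D(4)[OF H4 hc hb] this]
    show "eventually (\<lambda>d. \<exists>j<d. real r / real N < T d (Suc j) \<and> T d (Suc j) < real (Suc r) / real N) sequentially"
    proof eventually_elim
      case (elim d)
      have "\<exists>j<d. h (T d (Suc j)) \<noteq> 0"
      proof (rule ccontr)
        assume "\<not> (\<exists>j<d. h (T d (Suc j)) \<noteq> 0)"
        then have "(\<Sum>j<d. h (T d (Suc j))) = 0" by (intro sum.neutral) auto
        with elim show False by simp
      qed
      then obtain j where "j < d" "h (T d (Suc j)) \<noteq> 0" by blast
      then show ?case by (intro exI[of _ j]) (auto simp: h_def a_def b_def max_def min_def split: if_splits)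
    qed
  qed
  then show ?thesis
    using eventually_ge_at_top[of 1]
  proof eventually_elim
    case (elim d)
    note g = grid[OF elim(2)]
    show ?case
    proof (intro allI impI, rule ccontr)
      fix j assume j: "j < d" and "\<not> T d (Suc j) - T d j < \<rho>"
      then have gap: "T d (Suc j) - T d j > 2 / real N" using N by simp
      have T0: "T d j \<ge> 0" and T1: "T d (Suc j) \<le> 1"
        using grid_in_unit_interval[OF g, of j] grid_in_unit_interval[OF g, of "Suc j"] j by auto
      \<comment> \<open>The first cell starting at or after \<open>T d j\<close>. Rounding up costs
        less than one cell length, so this cell ends before \<open>T d j + 2 / real N\<close> and
        therefore inside the gap.\<close>
      define r where "r = nat \<lceil>real N * T d j\<rceil>"
      have "real r = of_int \<lceil>real N * T d j\<rceil>" using T0 N by (simp add: r_def)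
      then have r1: "real r \<ge> real N * T d j" and r2: "real r < real N * T d j + 1"
        using ceiling_correct[of "real N * T d j"] by auto
      have c1: "real r / real N \<ge> T d j" using r1 N by (simp add: field_simps)
      have "real (Suc r) / real N < (real N * T d j + 2) / real N"
        using r2 N by (intro divide_strict_right_mono) auto
      also have "\<dots> = T d j + 2 / real N" using N by (simp add: field_simps)
      also have "\<dots> < T d (Suc j)" using gap by simp
      finally have c2: "real (Suc r) / real N < T d (Suc j)" .
      with T1 have "real (Suc r) / real N < 1" by simp
      then have "r < N" using N by simp
      then obtain l where l: "l < d" "real r / real N < T d (Suc l)" "T d (Suc l) < real (Suc r) / real N"
        using elim(1) by blast
      have "T d j < T d (Suc l)" "T d (Suc l) < T d (Suc j)" using l c1 c2 by auto
      moreover have "T d (Suc l) \<le> T d j \<or> T d (Suc j) \<le> T d (Suc l)"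
        using grid_mono[of d "T d" "Suc l" j] grid_mono[of d "T d" "Suc j" "Suc l"] g j l(1)
        by (metis Suc_leI less_imp_le_nat linorder_neqE_nat not_less_eq order.order_iff_strict)
      ultimately show False by linarith
    qed
  qed
qed

text \<open>Averages and integrals against a probability measure are 1-Lipschitz in the sup norm, so
  weak convergence, a statement about single functions, becomes uniform over a compact
  family.\<close>

lemma grid_average_uniform_limit:
  fixes h :: "'p::metric_space \<Rightarrow> real \<Rightarrow> real"
  assumes H4: "H4 \<mu> T"
    and grid: "\<And>d. d \<ge> 1 \<Longrightarrow> T d 0 = 0 \<and> T d d \<le> 1 \<and> (\<forall>j<d. T d j < T d (Suc j))"
    and K: "compact K" and h: "continuous_on (K \<times> {0..1}) (\<lambda>(p, x). h p x)"
  shows "uniform_limit K (\<lambda>d p. (\<Sum>j<d. h p (T d (Suc j))) / real d) (\<lambda>p. \<integral>x. h p (clamp01 x) \<partial>\<mu>) sequentially"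
proof (rule uniform_limit_functional[OF K h, where C = 1 and L = "\<lambda>d f. (\<Sum>j<d. f (T d (Suc j))) / real d"
      and L' = "\<lambda>f. \<integral>x. f (clamp01 x) \<partial>\<mu>"])
  interpret prob_space \<mu> using H4_D(1)[OF H4] .
  have T01: "T d (Suc j) \<in> {0..1}" if "j < d" for d j
    using grid_in_unit_interval[OF grid, of d "Suc j"] that by simp
  fix f g :: "real \<Rightarrow> real" and e
  assume f: "continuous_on {0..1} f"
  have eq: "(\<Sum>j<d. f (T d (Suc j))) = (\<Sum>j<d. f (clamp01 (T d (Suc j))))" for d
    by (intro sum.cong refl) (simp add: clamp01_eq[OF T01])
  show "(\<lambda>d. (\<Sum>j<d. f (T d (Suc j))) / real d) \<longlonglongrightarrow> (\<integral>x. f (clamp01 x) \<partial>\<mu>)"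
    unfolding eq by (intro H4_D(4)[OF H4] continuous_on_clamp01 bounded_clamp01 f)
  assume g: "continuous_on {0..1} g" and fg: "\<And>x. x \<in> {0..1} \<Longrightarrow> \<bar>f x - g x\<bar> \<le> e"
  have "(\<integral>x. f (clamp01 x) \<partial>\<mu>) - (\<integral>x. g (clamp01 x) \<partial>\<mu>) = (\<integral>x. f (clamp01 x) - g (clamp01 x) \<partial>\<mu>)"
    by (intro Bochner_Integration.integral_diff[symmetric] integrable_clamp01 H4_D[OF H4] f g)
  also have "\<bar>\<dots>\<bar> \<le> (\<integral>x. \<bar>f (clamp01 x) - g (clamp01 x)\<bar> \<partial>\<mu>)"
    by (rule integral_abs_bound)
  also have "\<dots> \<le> (\<integral>x. e \<partial>\<mu>)"
    by (intro integral_mono integrable_abs Bochner_Integration.integrable_diff integrable_clamp01 H4_D[OF H4] f g fg) auto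
  finally show "\<bar>(\<integral>x. f (clamp01 x) \<partial>\<mu>) - (\<integral>x. g (clamp01 x) \<partial>\<mu>)\<bar> \<le> 1 * e" by (simp add: prob_space)
  fix d :: nat
  have e0: "e \<ge> 0" using fg[of 0] by simp
  have "\<bar>(\<Sum>j<d. f (T d (Suc j))) - (\<Sum>j<d. g (T d (Suc j)))\<bar> \<le> (\<Sum>j<d. \<bar>f (T d (Suc j)) - g (T d (Suc j))\<bar>)"
    by (simp add: sum_subtractf[symmetric])
  also have "\<dots> \<le> (\<Sum>j<d. e)" using T01 fg by (intro sum_mono) blast
  finally show "\<bar>(\<Sum>j<d. f (T d (Suc j))) / real d - (\<Sum>j<d. g (T d (Suc j))) / real d\<bar> \<le> 1 * e"
    using e0 by (cases "d = 0") (auto simp: diff_divide_distrib[symmetric] field_simps)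
qed

section \<open>Convergence of the contrast along a fixed path\<close>

text \<open>The difference of squares is the error times a factor that is itself small with
  \<open>c\<close> and \<open>D\<close>. This second small factor makes the remainders negligible
  after multiplication by \<open>n\<close>.\<close>

lemma sq_diff_perturbation:
  fixes x s D c :: real
  assumes "\<bar>x - s * D\<bar> \<le> c" "\<bar>s\<bar> \<le> B"
  shows "\<bar>x\<^sup>2 - s\<^sup>2 * D\<^sup>2\<bar> \<le> c * (c + 2 * B * \<bar>D\<bar>)"
proof -
  have "x\<^sup>2 - s\<^sup>2 * D\<^sup>2 = (x - s * D) * ((x - s * D) + 2 * (s * D))"
    by (simp add: power2_eq_square algebra_simps)
  also have "\<bar>\<dots>\<bar> \<le> c * (c + 2 * B * \<bar>D\<bar>)"
    unfolding abs_mult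
  proof (rule mult_mono)
    have "\<bar>s * D\<bar> \<le> B * \<bar>D\<bar>" using assms by (simp add: abs_mult mult_right_mono)
    then show "\<bar>x - s * D + 2 * (s * D)\<bar> \<le> c + 2 * B * \<bar>D\<bar>" using assms(1) by linarith
  qed (use assms in auto)
  finally show ?thesis .
qed

text \<open>With \<epsilon> added, logarithm and reciprocal are Lipschitz on the nonnegative
  half-line. The quotient is split so that \<open>X\<close> occurs only through X - Y; the bound is
  affine in \<open>Y\<close> and can thus be summed against squared increments.\<close>

lemma contrast_term_perturbation:
  fixes a a' :: real
  assumes "\<epsilon> > 0" "a \<ge> 0" "a' \<ge> 0" "\<bar>a' - a\<bar> \<le> r" "Y \<ge> 0"
  shows "\<bar>(ln (a' + \<epsilon>) + (X + \<epsilon>) / (a' + \<epsilon>)) - (ln (a + \<epsilon>) + (Y + \<epsilon>) / (a + \<epsilon>))\<bar>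
           \<le> r / \<epsilon> + \<bar>X - Y\<bar> / \<epsilon> + (Y + \<epsilon>) * r / \<epsilon>\<^sup>2"
proof -
  have ln1: "ln (x + \<epsilon>) - ln (y + \<epsilon>) \<le> \<bar>x - y\<bar> / \<epsilon>" if "x \<ge> 0" "y \<ge> 0" for x y :: real
  proof -
    have "ln (x + \<epsilon>) - ln (y + \<epsilon>) = ln ((x + \<epsilon>) / (y + \<epsilon>))"
      using that assms(1) by (simp add: ln_div)
    also have "\<dots> \<le> (x + \<epsilon>) / (y + \<epsilon>) - 1"
      using that assms(1) by (intro ln_le_minus_one) auto
    also have "\<dots> = (x - y) / (y + \<epsilon>)" using that assms(1) by (simp add: field_simps)
    also have "\<dots> \<le> \<bar>x - y\<bar> / (y + \<epsilon>)" using that assms(1) by (intro divide_right_mono) auto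
    also have "\<dots> \<le> \<bar>x - y\<bar> / \<epsilon>" using that assms(1) by (intro divide_left_mono) auto
    finally show ?thesis .
  qed
  have "\<bar>ln (a' + \<epsilon>) - ln (a + \<epsilon>)\<bar> \<le> \<bar>a' - a\<bar> / \<epsilon>"
    using ln1[of a a'] ln1[of a' a] assms(2,3) by (simp add: abs_minus_commute abs_le_iff)
  also have "\<dots> \<le> r / \<epsilon>" using assms by (intro divide_right_mono) auto
  finally have A: "\<bar>ln (a' + \<epsilon>) - ln (a + \<epsilon>)\<bar> \<le> r / \<epsilon>" .
  have "(X + \<epsilon>) / (a' + \<epsilon>) - (Y + \<epsilon>) / (a + \<epsilon>)
      = (X - Y) / (a' + \<epsilon>) + (Y + \<epsilon>) * ((a - a') / ((a' + \<epsilon>) * (a + \<epsilon>)))"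
  proof -
    have "x / b' - y / b = (x - y) / b' + y * ((b - b') / (b' * b))" if "b > 0" "b' > 0" for x y b b' :: real
      using that by (simp add: field_simps)
    from this[of "a + \<epsilon>" "a' + \<epsilon>" "X + \<epsilon>" "Y + \<epsilon>"] show ?thesis using assms by simp
  qed
  moreover have "\<bar>(X - Y) / (a' + \<epsilon>)\<bar> \<le> \<bar>X - Y\<bar> / \<epsilon>"
    using assms by (simp add: abs_divide divide_left_mono)
  moreover have "\<bar>(Y + \<epsilon>) * ((a - a') / ((a' + \<epsilon>) * (a + \<epsilon>)))\<bar> \<le> (Y + \<epsilon>) * (r / \<epsilon>\<^sup>2)"
  proof -
    have "\<epsilon>\<^sup>2 \<le> (a' + \<epsilon>) * (a + \<epsilon>)"
      unfolding power2_eq_square using assms by (intro mult_mono) auto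
    then have "\<bar>a - a'\<bar> / ((a' + \<epsilon>) * (a + \<epsilon>)) \<le> r / \<epsilon>\<^sup>2"
      using assms by (intro frac_le) auto
    then have "(Y + \<epsilon>) * (\<bar>a - a'\<bar> / ((a' + \<epsilon>) * (a + \<epsilon>))) \<le> (Y + \<epsilon>) * (r / \<epsilon>\<^sup>2)"
      using assms by (intro mult_left_mono) auto
    then show ?thesis using assms by (simp add: abs_mult abs_divide)
  qed
  ultimately show ?thesis using A unfolding times_divide_eq_right by linarith
qed

text \<open>The deterministic setting for one frozen outcome: \<open>w\<close> stands for the
  Brownian path and \<open>v\<close> for the continuous version of the forward variance. The
  constant \<open>C0\<close> may depend on the path. Continuity of \<open>v\<close> is asked on the
  whole square so that compactness applies; the expansion is asked only where t' \<le> u.\<close>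

locale volatility_path =
  fixes \<Theta> :: "'p::metric_space set" and \<kappa> :: "'p \<Rightarrow> real \<Rightarrow> real" and \<theta> :: 'p
    and v :: "real \<Rightarrow> real \<Rightarrow> real" and w :: "real \<Rightarrow> real" and C0 :: real
  assumes compact_\<Theta>: "compact \<Theta>" and \<theta>: "\<theta> \<in> \<Theta>"
    and cont_\<kappa>: "continuous_on (\<Theta> \<times> {0..1}) (\<lambda>(\<xi>, s). \<kappa> \<xi> s)"
    and cont_v: "continuous_on ({0..1} \<times> {0..1}) (\<lambda>(t, u). v t u)"
    and cont_w: "continuous_on {0..1} w"
    and v_incr: "\<And>t t' u. 0 \<le> t \<Longrightarrow> t \<le> t' \<Longrightarrow> t' \<le> u \<Longrightarrow> u \<le> 1 \<Longrightarrow>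
       \<bar>v t' u - v t u - \<kappa> \<theta> (u - t) * v t u * (w t' - w t)\<bar> \<le> C0 * ((w t' - w t)\<^sup>2 + (t' - t))"
begin

text \<open>The upper limit \<open>max t x\<close> yields the value 0 for x \<le> t without a case
  distinction and keeps the dependence on (t, x) continuous.\<close>

definition J :: "real \<Rightarrow> real \<Rightarrow> real" where
  "J t x = integral {t..max t x} (v t)"

definition \<sigma> :: "'p \<Rightarrow> real \<Rightarrow> real \<Rightarrow> real" where
  "\<sigma> \<xi> t x = integral {t..max t x} (\<lambda>u. \<kappa> \<xi> (max 0 (u - t)) * v t u)"

text \<open>The kernel argument is truncated at 0, whereas the kernel in \<open>sig_hat\<close>
  vanishes at negative arguments. The sums agree, because both values of \<open>J\<close> are 0 once
  the maturity lies before t.\<close>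

definition \<sigma>h :: "(nat \<Rightarrow> nat \<Rightarrow> real) \<Rightarrow> nat \<Rightarrow> 'p \<Rightarrow> real \<Rightarrow> nat \<Rightarrow> real" where
  "\<sigma>h T d \<xi> t j = (\<Sum>l<j. \<kappa> \<xi> (max 0 (T d (Suc l) - t)) * (J t (T d (Suc l)) - J t (T d l)))"

definition S :: "real measure \<Rightarrow> 'p \<Rightarrow> real \<Rightarrow> real" where
  "S \<mu> \<xi> t = (\<integral>x. (\<sigma> \<xi> t (clamp01 x))\<^sup>2 \<partial>\<mu>)"

text \<open>\<open>Und\<close> in terms of the continuous version, with the quotient in
  \<open>Feps\<close> reduced by \<open>d\<close> and the squared normalisation of the increments
  written as the factor \<open>n\<close>. Time and maturity indices start at 0.\<close>

definition U :: "(nat \<Rightarrow> nat \<Rightarrow> real) \<Rightarrow> real \<Rightarrow> nat \<Rightarrow> nat \<Rightarrow> 'p \<Rightarrow> real" where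
  "U T \<epsilon> n d \<xi> = (\<Sum>i<n. ln ((\<Sum>j<d. (\<sigma>h T d \<xi> (real i / real n) (Suc j))\<^sup>2) / real d + \<epsilon>)
      + ((\<Sum>j<d. real n * (J (real (Suc i) / real n) (T d (Suc j)) - J (real i / real n) (T d (Suc j)))\<^sup>2) / real d + \<epsilon>)
       / ((\<Sum>j<d. (\<sigma>h T d \<xi> (real i / real n) (Suc j))\<^sup>2) / real d + \<epsilon>)) / real n"

section \<open>Continuity, bounds and increments of the path functionals\<close>

lemma cont_v_section: "t \<in> {0..1} \<Longrightarrow> continuous_on {0..1} (v t)"
  by (rule continuous_on_section[OF cont_v])

lemma cont_kv:
  "continuous_on ((\<Theta> \<times> {0..1}) \<times> {0..1}) (\<lambda>(p, u). \<kappa> (fst p) (max 0 (u - snd p)) * v (snd p) u)"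
proof -
  have "continuous_on ((\<Theta> \<times> {0..1}) \<times> {0..1}) (\<lambda>y. (\<lambda>(\<xi>, s). \<kappa> \<xi> s) (fst (fst y), max 0 (snd y - snd (fst y))))"
    by (rule continuous_on_compose2[OF cont_\<kappa>]) (auto intro!: continuous_intros)
  moreover have "continuous_on ((\<Theta> \<times> {0..1}) \<times> {0..1}) (\<lambda>y. (\<lambda>(t, u). v t u) (snd (fst y), snd y))"
    by (rule continuous_on_compose2[OF cont_v]) (auto intro!: continuous_intros)
  ultimately show ?thesis unfolding case_prod_beta by (auto intro!: continuous_intros)
qed

lemma cont_kv_section:
  assumes "\<xi> \<in> \<Theta>" "t \<in> {0..1}"
  shows "continuous_on {0..1} (\<lambda>u. \<kappa> \<xi> (max 0 (u - t)) * v t u)"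
  using continuous_on_section[OF cont_kv, of "(\<xi>, t)"] assms by simp

lemma cont_\<sigma>: "continuous_on ((\<Theta> \<times> {0..1}) \<times> {0..1}) (\<lambda>(p, x). \<sigma> (fst p) (snd p) x)"
proof -
  have "continuous_on (((\<Theta> \<times> {0..1}) \<times> {0..1}) \<times> {0..1})
      (\<lambda>z. (\<lambda>(p, u). \<kappa> (fst p) (max 0 (u - snd p)) * v (snd p) u) (fst (fst z), snd z))"
    by (rule continuous_on_compose2[OF cont_kv]) (auto intro!: continuous_intros)
  then have "continuous_on ((\<Theta> \<times> {0..1}) \<times> {0..1})
     (\<lambda>y. integral {snd (fst y)..max (snd (fst y)) (snd y)}
        (\<lambda>u. \<kappa> (fst (fst y)) (max 0 (u - snd (fst y))) * v (snd (fst y)) u))"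
    by (intro continuous_on_integral_moving_interval[where c = 0 and d = 1])
       (auto intro!: continuous_intros simp: case_prod_beta)
  then show ?thesis by (simp add: \<sigma>_def case_prod_beta)
qed

lemma v_bounded: obtains B where "B > 0" "\<And>t u. t \<in> {0..1} \<Longrightarrow> u \<in> {0..1} \<Longrightarrow> \<bar>v t u\<bar> \<le> B"
  by (rule continuous_on_compact_abs_bound[OF compact_Times[OF compact_Icc compact_Icc] cont_v]) auto

lemma \<kappa>_bounded: obtains B where "B > 0" "\<And>\<xi> s. \<xi> \<in> \<Theta> \<Longrightarrow> s \<in> {0..1} \<Longrightarrow> \<bar>\<kappa> \<xi> s\<bar> \<le> B"
  by (rule continuous_on_compact_abs_bound[OF compact_Times[OF compact_\<Theta> compact_Icc] cont_\<kappa>]) auto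

lemma \<sigma>_bounded: obtains B where "B > 0"
  "\<And>\<xi> t x. \<xi> \<in> \<Theta> \<Longrightarrow> t \<in> {0..1} \<Longrightarrow> x \<in> {0..1} \<Longrightarrow> \<bar>\<sigma> \<xi> t x\<bar> \<le> B"
  by (rule continuous_on_compact_abs_bound[OF compact_Times[OF compact_Times[OF compact_\<Theta> compact_Icc] compact_Icc] cont_\<sigma>]) force

text \<open>For x beyond t', the expansion of \<open>v\<close> is integrated over [t', x]; the strip
  [t, t'] has length at most t' - t and is absorbed by the remainder. For x within the strip only
  strip terms remain, and for x \<le> t everything vanishes.\<close>

lemma J_increment:
  obtains C where "C > 0" "\<And>t t' x. 0 \<le> t \<Longrightarrow> t \<le> t' \<Longrightarrow> t' \<le> 1 \<Longrightarrow> x \<in> {0..1} \<Longrightarrow>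
     \<bar>J t' x - J t x - \<sigma> \<theta> t x * (w t' - w t)\<bar> \<le> C * ((w t' - w t)\<^sup>2 + (t' - t))"
proof -
  obtain Bv where Bv: "Bv > 0" "\<And>t u. t \<in> {0..1} \<Longrightarrow> u \<in> {0..1} \<Longrightarrow> \<bar>v t u\<bar> \<le> Bv" using v_bounded by metis
  obtain Bk where Bk: "Bk > 0" "\<And>\<xi> s. \<xi> \<in> \<Theta> \<Longrightarrow> s \<in> {0..1} \<Longrightarrow> \<bar>\<kappa> \<xi> s\<bar> \<le> Bk" using \<kappa>_bounded by metis
  obtain R where R: "R > 0" "\<And>s. s \<in> {0..1} \<Longrightarrow> \<bar>w s\<bar> \<le> R"
    by (rule continuous_on_compact_abs_bound[OF compact_Icc cont_w]) blast
  \<comment> \<open>\<open>\<bar>C0\<bar>\<close> accounts for the integrated expansion;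
    \<open>Bv\<close> and \<open>Bk * Bv * (2 * R)\<close> bound \<open>J\<close> and \<sigma> times
    the increment per unit length of the strip, where \<open>2 * R\<close> bounds any increment of
    \<open>w\<close>.\<close>
  define C where "C = \<bar>C0\<bar> + Bv + Bk * Bv * (2 * R)"
  have C: "C > 0" using Bv Bk R by (simp add: C_def add_nonneg_pos add_pos_pos)
  show ?thesis
  proof (rule that[OF C])
    fix t t' x :: real assume t: "0 \<le> t" "t \<le> t'" "t' \<le> 1" and x: "x \<in> {0..1}"
    define D where "D = w t' - w t"
    have D: "\<bar>D\<bar> \<le> 2 * R" using R(2)[of t] R(2)[of t'] t unfolding D_def by auto
    define kv where "kv u = \<kappa> \<theta> (max 0 (u - t)) * v t u" for u
    have ckv: "continuous_on {0..1} kv" unfolding kv_def using cont_kv_section[OF \<theta>, of t] t by simp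
    have cv: "continuous_on {0..1} (v t)" and cv': "continuous_on {0..1} (v t')"
      using cont_v_section t by auto
    have kvb: "\<bar>kv u\<bar> \<le> Bk * Bv" if "u \<in> {0..1}" for u
      unfolding kv_def abs_mult using Bk(2)[OF \<theta>, of "max 0 (u - t)"] Bv(2)[of t u] Bk(1) t that
      by (intro mult_mono) auto
    have ib: "\<bar>integral {a..b} (v t)\<bar> \<le> Bv * (b - a) \<and> \<bar>integral {a..b} kv\<bar> \<le> Bk * Bv * (b - a)"
      if "0 \<le> a" "a \<le> b" "b \<le> 1" for a b
    proof -
      have sub: "{a..b} \<subseteq> {0..1}" using that by auto
      show ?thesis
        using integral_bound[OF that(2) continuous_on_subset[OF cv sub], of Bv]
          integral_bound[OF that(2) continuous_on_subset[OF ckv sub], of "Bk * Bv"]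
          Bv(2)[of t] kvb t sub by force
    qed
    have triv: "\<bar>J t y\<bar> + \<bar>\<sigma> \<theta> t y * D\<bar> \<le> (Bv + Bk * Bv * (2 * R)) * (y - t)" if "t \<le> y" "y \<le> 1" for y
    proof -
      have "\<bar>\<sigma> \<theta> t y * D\<bar> \<le> (Bk * Bv * (y - t)) * (2 * R)"
        unfolding abs_mult \<sigma>_def using ib[of t y] that t D unfolding kv_def by (intro mult_mono) auto
      moreover have "\<bar>J t y\<bar> \<le> Bv * (y - t)" unfolding J_def using ib[of t y] that t by simp
      ultimately show ?thesis by (simp add: algebra_simps)
    qed
    have CC: "(Bv + Bk * Bv * (2 * R)) * (y - t) + \<bar>C0\<bar> * (D\<^sup>2 + (t' - t)) \<le> C * (D\<^sup>2 + (t' - t))"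
      if "y \<le> t'" for y
    proof -
      have "(Bv + Bk * Bv * (2 * R)) * (y - t) \<le> (Bv + Bk * Bv * (2 * R)) * (D\<^sup>2 + (t' - t))"
        using that Bv Bk R by (intro mult_left_mono) (auto intro: add_increasing)
      then show ?thesis by (simp add: C_def algebra_simps)
    qed
    have C0nn: "0 \<le> \<bar>C0\<bar> * (D\<^sup>2 + (t' - t))" using t by simp
    consider "x \<le> t" | "t < x" "x \<le> t'" | "t' < x" by linarith
    then show "\<bar>J t' x - J t x - \<sigma> \<theta> t x * (w t' - w t)\<bar> \<le> C * ((w t' - w t)\<^sup>2 + (t' - t))"
      unfolding D_def[symmetric]
    proof cases
      case 1
      then have "J t' x = 0" "J t x = 0" "\<sigma> \<theta> t x = 0" using t by (auto simp: J_def \<sigma>_def max_absorb1)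
      then show "\<bar>J t' x - J t x - \<sigma> \<theta> t x * D\<bar> \<le> C * (D\<^sup>2 + (t' - t))" using C t by simp
    next
      case 2
      then have "J t' x = 0" by (auto simp: J_def max_absorb1)
      moreover have "\<bar>J t x\<bar> + \<bar>\<sigma> \<theta> t x * D\<bar> \<le> (Bv + Bk * Bv * (2 * R)) * (x - t)"
        using triv[of x] 2(1) x by simp
      ultimately show "\<bar>J t' x - J t x - \<sigma> \<theta> t x * D\<bar> \<le> C * (D\<^sup>2 + (t' - t))"
        using CC[OF 2(2)] C0nn by linarith
    next
      case 3
      have sub: "{t..x} \<subseteq> {0..1}" "{t'..x} \<subseteq> {0..1}" using t x by auto
      have J1: "J t' x = integral {t'..x} (v t')" using 3 by (simp add: J_def)
      have J2: "J t x = J t t' + integral {t'..x} (v t)"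
        unfolding J_def using 3 t
        by (simp add: max_absorb2 Henstock_Kurzweil_Integration.integral_combine
            integrable_continuous_interval[OF continuous_on_subset[OF cv sub(1)]])
      have J3: "\<sigma> \<theta> t x = \<sigma> \<theta> t t' + integral {t'..x} kv"
        unfolding \<sigma>_def kv_def[symmetric] using 3 t
        by (simp add: max_absorb2 Henstock_Kurzweil_Integration.integral_combine
            integrable_continuous_interval[OF continuous_on_subset[OF ckv sub(1)]])
      have i1: "v t' integrable_on {t'..x}" "v t integrable_on {t'..x}" "kv integrable_on {t'..x}"
        by (intro integrable_continuous_interval continuous_on_subset[OF cv']
            continuous_on_subset[OF cv] continuous_on_subset[OF ckv] sub)+
      have e: "integral {t'..x} (v t') - integral {t'..x} (v t) - integral {t'..x} kv * D
         = integral {t'..x} (\<lambda>u. v t' u - v t u - kv u * D)"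
        using i1 by (simp add: Henstock_Kurzweil_Integration.integral_diff integrable_diff
            integrable_on_mult_left)
      have "norm (integral {t'..x} (\<lambda>u. v t' u - v t u - kv u * D)) \<le> (\<bar>C0\<bar> * (D\<^sup>2 + (t' - t))) * (x - t')"
      proof (rule integral_bound)
        show "continuous_on {t'..x} (\<lambda>u. v t' u - v t u - kv u * D)"
          by (intro continuous_intros continuous_on_subset[OF cv']
            continuous_on_subset[OF cv] continuous_on_subset[OF ckv] sub)
        show "norm (v t' u - v t u - kv u * D) \<le> \<bar>C0\<bar> * (D\<^sup>2 + (t' - t))" if "u \<in> {t'..x}" for u
        proof -
          have "\<bar>v t' u - v t u - kv u * D\<bar> \<le> C0 * (D\<^sup>2 + (t' - t))"
            using v_incr[of t t' u] t that x by (simp add: kv_def D_def)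
          also have "\<dots> \<le> \<bar>C0\<bar> * (D\<^sup>2 + (t' - t))" using t by (intro mult_right_mono) auto
          finally show ?thesis by simp
        qed
      qed (use 3 in simp)
      also have "\<dots> \<le> (\<bar>C0\<bar> * (D\<^sup>2 + (t' - t))) * 1" using 3 t x C0nn by (intro mult_left_mono) auto
      finally have E: "\<bar>integral {t'..x} (v t') - integral {t'..x} (v t) - integral {t'..x} kv * D\<bar>
          \<le> \<bar>C0\<bar> * (D\<^sup>2 + (t' - t))" unfolding e by simp
      have "J t' x - J t x - \<sigma> \<theta> t x * D = (integral {t'..x} (v t') - integral {t'..x} (v t) - integral {t'..x} kv * D)
          - J t t' - \<sigma> \<theta> t t' * D"
        unfolding J1 J2 J3 by (simp add: algebra_simps)
      then show "\<bar>J t' x - J t x - \<sigma> \<theta> t x * D\<bar> \<le> C * (D\<^sup>2 + (t' - t))"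
        using E triv[of t'] CC[of t'] t by linarith
    qed
  qed
qed

text \<open>Clipping the maturities at t makes \<sigma>h a weighted partition sum for the integral
  defining \<sigma>: maturities before t give empty cells and clipping never enlarges a cell. One
  mesh bound therefore serves all \<xi>, t and j.\<close>

lemma \<sigma>h_uniform_approx:
  assumes H4: "H4 \<mu> T"
    and grid: "\<And>d. d \<ge> 1 \<Longrightarrow> T d 0 = 0 \<and> T d d \<le> 1 \<and> (\<forall>j<d. T d j < T d (Suc j))"
    and e: "e > 0"
  shows "eventually (\<lambda>d. \<forall>\<xi>\<in>\<Theta>. \<forall>t\<in>{0..1}. \<forall>j\<le>d. \<bar>\<sigma>h T d \<xi> t j - \<sigma> \<xi> t (T d j)\<bar> \<le> e) sequentially"
proof -
  obtain Bv where Bv: "Bv > 0" "\<And>t u. t \<in> {0..1} \<Longrightarrow> u \<in> {0..1} \<Longrightarrow> \<bar>v t u\<bar> \<le> Bv" using v_bounded by metis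
  define e' where "e' = e / Bv"
  have e': "e' > 0" using e Bv by (simp add: e'_def)
  have "uniformly_continuous_on (\<Theta> \<times> {0..1}) (\<lambda>(\<xi>, s). \<kappa> \<xi> s)"
    by (intro compact_uniformly_continuous cont_\<kappa> compact_Times compact_\<Theta>) auto
  then obtain \<rho> where \<rho>: "\<rho> > 0" and u: "\<And>y z. y \<in> \<Theta> \<times> {0..1} \<Longrightarrow> z \<in> \<Theta> \<times> {0..1} \<Longrightarrow> dist y z < \<rho>
      \<Longrightarrow> dist ((\<lambda>(p, x). \<kappa> p x) y) ((\<lambda>(p, x). \<kappa> p x) z) < e'"
    unfolding uniformly_continuous_on_def using e' by metis
  have u': "\<bar>\<kappa> \<xi> x - \<kappa> \<xi> y\<bar> \<le> e'" if "\<xi> \<in> \<Theta>" "x \<in> {0..1}" "y \<in> {0..1}" "\<bar>x - y\<bar> < \<rho>" for \<xi> x y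
    using u[of "(\<xi>, x)" "(\<xi>, y)"] that by (auto simp: dist_Pair_Pair dist_real_def)
  have "eventually (\<lambda>d. \<forall>j<d. T d (Suc j) - T d j < \<rho>) sequentially"
    by (rule grid_mesh_tendsto_0[OF H4 grid \<rho>])
  then show ?thesis
    using eventually_ge_at_top[of 1]
  proof eventually_elim
    case (elim d)
    note g = grid[OF elim(2)]
    have T01: "T d l \<in> {0..1}" if "l \<le> d" for l by (rule grid_in_unit_interval[OF g that])
    show ?case
    proof (intro ballI allI impI)
      fix \<xi> t j assume \<xi>: "\<xi> \<in> \<Theta>" and t: "t \<in> {0..1::real}" and j: "j \<le> d"
      define \<tau> where "\<tau> l = max t (T d l)" for l
      have step: "\<tau> l \<le> \<tau> (Suc l) \<and> \<tau> (Suc l) - \<tau> l < \<rho>" if "l < j" for l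
        using elim(1) g that j \<rho> by (auto simp: \<tau>_def max_def dest!: spec[of _ l])
      have \<tau>0: "\<tau> 0 = t" using g t by (simp add: \<tau>_def)
      have \<tau>01: "\<tau> l \<in> {t..1}" if "l \<le> d" for l using T01[OF that] t by (auto simp: \<tau>_def)
      have sub: "{\<tau> 0..\<tau> j} \<subseteq> {0..1}" using \<tau>01[OF j] t \<tau>0 by auto
      have cv: "continuous_on {0..1} (v t)" by (rule cont_v_section[OF t])
      have inc: "J t (T d (Suc l)) - J t (T d l) = integral {\<tau> l..\<tau> (Suc l)} (v t)" if "l < j" for l
      proof -
        have le: "t \<le> \<tau> l" "\<tau> l \<le> \<tau> (Suc l)" "\<tau> (Suc l) \<le> 1"
          using step[OF that] \<tau>01[of "Suc l"] that j by (auto simp: \<tau>_def)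
        then have "{t..\<tau> (Suc l)} \<subseteq> {0..1}" using t by auto
        then have "v t integrable_on {t..\<tau> (Suc l)}"
          by (intro integrable_continuous_interval continuous_on_subset[OF cv])
        then have "integral {t..\<tau> l} (v t) + integral {\<tau> l..\<tau> (Suc l)} (v t) = integral {t..\<tau> (Suc l)} (v t)"
          using le by (intro Henstock_Kurzweil_Integration.integral_combine) auto
        then show ?thesis by (simp add: J_def \<tau>_def)
      qed
      have \<kappa>eq: "\<kappa> \<xi> (max 0 (T d (Suc l) - t)) = \<kappa> \<xi> (\<tau> (Suc l) - t)" for l
        by (auto simp: \<tau>_def max_def intro!: arg_cong[where f = "\<kappa> \<xi>"])
      have h: "\<sigma>h T d \<xi> t j = (\<Sum>l<j. \<kappa> \<xi> (\<tau> (Suc l) - t) * integral {\<tau> l..\<tau> (Suc l)} (v t))"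
        unfolding \<sigma>h_def \<kappa>eq using inc by (intro sum.cong) auto
      have s: "\<sigma> \<xi> t (T d j) = integral {\<tau> 0..\<tau> j} (\<lambda>u. \<kappa> \<xi> (max 0 (u - t)) * v t u)"
        unfolding \<tau>0 by (simp add: \<sigma>_def \<tau>_def)
      have ck: "continuous_on {0..1} (\<lambda>u. \<kappa> \<xi> (max 0 (u - t)))"
        using t by (intro continuous_on_compose2[OF continuous_on_section[OF cont_\<kappa> \<xi>]] continuous_intros) auto
      have "\<bar>\<sigma>h T d \<xi> t j - \<sigma> \<xi> t (T d j)\<bar> \<le> e' * Bv * (\<tau> j - \<tau> 0)"
        unfolding h s
      proof (rule weighted_partition_sum_error)
        fix l x assume l: "l < j" and x: "\<tau> l \<le> x" "x \<le> \<tau> (Suc l)"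
        have "t \<le> x" "x \<le> 1" using x \<tau>01[of l] \<tau>01[of "Suc l"] l j by auto
        then show "\<bar>\<kappa> \<xi> (\<tau> (Suc l) - t) - \<kappa> \<xi> (max 0 (x - t))\<bar> \<le> e'"
          using step[OF l] x t \<tau>01[of "Suc l"] l j by (intro u' \<xi>) auto
      qed (use step sub cv ck Bv(2) t in \<open>auto intro: continuous_on_subset\<close>)
      also have "\<dots> \<le> e' * Bv * 1" using \<tau>01[OF j] \<tau>0 t e' Bv by (intro mult_left_mono) auto
      also have "\<dots> = e" using Bv by (simp add: e'_def)
      finally show "\<bar>\<sigma>h T d \<xi> t j - \<sigma> \<xi> t (T d j)\<bar> \<le> e" .
    qed
  qed
qed

section \<open>Limits in the number of maturities, then in the number of time steps\<close>

lemma \<sigma>_sq_average_uniform_limit: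
  assumes H4: "H4 \<mu> T"
    and grid: "\<And>d. d \<ge> 1 \<Longrightarrow> T d 0 = 0 \<and> T d d \<le> 1 \<and> (\<forall>j<d. T d j < T d (Suc j))"
  shows "uniform_limit (\<Theta> \<times> {0..1}) (\<lambda>d p. (\<Sum>j<d. (\<sigma> (fst p) (snd p) (T d (Suc j)))\<^sup>2) / real d)
           (\<lambda>p. S \<mu> (fst p) (snd p)) sequentially"
  unfolding S_def
  by (rule grid_average_uniform_limit[OF H4 grid, where h = "\<lambda>p x. (\<sigma> (fst p) (snd p) x)\<^sup>2"])
     (use cont_\<sigma> in \<open>auto intro!: compact_Times compact_\<Theta> continuous_intros simp: case_prod_beta\<close>)

text \<open>The grid averages are finite sums of continuous functions, and continuity passes to
  their uniform limit.\<close>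

lemma cont_S:
  assumes H4: "H4 \<mu> T"
    and grid: "\<And>d. d \<ge> 1 \<Longrightarrow> T d 0 = 0 \<and> T d d \<le> 1 \<and> (\<forall>j<d. T d j < T d (Suc j))"
  shows "continuous_on (\<Theta> \<times> {0..1}) (\<lambda>p. S \<mu> (fst p) (snd p))"
proof (rule uniform_limit_theorem[OF _ \<sigma>_sq_average_uniform_limit[OF H4 grid]])
  have "continuous_on (\<Theta> \<times> {0..1}) (\<lambda>p. \<sigma> (fst p) (snd p) (T d (Suc j)))" if "j < d" for d j
  proof -
    have "T d (Suc j) \<in> {0..1}" using grid_in_unit_interval[OF grid, of d "Suc j"] that by simp
    then have "continuous_on (\<Theta> \<times> {0..1}) (\<lambda>p. (\<lambda>(p, x). \<sigma> (fst p) (snd p) x) (p, T d (Suc j)))"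
      by (intro continuous_on_compose2[OF cont_\<sigma>] continuous_intros) auto
    then show ?thesis by simp
  qed
  then show "\<forall>\<^sub>F d in sequentially. continuous_on (\<Theta> \<times> {0..1})
      (\<lambda>p. (\<Sum>j<d. (\<sigma> (fst p) (snd p) (T d (Suc j)))\<^sup>2) / real d)"
    unfolding divide_inverse by (intro always_eventually allI continuous_intros) auto
qed auto

lemma S_nonneg: "S \<mu> \<xi> t \<ge> 0"
  unfolding S_def by (intro integral_nonneg_AE) auto

lemma \<sigma>h_sq_average_uniform_limit:
  assumes H4: "H4 \<mu> T"
    and grid: "\<And>d. d \<ge> 1 \<Longrightarrow> T d 0 = 0 \<and> T d d \<le> 1 \<and> (\<forall>j<d. T d j < T d (Suc j))"
    and e: "e > 0"
  shows "eventually (\<lambda>d. \<forall>\<xi>\<in>\<Theta>. \<forall>t\<in>{0..1}.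
      \<bar>(\<Sum>j<d. (\<sigma>h T d \<xi> t (Suc j))\<^sup>2) / real d - S \<mu> \<xi> t\<bar> \<le> e) sequentially"
proof -
  obtain B where B: "B > 0" "\<And>\<xi> t x. \<xi> \<in> \<Theta> \<Longrightarrow> t \<in> {0..1} \<Longrightarrow> x \<in> {0..1} \<Longrightarrow> \<bar>\<sigma> \<xi> t x\<bar> \<le> B"
    using \<sigma>_bounded by metis
  \<comment> \<open>The cap at 1 allows r * (r + 2 * B) \<le> r * (1 + 2 * B), which the second
    entry brings down to e/2.\<close>
  define r where "r = min 1 (e / (2 * (1 + 2 * B)))"
  have r: "r > 0" "r \<le> 1" "r * (1 + 2 * B) \<le> e / 2"
  proof -
    show "r > 0" "r \<le> 1" using e B by (auto simp: r_def)
    have "r * (1 + 2 * B) \<le> e / (2 * (1 + 2 * B)) * (1 + 2 * B)"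
      using B by (intro mult_right_mono) (auto simp: r_def)
    also have "\<dots> = e / 2" using B by (simp add: divide_simps)
    finally show "r * (1 + 2 * B) \<le> e / 2" .
  qed
  have "eventually (\<lambda>d. \<forall>p\<in>\<Theta> \<times> {0..1}. dist ((\<Sum>j<d. (\<sigma> (fst p) (snd p) (T d (Suc j)))\<^sup>2) / real d) (S \<mu> (fst p) (snd p)) < e / 2) sequentially"
    using uniform_limitD[OF \<sigma>_sq_average_uniform_limit[OF H4 grid], of "e / 2"] e by simp
  moreover have "eventually (\<lambda>d. \<forall>\<xi>\<in>\<Theta>. \<forall>t\<in>{0..1}. \<forall>j\<le>d. \<bar>\<sigma>h T d \<xi> t j - \<sigma> \<xi> t (T d j)\<bar> \<le> r) sequentially"
    by (rule \<sigma>h_uniform_approx[OF H4 grid r(1)])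
  ultimately show ?thesis
    using eventually_ge_at_top[of 1]
  proof eventually_elim
    case (elim d)
    show ?case
    proof (intro ballI)
      fix \<xi> t assume \<xi>: "\<xi> \<in> \<Theta>" and t: "t \<in> {0..1::real}"
      have T01: "T d (Suc j) \<in> {0..1}" if "j < d" for j
        using grid_in_unit_interval[OF grid, of d "Suc j"] that by simp
      have "\<bar>(\<Sum>j<d. (\<sigma>h T d \<xi> t (Suc j))\<^sup>2) - (\<Sum>j<d. (\<sigma> \<xi> t (T d (Suc j)))\<^sup>2)\<bar>
          \<le> (\<Sum>j<d. \<bar>(\<sigma>h T d \<xi> t (Suc j))\<^sup>2 - (\<sigma> \<xi> t (T d (Suc j)))\<^sup>2\<bar>)"
        by (simp add: sum_subtractf[symmetric])
      also have "\<dots> \<le> (\<Sum>j<d. e / 2)"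
      proof (rule sum_mono)
        fix j assume "j \<in> {..<d}"
        then have j: "j < d" by simp
        \<comment> \<open>The factor 1 plays the role of the increment \<open>D\<close>, so the
          estimate for squared increments applies.\<close>
        have "\<bar>\<sigma>h T d \<xi> t (Suc j) - \<sigma> \<xi> t (T d (Suc j)) * 1\<bar> \<le> r" using elim(2) \<xi> t j by simp
        from sq_diff_perturbation[OF this B(2)[OF \<xi> t T01[OF j]]]
        have "\<bar>(\<sigma>h T d \<xi> t (Suc j))\<^sup>2 - (\<sigma> \<xi> t (T d (Suc j)))\<^sup>2\<bar> \<le> r * (r + 2 * B)" by simp
        also have "\<dots> \<le> r * (1 + 2 * B)" using r by (intro mult_left_mono) auto
        finally show "\<bar>(\<sigma>h T d \<xi> t (Suc j))\<^sup>2 - (\<sigma> \<xi> t (T d (Suc j)))\<^sup>2\<bar> \<le> e / 2" using r(3) by simp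
      qed
      finally have "\<bar>(\<Sum>j<d. (\<sigma>h T d \<xi> t (Suc j))\<^sup>2) / real d - (\<Sum>j<d. (\<sigma> \<xi> t (T d (Suc j)))\<^sup>2) / real d\<bar> \<le> e / 2"
        using elim(3) by (simp add: diff_divide_distrib[symmetric] field_simps)
      moreover have "\<bar>(\<Sum>j<d. (\<sigma> \<xi> t (T d (Suc j)))\<^sup>2) / real d - S \<mu> \<xi> t\<bar> < e / 2"
        using elim(1) \<xi> t by (force simp: dist_real_def)
      ultimately show "\<bar>(\<Sum>j<d. (\<sigma>h T d \<xi> t (Suc j))\<^sup>2) / real d - S \<mu> \<xi> t\<bar> \<le> e" by linarith
    qed
  qed
qed

text \<open>The contrast is compared with \<open>G\<close>, where averages of squared \<sigma>h
  become \<open>S\<close> and normalised squared increments become \<open>S\<close> at \<theta>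
  times n D^2. \<open>G\<close> is a Riemann sum plus a weighted sum of squared increments, and
  their limits are known. The hypothesis \<open>qv\<close> with weight 1 also bounds the total
  quadratic variation, on which every error bound rests.\<close>

lemma U_uniform_limit:
  fixes n d :: "nat \<Rightarrow> nat"
  assumes H4: "H4 \<mu> T"
    and grid: "\<And>d. d \<ge> 1 \<Longrightarrow> T d 0 = 0 \<and> T d d \<le> 1 \<and> (\<forall>j<d. T d j < T d (Suc j))"
    and eps: "\<epsilon> > 0"
    and n: "filterlim n at_top sequentially" and d: "filterlim d at_top sequentially"
    and qv: "\<And>h. continuous_on {0..1} h \<Longrightarrow>
       (\<lambda>m. \<Sum>i<n m. h (real i / real (n m)) * (w (real (Suc i) / real (n m)) - w (real i / real (n m)))\<^sup>2)
          \<longlonglongrightarrow> integral {0..1} h"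
  shows "uniform_limit \<Theta> (\<lambda>m. U T \<epsilon> (n m) (d m))
     (\<lambda>\<xi>. integral {0..1} (\<lambda>t. ln (S \<mu> \<xi> t + \<epsilon>) + (S \<mu> \<theta> t + \<epsilon>) / (S \<mu> \<xi> t + \<epsilon>))) sequentially"
proof -
  define D where "D m i = w (real (Suc i) / real (n m)) - w (real i / real (n m))" for m i
  define p where "p m i = real i / real (n m)" for m i
  define Q where "Q m = (\<Sum>i<n m. (D m i)\<^sup>2)" for m
  have p01: "p m i \<in> {0..1}" if "i < n m" for m i using that by (simp add: p_def)
  have "Q \<longlonglongrightarrow> integral {0..1} (\<lambda>_::real. 1::real)"
    using qv[of "\<lambda>_. 1"] by (simp add: Q_def[abs_def] D_def)
  then have "Bseq Q" by (intro convergent_imp_Bseq convergentI)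
  then obtain CQ where CQ: "CQ > 0" "\<And>m. \<bar>Q m\<bar> \<le> CQ" unfolding Bseq_def by auto
  have Q0: "Q m \<ge> 0" for m by (simp add: Q_def sum_nonneg)
  have cS: "continuous_on (\<Theta> \<times> {0..1}) (\<lambda>p. S \<mu> (fst p) (snd p))" by (rule cont_S[OF H4 grid])
  have cSt: "continuous_on (\<Theta> \<times> {0..1}) (\<lambda>p. S \<mu> \<theta> (snd p))"
    using continuous_on_compose2[OF cS, of "\<Theta> \<times> {0..1}" "\<lambda>p. (\<theta>, snd p)"] \<theta>
    by (force intro!: continuous_intros)
  have Sp: "S \<mu> \<xi> t + \<epsilon> > 0" for \<xi> t using S_nonneg[of \<mu> \<xi> t] eps by simp
  then have Snz: "S \<mu> \<xi> t + \<epsilon> \<noteq> 0" for \<xi> t using less_imp_neq by metis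
  \<comment> \<open>The summand of the contrast is separated: \<open>h1\<close> meets the uniform
    weights 1/n, and \<open>h2\<close> collects what multiplies the squared increments.\<close>
  define h1 where "h1 \<xi> t = ln (S \<mu> \<xi> t + \<epsilon>) + \<epsilon> / (S \<mu> \<xi> t + \<epsilon>)" for \<xi> t
  define h2 where "h2 \<xi> t = S \<mu> \<theta> t / (S \<mu> \<xi> t + \<epsilon>)" for \<xi> t
  have c1: "continuous_on (\<Theta> \<times> {0..1}) (\<lambda>(\<xi>, t). h1 \<xi> t)"
    unfolding h1_def case_prod_beta using cS Sp Snz by (intro continuous_intros) auto
  have c2: "continuous_on (\<Theta> \<times> {0..1}) (\<lambda>(\<xi>, t). h2 \<xi> t)"
    unfolding h2_def case_prod_beta using cS cSt Snz by (intro continuous_intros) auto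
  have int_lip: "\<bar>integral {0..1} f - integral {0..1} g\<bar> \<le> 1 * e"
    if "continuous_on {0..1} f" "continuous_on {0..1} g" "\<And>x. x \<in> {0..1} \<Longrightarrow> \<bar>f x - g x\<bar> \<le> e"
    for f g :: "real \<Rightarrow> real" and e
  proof -
    have "integral {0..1} f - integral {0..1} g = integral {0..1} (\<lambda>x. f x - g x)"
      using that by (simp add: Henstock_Kurzweil_Integration.integral_diff integrable_continuous_interval)
    also have "norm \<dots> \<le> e * (1 - 0)" using that by (intro integral_bound continuous_intros) auto
    finally show ?thesis by simp
  qed
  have lim1: "uniform_limit \<Theta> (\<lambda>m \<xi>. (\<Sum>i<n m. h1 \<xi> (p m i)) / real (n m)) (\<lambda>\<xi>. integral {0..1} (h1 \<xi>)) sequentially"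
  proof (rule uniform_limit_functional[OF compact_\<Theta> c1, where C = 1
        and L = "\<lambda>m f. (\<Sum>i<n m. f (p m i)) / real (n m)" and L' = "integral {0..1}"])
    fix f :: "real \<Rightarrow> real" assume f: "continuous_on {0..1} f"
    from filterlim_compose[OF riemann_sum_tendsto_integral[OF f] n]
    show "(\<lambda>m. (\<Sum>i<n m. f (p m i)) / real (n m)) \<longlonglongrightarrow> integral {0..1} f" by (simp add: p_def)
  next
    fix m and f g :: "real \<Rightarrow> real" and e
    assume fg: "\<And>x. x \<in> {0..1} \<Longrightarrow> \<bar>f x - g x\<bar> \<le> e"
    have e0: "e \<ge> 0" using fg[of 0] by simp
    have "\<bar>(\<Sum>i<n m. f (p m i)) - (\<Sum>i<n m. g (p m i))\<bar> \<le> (\<Sum>i<n m. \<bar>f (p m i) - g (p m i)\<bar>)"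
      by (simp add: sum_subtractf[symmetric])
    also have "\<dots> \<le> (\<Sum>i<n m. e)" using p01 fg by (intro sum_mono) blast
    finally show "\<bar>(\<Sum>i<n m. f (p m i)) / real (n m) - (\<Sum>i<n m. g (p m i)) / real (n m)\<bar> \<le> 1 * e"
      using e0 by (cases "n m = 0") (auto simp: diff_divide_distrib[symmetric] field_simps)
  qed (rule int_lip)
  have lim2: "uniform_limit \<Theta> (\<lambda>m \<xi>. \<Sum>i<n m. h2 \<xi> (p m i) * (D m i)\<^sup>2) (\<lambda>\<xi>. integral {0..1} (h2 \<xi>)) sequentially"
  \<comment> \<open>\<open>CQ\<close> is a Lipschitz constant for the weighted sums and 1 for the
    integral; their sum serves both.\<close>
  proof (rule uniform_limit_functional[OF compact_\<Theta> c2, where C = "CQ + 1"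
        and L = "\<lambda>m f. \<Sum>i<n m. f (p m i) * (D m i)\<^sup>2" and L' = "integral {0..1}"])
    fix f :: "real \<Rightarrow> real" assume f: "continuous_on {0..1} f"
    from qv[OF f]
    show "(\<lambda>m. \<Sum>i<n m. f (p m i) * (D m i)\<^sup>2) \<longlonglongrightarrow> integral {0..1} f" by (simp add: p_def D_def)
  next
    fix f g :: "real \<Rightarrow> real" and e
    assume f: "continuous_on {0..1} f" and g: "continuous_on {0..1} g"
      and fg: "\<And>x. x \<in> {0..1} \<Longrightarrow> \<bar>f x - g x\<bar> \<le> e"
    have e0: "e \<ge> 0" using fg[of 0] by simp
    have "0 \<le> CQ * e" using CQ e0 by simp
    then show "\<bar>integral {0..1} f - integral {0..1} g\<bar> \<le> (CQ + 1) * e"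
      using int_lip[OF f g fg] by (simp add: algebra_simps)
    fix m
    have "\<bar>(\<Sum>i<n m. f (p m i) * (D m i)\<^sup>2) - (\<Sum>i<n m. g (p m i) * (D m i)\<^sup>2)\<bar>
        \<le> (\<Sum>i<n m. \<bar>f (p m i) * (D m i)\<^sup>2 - g (p m i) * (D m i)\<^sup>2\<bar>)"
      by (simp add: sum_subtractf[symmetric])
    also have "\<dots> \<le> (\<Sum>i<n m. e * (D m i)\<^sup>2)"
    proof (rule sum_mono)
      fix i assume "i \<in> {..<n m}"
      then have "\<bar>f (p m i) - g (p m i)\<bar> * (D m i)\<^sup>2 \<le> e * (D m i)\<^sup>2"
        using p01[of i m] fg by (intro mult_right_mono) auto
      then show "\<bar>f (p m i) * (D m i)\<^sup>2 - g (p m i) * (D m i)\<^sup>2\<bar> \<le> e * (D m i)\<^sup>2"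
        by (simp add: left_diff_distrib[symmetric] abs_mult)
    qed
    also have "\<dots> = e * Q m" by (simp add: Q_def sum_distrib_left)
    also have "\<dots> \<le> e * (CQ + 1)" using CQ(2)[of m] e0 by (intro mult_left_mono) auto
    finally show "\<bar>(\<Sum>i<n m. f (p m i) * (D m i)\<^sup>2) - (\<Sum>i<n m. g (p m i) * (D m i)\<^sup>2)\<bar> \<le> (CQ + 1) * e"
      by (simp add: mult.commute)
  qed
  define G where "G m \<xi> = (\<Sum>i<n m. h1 \<xi> (p m i)) / real (n m) + (\<Sum>i<n m. h2 \<xi> (p m i) * (D m i)\<^sup>2)" for m \<xi>
  have lim_eq: "integral {0..1} (h1 \<xi>) + integral {0..1} (h2 \<xi>)
     = integral {0..1} (\<lambda>t. ln (S \<mu> \<xi> t + \<epsilon>) + (S \<mu> \<theta> t + \<epsilon>) / (S \<mu> \<xi> t + \<epsilon>))" if "\<xi> \<in> \<Theta>" for \<xi>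
  proof -
    have "integral {0..1} (h1 \<xi>) + integral {0..1} (h2 \<xi>) = integral {0..1} (\<lambda>t. h1 \<xi> t + h2 \<xi> t)"
      by (intro Henstock_Kurzweil_Integration.integral_add[symmetric] integrable_continuous_interval
          continuous_on_section[OF c1 that] continuous_on_section[OF c2 that])
    also have "(\<lambda>t. h1 \<xi> t + h2 \<xi> t) = (\<lambda>t. ln (S \<mu> \<xi> t + \<epsilon>) + (S \<mu> \<theta> t + \<epsilon>) / (S \<mu> \<xi> t + \<epsilon>))"
      by (simp add: h1_def h2_def add_divide_distrib fun_eq_iff)
    finally show ?thesis .
  qed
  have limG: "uniform_limit \<Theta> G
     (\<lambda>\<xi>. integral {0..1} (\<lambda>t. ln (S \<mu> \<xi> t + \<epsilon>) + (S \<mu> \<theta> t + \<epsilon>) / (S \<mu> \<xi> t + \<epsilon>))) sequentially"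
    using uniform_limit_add[OF lim1 lim2] unfolding G_def[abs_def]
    by (rule uniform_limit_cong'[THEN iffD1, rotated 2]) (auto simp: lim_eq)
  obtain B where B: "B > 0" "\<And>\<xi> t x. \<xi> \<in> \<Theta> \<Longrightarrow> t \<in> {0..1} \<Longrightarrow> x \<in> {0..1} \<Longrightarrow> \<bar>\<sigma> \<xi> t x\<bar> \<le> B"
    using \<sigma>_bounded by metis
  obtain C where C: "C > 0" "\<And>t t' x. 0 \<le> t \<Longrightarrow> t \<le> t' \<Longrightarrow> t' \<le> 1 \<Longrightarrow> x \<in> {0..1} \<Longrightarrow>
     \<bar>J t' x - J t x - \<sigma> \<theta> t x * (w t' - w t)\<bar> \<le> C * ((w t' - w t)\<^sup>2 + (t' - t))"
    using J_increment by metis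
  obtain BS where BS: "BS > 0" "\<And>t. t \<in> {0..1} \<Longrightarrow> S \<mu> \<theta> t \<le> BS"
    by (rule continuous_on_compact_abs_bound[OF compact_Times[OF compact_\<Theta> compact_Icc] cS]) (use \<theta> in force)
  \<comment> \<open>The error of one increment is c = C (D^2 + 1/n), and its cofactor c + 2 B |D| is
    at most (2 C + 2 B) r once |D|, D^2 and 1/n are at most \<open>r\<close>.\<close>
  define C' where "C' = C * (2 * C + 2 * B)"
  have C': "C' > 0" using C B by (simp add: C'_def)
  \<comment> \<open>The three terms of \<open>contrast_term_perturbation\<close>, with the common
    factor \<open>r\<close> taken out, averaged over time and with the total quadratic variation
    replaced by its bound \<open>CQ\<close>.\<close>
  define Kc where "Kc = 1 / \<epsilon> + (C' * (CQ + 1) + CQ) / \<epsilon> + (BS * CQ + \<epsilon>) / \<epsilon>\<^sup>2"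
  have Kc: "Kc > 0" using eps C' CQ BS by (simp add: Kc_def add_pos_pos)
  have close: "eventually (\<lambda>m. \<forall>\<xi>\<in>\<Theta>. \<bar>U T \<epsilon> (n m) (d m) \<xi> - G m \<xi>\<bar> \<le> r * Kc) sequentially"
    if r: "0 < r" "r \<le> 1" for r
  proof -
    have "eventually (\<lambda>d. \<forall>\<xi>\<in>\<Theta>. \<forall>t\<in>{0..1}. \<bar>(\<Sum>j<d. (\<sigma>h T d \<xi> t (Suc j))\<^sup>2) / real d - S \<mu> \<xi> t\<bar> \<le> r) sequentially"
      by (rule \<sigma>h_sq_average_uniform_limit[OF H4 grid r(1)])
    then have e1: "eventually (\<lambda>m. \<forall>\<xi>\<in>\<Theta>. \<forall>t\<in>{0..1}. \<bar>(\<Sum>j<d m. (\<sigma>h T (d m) \<xi> t (Suc j))\<^sup>2) / real (d m) - S \<mu> \<xi> t\<bar> \<le> r) sequentially"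
      using d by (rule eventually_compose_filterlim)
    have "uniform_limit (\<Theta> \<times> {0..1}) (\<lambda>d p. (\<Sum>j<d. (\<sigma> (fst p) (snd p) (T d (Suc j)))\<^sup>2) / real d)
           (\<lambda>p. S \<mu> (fst p) (snd p)) sequentially"
      by (rule \<sigma>_sq_average_uniform_limit[OF H4 grid])
    from eventually_compose_filterlim[OF uniform_limitD[OF this r(1)] d]
    have e2: "eventually (\<lambda>m. \<forall>p\<in>\<Theta> \<times> {0..1}. dist ((\<Sum>j<d m. (\<sigma> (fst p) (snd p) (T (d m) (Suc j)))\<^sup>2) / real (d m)) (S \<mu> (fst p) (snd p)) < r) sequentially" .
    obtain \<rho> where \<rho>: "\<rho> > 0" "\<And>x y. x \<in> {0..1} \<Longrightarrow> y \<in> {0..1} \<Longrightarrow> \<bar>x - y\<bar> < \<rho> \<Longrightarrow> \<bar>w x - w y\<bar> < r"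
      using uniform_continuity_real[OF cont_w r(1)] by blast
    obtain N1 :: nat where N1: "real N1 > 1 / min \<rho> r" using reals_Archimedean2 by blast
    have e3: "eventually (\<lambda>m. n m \<ge> N1) sequentially" "eventually (\<lambda>m. d m \<ge> 1) sequentially"
      using n d by (auto simp: filterlim_at_top)
    show ?thesis
      using e1 e2 e3
    proof eventually_elim
      case (elim m)
      have nN: "real (n m) > 1 / min \<rho> r" using N1 elim(3) by linarith
      then have n0: "real (n m) > 0" using \<rho>(1) r(1) by (smt (verit) divide_pos_pos)
      have nr: "1 / real (n m) < \<rho>" "1 / real (n m) \<le> r"
      proof -
        have "1 / a < q" if "1 / q < a" "q > 0" "a > 0" for a q :: real using that by (simp add: field_simps)
        from this[OF nN] have "1 / real (n m) < min \<rho> r" using n0 \<rho>(1) r(1) by simp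
        then show "1 / real (n m) < \<rho>" "1 / real (n m) \<le> r" by auto
      qed
      have d0: "real (d m) > 0" using elim(4) by simp
      have T01: "T (d m) (Suc j) \<in> {0..1}" if "j < d m" for j
        using grid_in_unit_interval[OF grid, of "d m" "Suc j"] that by simp
      define X where "X i = (\<Sum>j<d m. real (n m) * (J (real (Suc i) / real (n m)) (T (d m) (Suc j)) - J (p m i) (T (d m) (Suc j)))\<^sup>2) / real (d m)" for i
      have ps: "real (Suc i) / real (n m) = p m i + 1 / real (n m)" for i
        by (simp add: p_def add_divide_distrib)
      have p1: "real (Suc i) / real (n m) \<in> {0..1}" if "i < n m" for i using that by simp
      \<comment> \<open>Two replacements: increments of \<open>J\<close> by \<sigma> D, which costs
        the first term, and then the grid average \<open>Sd\<close> by \<open>S\<close>, which costs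
        the second.\<close>
      have X: "\<bar>X i - S \<mu> \<theta> (p m i) * (real (n m) * (D m i)\<^sup>2)\<bar>
          \<le> r * C' * (real (n m) * (D m i)\<^sup>2 + 1) + r * (real (n m) * (D m i)\<^sup>2)" if i: "i < n m" for i
      proof -
        have Dr: "\<bar>D m i\<bar> \<le> r"
          using \<rho>(2)[of "real (Suc i) / real (n m)" "p m i"] p01[OF i] p1[OF i] nr(1) n0
          unfolding D_def p_def[of m i, symmetric] ps by (simp add: less_imp_le)
        have Y: "\<bar>(J (real (Suc i) / real (n m)) (T (d m) (Suc j)) - J (p m i) (T (d m) (Suc j)))\<^sup>2
             - (\<sigma> \<theta> (p m i) (T (d m) (Suc j)))\<^sup>2 * (D m i)\<^sup>2\<bar> \<le> r * C' * ((D m i)\<^sup>2 + 1 / real (n m))"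
          (is "?l \<le> _") if j: "j < d m" for j
        proof -
          define c where "c = C * ((D m i)\<^sup>2 + 1 / real (n m))"
          have "\<bar>J (real (Suc i) / real (n m)) (T (d m) (Suc j)) - J (p m i) (T (d m) (Suc j))
             - \<sigma> \<theta> (p m i) (T (d m) (Suc j)) * D m i\<bar> \<le> c"
            using C(2)[of "p m i" "real (Suc i) / real (n m)" "T (d m) (Suc j)"] p01[OF i] p1[OF i] T01[OF j]
            unfolding c_def D_def p_def[of m i, symmetric] ps by simp
          from sq_diff_perturbation[OF this B(2)[OF \<theta> p01[OF i] T01[OF j]]]
          have "?l \<le> c * (c + 2 * B * \<bar>D m i\<bar>)" .
          also have "c + 2 * B * \<bar>D m i\<bar> \<le> C * (2 * r) + 2 * B * r"
          proof (rule add_mono)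
            have "(D m i)\<^sup>2 = \<bar>D m i\<bar> * \<bar>D m i\<bar>" by (simp add: power2_eq_square)
            also have "\<dots> \<le> r * 1" using Dr r by (intro mult_mono) auto
            finally show "c \<le> C * (2 * r)" unfolding c_def using nr(2) C(1) by (intro mult_left_mono) auto
            show "2 * B * \<bar>D m i\<bar> \<le> 2 * B * r" using Dr B(1) by (intro mult_left_mono) auto
          qed
          then have "c * (c + 2 * B * \<bar>D m i\<bar>) \<le> c * (C * (2 * r) + 2 * B * r)"
            using C(1) by (intro mult_left_mono) (auto simp: c_def)
          finally show ?thesis by (simp add: c_def C'_def algebra_simps)
        qed
        define Sd where "Sd = (\<Sum>j<d m. (\<sigma> \<theta> (p m i) (T (d m) (Suc j)))\<^sup>2) / real (d m)"
        have eq: "X i - Sd * (real (n m) * (D m i)\<^sup>2)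
           = (\<Sum>j<d m. real (n m) * ((J (real (Suc i) / real (n m)) (T (d m) (Suc j)) - J (p m i) (T (d m) (Suc j)))\<^sup>2
             - (\<sigma> \<theta> (p m i) (T (d m) (Suc j)))\<^sup>2 * (D m i)\<^sup>2)) / real (d m)"
        proof -
          have "Sd * (real (n m) * (D m i)\<^sup>2)
              = (\<Sum>j<d m. (\<sigma> \<theta> (p m i) (T (d m) (Suc j)))\<^sup>2 * (real (n m) * (D m i)\<^sup>2)) / real (d m)"
            unfolding Sd_def by (simp add: sum_distrib_right)
          also have "\<dots> = (\<Sum>j<d m. real (n m) * ((\<sigma> \<theta> (p m i) (T (d m) (Suc j)))\<^sup>2 * (D m i)\<^sup>2)) / real (d m)"
            by (simp only: mult.left_commute)
          finally show ?thesis
            unfolding X_def by (simp only: right_diff_distrib sum_subtractf diff_divide_distrib)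
        qed
        have "\<bar>X i - Sd * (real (n m) * (D m i)\<^sup>2)\<bar>
            \<le> (\<Sum>j<d m. real (n m) * (r * C' * ((D m i)\<^sup>2 + 1 / real (n m)))) / real (d m)"
          unfolding eq abs_divide abs_of_nat
        proof (intro divide_right_mono abs_sum_le)
          fix j assume "j < d m"
          from mult_left_mono[OF Y[OF this], of "real (n m)"] n0
          show "\<bar>real (n m) * ((J (real (Suc i) / real (n m)) (T (d m) (Suc j)) - J (p m i) (T (d m) (Suc j)))\<^sup>2
             - (\<sigma> \<theta> (p m i) (T (d m) (Suc j)))\<^sup>2 * (D m i)\<^sup>2)\<bar> \<le> real (n m) * (r * C' * ((D m i)\<^sup>2 + 1 / real (n m)))"
            by (simp only: abs_mult abs_of_nat)
        qed simp
        also have "\<dots> = r * C' * (real (n m) * (D m i)\<^sup>2 + 1)"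
        proof -
          have "c * (k * (a * (b + 1 / k))) / c = a * (k * b + 1)" if "k > 0" "c > 0" for a b c k :: real
            using that by (simp add: field_simps)
          from this[OF n0 d0] show ?thesis by (simp only: sum_constant card_lessThan)
        qed
        finally have "\<bar>X i - Sd * (real (n m) * (D m i)\<^sup>2)\<bar> \<le> r * C' * (real (n m) * (D m i)\<^sup>2 + 1)" .
        moreover have "\<bar>Sd * (real (n m) * (D m i)\<^sup>2) - S \<mu> \<theta> (p m i) * (real (n m) * (D m i)\<^sup>2)\<bar> \<le> r * (real (n m) * (D m i)\<^sup>2)"
        proof -
          have "\<bar>Sd - S \<mu> \<theta> (p m i)\<bar> \<le> r"
            using elim(2) \<theta> p01[OF i] unfolding Sd_def by (force simp: dist_real_def)
          then have "\<bar>Sd - S \<mu> \<theta> (p m i)\<bar> * (real (n m) * (D m i)\<^sup>2) \<le> r * (real (n m) * (D m i)\<^sup>2)"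
            by (intro mult_right_mono) auto
          then show ?thesis by (simp add: left_diff_distrib[symmetric] abs_mult)
        qed
        ultimately show ?thesis by linarith
      qed
      show ?case
      proof
        fix \<xi> assume \<xi>: "\<xi> \<in> \<Theta>"
        define Sh where "Sh i = (\<Sum>j<d m. (\<sigma>h T (d m) \<xi> (p m i) (Suc j))\<^sup>2) / real (d m)" for i
        have Sh0: "Sh i \<ge> 0" for i by (simp add: Sh_def sum_nonneg)
        define Y where "Y i = S \<mu> \<theta> (p m i) * (real (n m) * (D m i)\<^sup>2)" for i
        have Y0: "Y i \<ge> 0" for i using S_nonneg by (simp add: Y_def)
        have Uq: "U T \<epsilon> (n m) (d m) \<xi> = (\<Sum>i<n m. ln (Sh i + \<epsilon>) + (X i + \<epsilon>) / (Sh i + \<epsilon>)) / real (n m)"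
          unfolding U_def Sh_def X_def p_def by simp
        have Gq: "G m \<xi> = (\<Sum>i<n m. ln (S \<mu> \<xi> (p m i) + \<epsilon>) + (Y i + \<epsilon>) / (S \<mu> \<xi> (p m i) + \<epsilon>)) / real (n m)"
        proof -
          have "(\<Sum>i<n m. h2 \<xi> (p m i) * (D m i)\<^sup>2) = (\<Sum>i<n m. Y i / (S \<mu> \<xi> (p m i) + \<epsilon>)) / real (n m)"
            unfolding sum_divide_distrib h2_def Y_def using n0 by (intro sum.cong) auto
          then show ?thesis
            unfolding G_def h1_def by (simp add: add_divide_distrib sum.distrib)
        qed
        have tb: "\<bar>(ln (Sh i + \<epsilon>) + (X i + \<epsilon>) / (Sh i + \<epsilon>)) - (ln (S \<mu> \<xi> (p m i) + \<epsilon>) + (Y i + \<epsilon>) / (S \<mu> \<xi> (p m i) + \<epsilon>))\<bar>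
           \<le> r * (1 / \<epsilon> + (C' * (real (n m) * (D m i)\<^sup>2 + 1) + real (n m) * (D m i)\<^sup>2) / \<epsilon> + (BS * (real (n m) * (D m i)\<^sup>2) + \<epsilon>) / \<epsilon>\<^sup>2)"
          if i: "i < n m" for i
        proof -
          have "\<bar>Sh i - S \<mu> \<xi> (p m i)\<bar> \<le> r" using elim(1) \<xi> p01[OF i] by (simp add: Sh_def)
          from contrast_term_perturbation[OF eps S_nonneg Sh0 this Y0[of i], where X = "X i"]
          have "\<bar>(ln (Sh i + \<epsilon>) + (X i + \<epsilon>) / (Sh i + \<epsilon>)) - (ln (S \<mu> \<xi> (p m i) + \<epsilon>) + (Y i + \<epsilon>) / (S \<mu> \<xi> (p m i) + \<epsilon>))\<bar>
            \<le> r / \<epsilon> + \<bar>X i - Y i\<bar> / \<epsilon> + (Y i + \<epsilon>) * r / \<epsilon>\<^sup>2" .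
          also have "\<dots> \<le> r / \<epsilon> + (r * C' * (real (n m) * (D m i)\<^sup>2 + 1) + r * (real (n m) * (D m i)\<^sup>2)) / \<epsilon>
              + (BS * (real (n m) * (D m i)\<^sup>2) + \<epsilon>) * r / \<epsilon>\<^sup>2"
          proof (intro add_mono order_refl divide_right_mono mult_right_mono)
            show "\<bar>X i - Y i\<bar> \<le> r * C' * (real (n m) * (D m i)\<^sup>2 + 1) + r * (real (n m) * (D m i)\<^sup>2)"
              using X[OF i] by (simp add: Y_def)
            show "Y i \<le> BS * (real (n m) * (D m i)\<^sup>2)"
              unfolding Y_def using BS(2)[OF p01[OF i]] by (intro mult_right_mono) auto
          qed (use eps r in auto)
          also have "\<dots> = r * (1 / \<epsilon> + (C' * (real (n m) * (D m i)\<^sup>2 + 1) + real (n m) * (D m i)\<^sup>2) / \<epsilon> + (BS * (real (n m) * (D m i)\<^sup>2) + \<epsilon>) / \<epsilon>\<^sup>2)"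
            unfolding times_divide_eq_right distrib_left[of r]
            by (simp only: distrib_left[of r] mult.assoc mult_1_right times_divide_eq_right mult.commute[of _ r])
          finally show ?thesis .
        qed
        have "\<bar>U T \<epsilon> (n m) (d m) \<xi> - G m \<xi>\<bar> = \<bar>\<Sum>i<n m. (ln (Sh i + \<epsilon>) + (X i + \<epsilon>) / (Sh i + \<epsilon>))
            - (ln (S \<mu> \<xi> (p m i) + \<epsilon>) + (Y i + \<epsilon>) / (S \<mu> \<xi> (p m i) + \<epsilon>))\<bar> / real (n m)"
          unfolding Uq Gq by (simp add: diff_divide_distrib[symmetric] sum_subtractf[symmetric] abs_divide)
        also have "\<dots> \<le> (\<Sum>i<n m. r * (1 / \<epsilon> + (C' * (real (n m) * (D m i)\<^sup>2 + 1) + real (n m) * (D m i)\<^sup>2) / \<epsilon>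
            + (BS * (real (n m) * (D m i)\<^sup>2) + \<epsilon>) / \<epsilon>\<^sup>2)) / real (n m)"
          by (intro divide_right_mono abs_sum_le tb) auto
        also have "\<dots> = r * (\<Sum>i<n m. 1 / \<epsilon> + (C' * (real (n m) * (D m i)\<^sup>2 + 1) + real (n m) * (D m i)\<^sup>2) / \<epsilon>
            + (BS * (real (n m) * (D m i)\<^sup>2) + \<epsilon>) / \<epsilon>\<^sup>2) / real (n m)"
          by (simp only: sum_distrib_left)
        also have "(\<Sum>i<n m. 1 / \<epsilon> + (C' * (real (n m) * (D m i)\<^sup>2 + 1) + real (n m) * (D m i)\<^sup>2) / \<epsilon>
            + (BS * (real (n m) * (D m i)\<^sup>2) + \<epsilon>) / \<epsilon>\<^sup>2)
          = real (n m) * (1 / \<epsilon> + (C' * (Q m + 1) + Q m) / \<epsilon> + (BS * Q m + \<epsilon>) / \<epsilon>\<^sup>2)"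
        proof -
          have "1 / \<epsilon> + (C' * (N * x + 1) + N * x) / \<epsilon> + (BS * (N * x) + \<epsilon>) / \<epsilon>\<^sup>2
              = (1 / \<epsilon> + C' / \<epsilon> + \<epsilon> / \<epsilon>\<^sup>2) + (C' / \<epsilon> + 1 / \<epsilon> + BS / \<epsilon>\<^sup>2) * N * x" for N x
            by (simp add: distrib_left distrib_right add_divide_distrib)
          \<comment> \<open>The bound is affine in N x. Expanding it for the summands, with N the
            number of steps, and again with N = 1 for \<open>Q\<close> lets the sum over time points
            be evaluated termwise.\<close>
          note eq = this this[of 1, unfolded mult_1 mult_1_right]
          show ?thesis
            unfolding eq Q_def
            by (simp add: sum.distrib sum_distrib_left[symmetric] distrib_left)
        qed
        also have "r * (real (n m) * (1 / \<epsilon> + (C' * (Q m + 1) + Q m) / \<epsilon> + (BS * Q m + \<epsilon>) / \<epsilon>\<^sup>2)) / real (n m)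
          = r * (1 / \<epsilon> + (C' * (Q m + 1) + Q m) / \<epsilon> + (BS * Q m + \<epsilon>) / \<epsilon>\<^sup>2)"
          using n0 by simp
        also have "\<dots> \<le> r * Kc"
          unfolding Kc_def using CQ(2)[of m] r eps C' BS(1)
          by (intro mult_left_mono add_mono divide_right_mono order_refl) auto
        finally show "\<bar>U T \<epsilon> (n m) (d m) \<xi> - G m \<xi>\<bar> \<le> r * Kc" .
      qed
    qed
  qed
  show ?thesis
  proof (rule uniform_limitI)
    fix e :: real assume e: "e > 0"
    define r where "r = min 1 (e / (4 * Kc))"
    have r: "0 < r" "r \<le> 1" using e Kc by (auto simp: r_def)
    have "r * Kc \<le> e / (4 * Kc) * Kc" using Kc by (intro mult_right_mono) (auto simp: r_def)
    also have "\<dots> = e / 4" using Kc by simp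
    finally have rK: "r * Kc \<le> e / 4" .
    have e2: "0 < e / 2" using e by simp
    from close[OF r] uniform_limitD[OF limG e2]
    show "\<forall>\<^sub>F m in sequentially. \<forall>\<xi>\<in>\<Theta>. dist (U T \<epsilon> (n m) (d m) \<xi>)
        (integral {0..1} (\<lambda>t. ln (S \<mu> \<xi> t + \<epsilon>) + (S \<mu> \<theta> t + \<epsilon>) / (S \<mu> \<xi> t + \<epsilon>))) < e"
    proof eventually_elim
      case (elim m)
      show ?case
      proof
        fix \<xi> assume "\<xi> \<in> \<Theta>"
        then show "dist (U T \<epsilon> (n m) (d m) \<xi>)
          (integral {0..1} (\<lambda>t. ln (S \<mu> \<xi> t + \<epsilon>) + (S \<mu> \<theta> t + \<epsilon>) / (S \<mu> \<xi> t + \<epsilon>))) < e"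
          using elim(1)[rule_format, of \<xi>] elim(2)[rule_format, of \<xi>] rK e unfolding dist_real_def by linarith
      qed
    qed
  qed
qed

end

section \<open>The pathwise version of the forward variance\<close>

text \<open>Everything follows from 1 + y \<le> exp y applied to x and -x. The factor
  \<open>exp \<bar>x\<bar>\<close> is harmless because exponents along a fixed path are
  bounded.\<close>

lemma exp_second_order_bound:
  fixes x :: real
  shows "\<bar>exp x - 1 - x\<bar> \<le> exp \<bar>x\<bar> * x\<^sup>2"
proof -
  have a: "exp y - 1 \<le> y * exp y" for y :: real
  proof -
    have "(1 - y) * exp y \<le> exp (- y) * exp y"
      using exp_ge_add_one_self[of "- y"] by (intro mult_right_mono) auto
    also have "\<dots> = 1" by (simp add: mult_exp_exp)
    finally show ?thesis by (simp add: algebra_simps)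
  qed
  have "exp x - 1 - x \<le> x * (exp x - 1)" using a[of x] by (simp add: algebra_simps)
  also have "\<dots> \<le> exp \<bar>x\<bar> * x\<^sup>2"
  proof (cases "x \<ge> 0")
    case True
    have "x * (exp x - 1) \<le> x * (x * exp x)" using a[of x] True by (intro mult_left_mono)
    with True show ?thesis by (simp add: power2_eq_square ac_simps)
  next
    case False
    have "(- x) * (1 - exp x) \<le> (- x) * (- x)"
    proof (rule mult_left_mono)
      show "1 - exp x \<le> - x" using exp_ge_add_one_self[of x] by linarith
    qed (use False in simp)
    also have "\<dots> = 1 * x\<^sup>2" by (simp add: power2_eq_square)
    also have "\<dots> \<le> exp \<bar>x\<bar> * x\<^sup>2" by (intro mult_right_mono) auto
    finally show ?thesis by (simp add: algebra_simps)
  qed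
  finally show ?thesis using exp_ge_add_one_self[of x] by linarith
qed


text \<open>Here \<open>k\<close> is the slice of the kernel at the true parameter, the one that
  drives \<open>V\<close>, and \<open>k'\<close> its derivative in time, onto which integration by
  parts moves the Wiener integral.\<close>

locale C1_kernel =
  fixes k k' V0 :: "real \<Rightarrow> real"
  assumes deriv_k: "\<And>s. s \<in> {0..1} \<Longrightarrow> (k has_real_derivative k' s) (at s within {0..1})"
    and cont_k': "continuous_on {0..1} k'"
    and cont_V0: "continuous_on {0..1} V0"
begin

text \<open>The forward variance with its Wiener integral rewritten pathwise through integration by parts;
  truncating the argument of the kernel at 0 makes it continuous also where \<open>t > u\<close>.\<close>

definition expo :: "(real \<Rightarrow> real) \<Rightarrow> real \<Rightarrow> real \<Rightarrow> real" where
  "expo w t u = k (max 0 (u - t)) * w t + integral {0..t} (\<lambda>s. w s * k' (max 0 (u - s)))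
     - 1/2 * integral {0..t} (\<lambda>s. (k (max 0 (u - s)))\<^sup>2)"

definition fvar :: "(real \<Rightarrow> real) \<Rightarrow> real \<Rightarrow> real \<Rightarrow> real" where
  "fvar w t u = V0 u * exp (expo w t u)"

lemma cont_k: "continuous_on {0..1} k"
  using deriv_k by (intro DERIV_continuous_on)

lemma cont_trunc:
  fixes f :: "real \<Rightarrow> real"
  assumes "continuous_on {0..1} f"
  shows "continuous_on (({0..1} \<times> {0..1}) \<times> {0..1}) (\<lambda>y. f (max 0 (snd (fst y) - snd y)))"
  by (rule continuous_on_compose2[OF assms]) (auto intro!: continuous_intros)

lemma cont_trunc_section:
  fixes f :: "real \<Rightarrow> real"
  assumes "continuous_on {0..1} f" "u \<in> {0..1}"
  shows "continuous_on {0..1} (\<lambda>s. f (max 0 (u - s)))"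
  by (rule continuous_on_compose2[OF assms(1)]) (use assms(2) in \<open>auto intro!: continuous_intros\<close>)

lemma cont_fvar:
  assumes w: "continuous_on {0..1} w"
  shows "continuous_on ({0..1} \<times> {0..1}) (\<lambda>(t, u). fvar w t u)"
proof -
  have w': "continuous_on (({0..1} \<times> {0..1}) \<times> {0..1}) (\<lambda>y::(real \<times> real) \<times> real. w (snd y))"
    by (rule continuous_on_compose2[OF w]) (auto intro!: continuous_intros)
  have 1: "continuous_on ({0..1} \<times> {0..1}) (\<lambda>p. integral {0..fst p} (\<lambda>s. w s * k' (max 0 (snd p - s))))"
    by (rule continuous_on_integral_moving_interval[where c = 0 and d = 1])
       (use w' cont_trunc[OF cont_k'] in \<open>auto intro!: continuous_intros simp: case_prod_beta\<close>)
  have 2: "continuous_on ({0..1} \<times> {0..1}) (\<lambda>p. integral {0..fst p} (\<lambda>s. (k (max 0 (snd p - s)))\<^sup>2))"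
    by (rule continuous_on_integral_moving_interval[where c = 0 and d = 1])
       (use cont_trunc[OF cont_k] in \<open>auto intro!: continuous_intros simp: case_prod_beta\<close>)
  have 3: "continuous_on ({0..1} \<times> {0..1}) (\<lambda>p::real \<times> real. k (max 0 (snd p - fst p)))"
    by (rule continuous_on_compose2[OF cont_k]) (auto intro!: continuous_intros)
  have 4: "continuous_on ({0..1} \<times> {0..1}) (\<lambda>p::real \<times> real. V0 (snd p))"
    by (rule continuous_on_compose2[OF cont_V0]) (auto intro!: continuous_intros)
  have 5: "continuous_on ({0..1} \<times> {0..1}) (\<lambda>p::real \<times> real. w (fst p))"
    by (rule continuous_on_compose2[OF w]) (auto intro!: continuous_intros)
  show ?thesis
    unfolding fvar_def expo_def case_prod_beta by (intro continuous_intros 1 2 3 4 5)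
qed

text \<open>The exponent changes by \<delta> = k (u - t) D + \<rho> with |\<rho>| of order t' - t,
  and expanding exp to first order leaves an error of order \<delta>^2, hence of order D^2 + (t' -
  t). The Ito correction is of order t' - t and disappears in the remainder, so no stochastic
  calculus enters.\<close>

lemma fvar_increment:
  assumes w: "continuous_on {0..1} w"
  obtains C where "\<And>t t' u. 0 \<le> t \<Longrightarrow> t \<le> t' \<Longrightarrow> t' \<le> u \<Longrightarrow> u \<le> 1 \<Longrightarrow>
     \<bar>fvar w t' u - fvar w t u - k (u - t) * fvar w t u * (w t' - w t)\<bar> \<le> C * ((w t' - w t)\<^sup>2 + (t' - t))"
proof -
  obtain R where R: "R > 0" "\<And>x. x \<in> {0..1} \<Longrightarrow> \<bar>w x\<bar> \<le> R" by (rule continuous_on_compact_abs_bound[OF compact_Icc w]) blast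
  obtain Bk where Bk: "Bk > 0" "\<And>x. x \<in> {0..1} \<Longrightarrow> \<bar>k x\<bar> \<le> Bk" by (rule continuous_on_compact_abs_bound[OF compact_Icc cont_k]) blast
  obtain B' where B': "B' > 0" "\<And>x. x \<in> {0..1} \<Longrightarrow> \<bar>k' x\<bar> \<le> B'" by (rule continuous_on_compact_abs_bound[OF compact_Icc cont_k']) blast
  obtain Bv where Bv: "Bv > 0" "\<And>t u. t \<in> {0..1} \<Longrightarrow> u \<in> {0..1} \<Longrightarrow> \<bar>fvar w t u\<bar> \<le> Bv"
    by (rule continuous_on_compact_abs_bound[OF compact_Times[OF compact_Icc compact_Icc] cont_fvar[OF w]]) auto
  \<comment> \<open>Per unit of time: the shift of the kernel in the boundary term, the integral of
    w k', and half the squared kernel. Below, \<open>M\<close> bounds |\<delta>|, so that exp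
    |\<delta>| \<le> exp M.\<close>
  define C1 where "C1 = B' * R + R * B' + 1/2 * Bk\<^sup>2"
  define M where "M = Bk * (2 * R) + C1"
  define C where "C = Bv * (exp M * (2 * Bk\<^sup>2 + 2 * C1\<^sup>2) + C1)"
  have C1: "C1 > 0" unfolding C1_def using B' R Bk by (intro add_pos_pos) auto
  show ?thesis
  proof (rule that[of C])
    fix t t' u :: real assume t: "0 \<le> t" "t \<le> t'" "t' \<le> u" "u \<le> 1"
    define D where "D = w t' - w t"
    have D: "\<bar>D\<bar> \<le> 2 * R" using R(2)[of t] R(2)[of t'] t unfolding D_def by auto
    define \<delta> where "\<delta> = expo w t' u - expo w t u"
    define \<rho> where "\<rho> = \<delta> - k (u - t) * D"
    have sub: "{t..t'} \<subseteq> {0..1}" "{0..t'} \<subseteq> {0..1}" and u: "u \<in> {0..1}" using t by auto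
    define f where "f s = w s * k' (max 0 (u - s))" for s
    define g where "g s = (k (max 0 (u - s)))\<^sup>2" for s
    have cf: "continuous_on {0..1} f" unfolding f_def by (intro continuous_intros w cont_trunc_section cont_k' u)
    have cg: "continuous_on {0..1} g" unfolding g_def by (intro continuous_intros cont_trunc_section cont_k u)
    have If: "integral {0..t'} f = integral {0..t} f + integral {t..t'} f"
      using t sub by (intro Henstock_Kurzweil_Integration.integral_combine[symmetric] integrable_continuous_interval continuous_on_subset[OF cf])
    have Ig: "integral {0..t'} g = integral {0..t} g + integral {t..t'} g"
      using t sub by (intro Henstock_Kurzweil_Integration.integral_combine[symmetric] integrable_continuous_interval continuous_on_subset[OF cg])
    have bf: "\<bar>integral {t..t'} f\<bar> \<le> R * B' * (t' - t)"
    proof -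
      have "\<bar>f s\<bar> \<le> R * B'" if "s \<in> {t..t'}" for s
        unfolding f_def abs_mult using R(2)[of s] B'(2)[of "max 0 (u - s)"] that t R(1) by (intro mult_mono) auto
      then show ?thesis
        using integral_bound[OF t(2) continuous_on_subset[OF cf sub(1)], of "R * B'"] by simp
    qed
    have bg: "\<bar>integral {t..t'} g\<bar> \<le> Bk\<^sup>2 * (t' - t)"
    proof -
      have "\<bar>g s\<bar> \<le> Bk\<^sup>2" if "s \<in> {t..t'}" for s
        unfolding g_def using power_mono[OF Bk(2)[of "max 0 (u - s)"], of 2] that t by simp
      then show ?thesis
        using integral_bound[OF t(2) continuous_on_subset[OF cg sub(1)], of "Bk\<^sup>2"] by simp
    qed
    have bk: "\<bar>k (u - t') - k (u - t)\<bar> \<le> B' * (t' - t)"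
    proof -
      have "norm (k (u - t') - k (u - t)) \<le> B' * norm ((u - t') - (u - t))"
        by (rule field_differentiable_bound[of "{0..1}" k k']) (use B'(2) t deriv_k in auto)
      then show ?thesis using t by simp
    qed
    \<comment> \<open>The boundary term changes by k (u - t) D plus the change of the kernel times
      \<open>w t'\<close>; subtracting the leading part leaves only terms of order t' - t.\<close>
    have "\<rho> = (k (u - t') - k (u - t)) * w t' + integral {t..t'} f - 1/2 * integral {t..t'} g"
      unfolding \<rho>_def \<delta>_def expo_def f_def[symmetric] g_def[symmetric] If Ig D_def
      using t by (simp add: algebra_simps)
    moreover have "\<bar>(k (u - t') - k (u - t)) * w t'\<bar> \<le> B' * (t' - t) * R"
      unfolding abs_mult using bk R(2)[of t'] t by (intro mult_mono) auto
    moreover have "\<bar>1/2 * integral {t..t'} g\<bar> \<le> 1/2 * (Bk\<^sup>2 * (t' - t))"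
      using bg by (simp add: abs_mult)
    ultimately have "\<bar>\<rho>\<bar> \<le> B' * (t' - t) * R + R * B' * (t' - t) + 1/2 * (Bk\<^sup>2 * (t' - t))"
      using bf by linarith
    also have "\<dots> = C1 * (t' - t)" unfolding C1_def distrib_right by simp
    finally have \<rho>: "\<bar>\<rho>\<bar> \<le> C1 * (t' - t)" .
    have "\<bar>k (u - t) * D\<bar> \<le> Bk * \<bar>D\<bar>" unfolding abs_mult using Bk(2)[of "u - t"] t by (intro mult_right_mono) auto
    then have \<delta>1: "\<bar>\<delta>\<bar> \<le> Bk * \<bar>D\<bar> + C1 * (t' - t)" using \<rho> unfolding \<rho>_def by linarith
    have "Bk * \<bar>D\<bar> \<le> Bk * (2 * R)" using D Bk by (intro mult_left_mono) auto
    moreover have "C1 * (t' - t) \<le> C1 * 1" using C1 t by (intro mult_left_mono) auto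
    ultimately have \<delta>2: "\<bar>\<delta>\<bar> \<le> M" using \<delta>1 unfolding M_def by linarith
    have "\<delta>\<^sup>2 \<le> (Bk * \<bar>D\<bar> + C1 * (t' - t))\<^sup>2" using power_mono[OF \<delta>1, of 2] by simp
    also have "\<dots> \<le> 2 * (Bk * \<bar>D\<bar>)\<^sup>2 + 2 * (C1 * (t' - t))\<^sup>2"
    proof -
      have "(a + b)\<^sup>2 \<le> 2 * a\<^sup>2 + 2 * b\<^sup>2" for a b :: real
        using zero_le_power2[of "a - b"] by (simp add: power2_eq_square algebra_simps)
      then show ?thesis .
    qed
    also have "\<dots> = 2 * Bk\<^sup>2 * D\<^sup>2 + 2 * C1\<^sup>2 * (t' - t)\<^sup>2" by (simp add: power_mult_distrib)
    also have "\<dots> \<le> 2 * Bk\<^sup>2 * D\<^sup>2 + 2 * C1\<^sup>2 * (t' - t)"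
    proof -
      have "(t' - t)\<^sup>2 \<le> (t' - t) * 1" unfolding power2_eq_square using t by (intro mult_left_mono) auto
      then show ?thesis by (intro add_mono mult_left_mono) auto
    qed
    also have "\<dots> \<le> (2 * Bk\<^sup>2 + 2 * C1\<^sup>2) * (D\<^sup>2 + (t' - t))"
    proof -
      have "0 \<le> 2 * Bk\<^sup>2 * (t' - t) + 2 * C1\<^sup>2 * D\<^sup>2" using t by (intro add_nonneg_nonneg mult_nonneg_nonneg) auto
      then show ?thesis by (simp add: algebra_simps)
    qed
    finally have \<delta>3: "\<delta>\<^sup>2 \<le> (2 * Bk\<^sup>2 + 2 * C1\<^sup>2) * (D\<^sup>2 + (t' - t))" .
    have "\<bar>exp \<delta> - 1 - \<delta>\<bar> \<le> exp \<bar>\<delta>\<bar> * \<delta>\<^sup>2" by (rule exp_second_order_bound)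
    also have "\<dots> \<le> exp M * ((2 * Bk\<^sup>2 + 2 * C1\<^sup>2) * (D\<^sup>2 + (t' - t)))"
      using \<delta>2 \<delta>3 by (intro mult_mono) auto
    finally have e: "\<bar>exp \<delta> - 1 - \<delta>\<bar> \<le> exp M * ((2 * Bk\<^sup>2 + 2 * C1\<^sup>2) * (D\<^sup>2 + (t' - t)))" .
    have \<rho>': "\<bar>\<rho>\<bar> \<le> C1 * (D\<^sup>2 + (t' - t))"
    proof -
      have "C1 * (t' - t) \<le> C1 * (D\<^sup>2 + (t' - t))" using C1 by (intro mult_left_mono) auto
      then show ?thesis using \<rho> by linarith
    qed
    have vd: "fvar w t' u = fvar w t u * exp \<delta>"
      unfolding fvar_def \<delta>_def by (simp add: exp_diff)
    have "fvar w t' u - fvar w t u - k (u - t) * fvar w t u * D = fvar w t u * ((exp \<delta> - 1 - \<delta>) + \<rho>)"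
      unfolding vd \<rho>_def by (simp add: algebra_simps)
    then have "\<bar>fvar w t' u - fvar w t u - k (u - t) * fvar w t u * D\<bar> = \<bar>fvar w t u\<bar> * \<bar>(exp \<delta> - 1 - \<delta>) + \<rho>\<bar>"
      by (simp only: abs_mult)
    also have "\<dots> \<le> Bv * (exp M * ((2 * Bk\<^sup>2 + 2 * C1\<^sup>2) * (D\<^sup>2 + (t' - t))) + C1 * (D\<^sup>2 + (t' - t)))"
      using Bv(2)[of t u] Bv(1) t e \<rho>' by (intro mult_mono) auto
    also have "\<dots> = C * (D\<^sup>2 + (t' - t))" by (simp add: C_def algebra_simps)
    finally show "\<bar>fvar w t' u - fvar w t u - k (u - t) * fvar w t u * (w t' - w t)\<bar> \<le> C * ((w t' - w t)\<^sup>2 + (t' - t))"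
      unfolding D_def .
  qed
qed

text \<open>Since w starts at 0, the lower boundary term vanishes, and the derivative of s \<mapsto>
  k (u - s) brings the minus sign that makes the integral in \<open>expo\<close> positive. The drift
  is added back because the sums approximate the Wiener integral alone.\<close>

lemma expo_riemann_limit:
  assumes w: "continuous_on {0..1} w" and w0: "w 0 = 0" and t: "0 \<le> t" "t \<le> u" "u \<le> 1"
  shows "(\<lambda>m. \<Sum>i<m. k (u - t * real i / real m) * (w (t * real (Suc i) / real m) - w (t * real i / real m)))
     \<longlonglongrightarrow> expo w t u + 1/2 * integral {0..t} (\<lambda>s. (k (max 0 (u - s)))\<^sup>2)"
proof -
  have d: "((\<lambda>s. k (u - s)) has_real_derivative - k' (max 0 (u - s))) (at s within {0..t})" if s: "s \<in> {0..t}" for s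
  proof -
    have "(k has_real_derivative k' (u - s)) (at (u - s) within (\<lambda>s. u - s) ` {0..t})"
      using s t by (intro DERIV_subset[OF deriv_k]) auto
    moreover have "((\<lambda>s. u - s) has_real_derivative - 1) (at s within {0..t})"
      by (auto intro!: derivative_eq_intros)
    ultimately have "((k \<circ> (\<lambda>s. u - s)) has_real_derivative k' (u - s) * - 1) (at s within {0..t})"
      by (rule DERIV_image_chain)
    then show ?thesis using s t by (simp add: o_def)
  qed
  have sub: "{0..t} \<subseteq> {0..1}" using t by auto
  have u: "u \<in> {0..1}" using t by auto
  have "(\<lambda>m. \<Sum>i<m. k (u - t * real i / real m) * (w (t * real (Suc i) / real m) - w (t * real i / real m)))
     \<longlonglongrightarrow> k (u - t) * w t - k (u - 0) * w 0 - integral {0..t} (\<lambda>s. w s * (- k' (max 0 (u - s))))"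
    using t by (intro riemann_stieltjes_by_parts_tendsto d continuous_on_subset[OF w sub] continuous_on_minus
        continuous_on_subset[OF cont_trunc_section[OF cont_k' u] sub])
  then show ?thesis using w0 t by (simp add: expo_def)
qed

end

section \<open>Almost sure quadratic variation\<close>

text \<open>The sum of all squares has finite expectation, so it is finite almost surely and its
  terms tend to 0.\<close>

lemma AE_tendsto_0_of_summable_second_moments:
  fixes Y :: "nat \<Rightarrow> 'a \<Rightarrow> real"
  assumes meas: "\<And>m. Y m \<in> borel_measurable M"
    and int: "\<And>m. integrable M (\<lambda>\<omega>. (Y m \<omega>)\<^sup>2)"
    and bound: "\<And>m. (\<integral>\<omega>. (Y m \<omega>)\<^sup>2 \<partial>M) \<le> b m" and b: "summable b"
  shows "AE \<omega> in M. (\<lambda>m. Y m \<omega>) \<longlonglongrightarrow> 0"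
proof -
  note [measurable] = meas
  have b0: "0 \<le> b m" for m by (rule order_trans[OF Bochner_Integration.integral_nonneg bound]) simp
  have "(\<integral>\<^sup>+\<omega>. (\<Sum>m. ennreal ((Y m \<omega>)\<^sup>2)) \<partial>M) = (\<Sum>m. \<integral>\<^sup>+\<omega>. ennreal ((Y m \<omega>)\<^sup>2) \<partial>M)"
    by (intro nn_integral_suminf) auto
  also have "\<dots> \<le> (\<Sum>m. ennreal (b m))"
    using int bound b0 by (intro suminf_le summableI) (auto simp: nn_integral_eq_integral intro!: ennreal_leI)
  also have "\<dots> < \<infinity>" using b b0 by (simp add: suminf_ennreal2)
  finally have "AE \<omega> in M. (\<Sum>m. ennreal ((Y m \<omega>)\<^sup>2)) \<noteq> \<infinity>"
    by (intro nn_integral_noteq_infinite) auto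
  then show ?thesis
  proof eventually_elim
    case (elim \<omega>)
    then have "summable (\<lambda>m. (Y m \<omega>)\<^sup>2)"
      by (intro summable_suminf_not_top) auto
    then have "(\<lambda>m. (Y m \<omega>)\<^sup>2) \<longlonglongrightarrow> 0" by (rule summable_LIMSEQ_zero)
    then have "(\<lambda>m. sqrt ((Y m \<omega>)\<^sup>2)) \<longlonglongrightarrow> sqrt 0" by (rule tendsto_real_sqrt)
    then show ?case by (simp add: tendsto_rabs_zero_iff)
  qed
qed

section \<open>Second moments of sums of centred squared Brownian increments\<close>

lemma std_brownian_motion_increment_moments:
  assumes BM: "std_brownian_motion M F W" and st: "0 \<le> s" "s < t" "t \<le> 1"
  shows "integrable M (\<lambda>\<omega>. (W t \<omega> - W s \<omega>)^2)" "(\<integral>\<omega>. (W t \<omega> - W s \<omega>)^2 \<partial>M) = t - s"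
    "integrable M (\<lambda>\<omega>. (W t \<omega> - W s \<omega>)^4)" "(\<integral>\<omega>. (W t \<omega> - W s \<omega>)^4 \<partial>M) = 3 * (t - s)\<^sup>2"
proof -
  have dist: "distributed M lborel (\<lambda>\<omega>. W t \<omega> - W s \<omega>) (\<lambda>x. ennreal (normal_density 0 (sqrt (t - s)) x))"
    using BM st unfolding std_brownian_motion_def by auto
  have pos: "sqrt (t - s) > 0" using st by simp
  have m: "has_bochner_integral lborel (\<lambda>x. normal_density 0 (sqrt (t - s)) x * x ^ (2 * j))
      (fact (2 * j) / ((2 / (t - s)) ^ j * fact j))" for j
    using normal_moment_even[OF pos, of 0 j] st by simp
  have i: "integrable M (\<lambda>\<omega>. (W t \<omega> - W s \<omega>) ^ (2 * j))
      \<and> (\<integral>\<omega>. (W t \<omega> - W s \<omega>) ^ (2 * j) \<partial>M) = fact (2 * j) / ((2 / (t - s)) ^ j * fact j)" for j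
  proof
    show "integrable M (\<lambda>\<omega>. (W t \<omega> - W s \<omega>) ^ (2 * j))"
      using distributed_integrable[OF dist, of "\<lambda>x. x ^ (2 * j)"] m[of j] by (auto simp: has_bochner_integral_iff)
    show "(\<integral>\<omega>. (W t \<omega> - W s \<omega>) ^ (2 * j) \<partial>M) = fact (2 * j) / ((2 / (t - s)) ^ j * fact j)"
      using distributed_integral[OF dist, of "\<lambda>x. x ^ (2 * j)"] m[of j] by (auto simp: has_bochner_integral_iff)
  qed
  have f: "fact 4 = (24::real)" by (simp add: fact_numeral)
  show "integrable M (\<lambda>\<omega>. (W t \<omega> - W s \<omega>)^2)" "(\<integral>\<omega>. (W t \<omega> - W s \<omega>)^2 \<partial>M) = t - s"
    using i[of 1] st by (auto simp: fact_numeral)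
  show "integrable M (\<lambda>\<omega>. (W t \<omega> - W s \<omega>)^4)" "(\<integral>\<omega>. (W t \<omega> - W s \<omega>)^4 \<partial>M) = 3 * (t - s)\<^sup>2"
    using i[of 2] st by (auto simp: f power2_eq_square field_simps)
qed

lemma std_brownian_motion_measurable:
  assumes BM: "std_brownian_motion M F W" and t: "t \<in> {0..1}"
  shows "W t \<in> borel_measurable M"
  using BM t measurable_from_subalg unfolding std_brownian_motion_def by blast

text \<open>Because t \<le> s', the earlier increment is measurable with respect to
  \<open>F s'\<close>, and the later one is independent of that \<sigma>-algebra. The expectation of
  the product factorises, and the later centred square has mean 0.\<close>

lemma std_brownian_motion_centred_squares_orthogonal:
  assumes BM: "std_brownian_motion M F W"
    and st: "0 \<le> s" "s < t" "t \<le> s'" "s' < t'" "t' \<le> 1"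
  shows "integrable M (\<lambda>\<omega>. ((W t \<omega> - W s \<omega>)\<^sup>2 - (t - s)) * ((W t' \<omega> - W s' \<omega>)\<^sup>2 - (t' - s')))"
    "(\<integral>\<omega>. ((W t \<omega> - W s \<omega>)\<^sup>2 - (t - s)) * ((W t' \<omega> - W s' \<omega>)\<^sup>2 - (t' - s')) \<partial>M) = 0"
proof -
  interpret prob_space M using BM by (simp add: std_brownian_motion_def)
  define X where "X \<omega> = W t \<omega> - W s \<omega>" for \<omega>
  define Y where "Y \<omega> = W t' \<omega> - W s' \<omega>" for \<omega>
  have Xm: "X \<in> borel_measurable M" and Ym: "Y \<in> borel_measurable M"
    unfolding X_def Y_def using st
    by (auto intro!: borel_measurable_diff std_brownian_motion_measurable[OF BM])
  have mono: "sets (F a) \<subseteq> sets (F s')" if "0 \<le> a" "a \<le> s'" for a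
    using BM st that unfolding std_brownian_motion_def by auto
  have sp: "space (F a) = space M" if "a \<in> {0..1}" for a
    using BM that unfolding std_brownian_motion_def subalgebra_def by auto
  have Wm: "W a \<in> borel_measurable (F s')" if a: "0 \<le> a" "a \<le> s'" for a
  proof (rule measurable_from_subalg)
    show "W a \<in> borel_measurable (F a)" using BM st a unfolding std_brownian_motion_def by auto
    show "subalgebra (F s') (F a)" unfolding subalgebra_def using mono[OF a] sp[of a] sp[of s'] st a by auto
  qed
  have XF: "X \<in> borel_measurable (F s')" unfolding X_def using st by (intro borel_measurable_diff Wm) auto
  have ind: "indep_sets (\<lambda>b. if b then sets (F s') else {Y -` A \<inter> space M | A. A \<in> sets borel}) UNIV"
    using BM st unfolding std_brownian_motion_def Y_def by auto
  have "indep_var borel X borel Y"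
    unfolding indep_var_def indep_vars_def2
  proof (intro conjI ballI)
    show "random_variable (case b of True \<Rightarrow> borel | False \<Rightarrow> borel) (case b of True \<Rightarrow> X | False \<Rightarrow> Y)" for b
      using Xm Ym by (cases b) auto
    show "indep_sets (\<lambda>b. {(case b of True \<Rightarrow> X | False \<Rightarrow> Y) -` A \<inter> space M |A. A \<in> sets (case b of True \<Rightarrow> borel | False \<Rightarrow> borel)}) UNIV"
    proof (rule indep_sets_mono_sets[OF ind])
      fix b
      have "X -` A \<inter> space M \<in> sets (F s')" if "A \<in> sets borel" for A
        using measurable_sets[OF XF that] sp[of s'] st by simp
      then show "{(case b of True \<Rightarrow> X | False \<Rightarrow> Y) -` A \<inter> space M |A. A \<in> sets (case b of True \<Rightarrow> borel | False \<Rightarrow> borel)}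
         \<subseteq> (if b then sets (F s') else {Y -` A \<inter> space M | A. A \<in> sets borel})"
        by (cases b) auto
    qed
  qed
  from indep_var_compose[OF this, of "\<lambda>x. x\<^sup>2 - (t - s)" borel "\<lambda>x. x\<^sup>2 - (t' - s')" borel]
  have ind2: "indep_var borel (\<lambda>\<omega>. (X \<omega>)\<^sup>2 - (t - s)) borel (\<lambda>\<omega>. (Y \<omega>)\<^sup>2 - (t' - s'))"
    by (simp add: o_def)
  have mX: "integrable M (\<lambda>\<omega>. (X \<omega>)\<^sup>2 - (t - s))"
    unfolding X_def using st by (intro Bochner_Integration.integrable_diff std_brownian_motion_increment_moments[OF BM]) auto
  have mY: "integrable M (\<lambda>\<omega>. (Y \<omega>)\<^sup>2 - (t' - s'))" "(\<integral>\<omega>. (Y \<omega>)\<^sup>2 - (t' - s') \<partial>M) = 0"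
    unfolding Y_def using st std_brownian_motion_increment_moments[OF BM, of s' t'] by (auto simp: prob_space)
  show "integrable M (\<lambda>\<omega>. ((W t \<omega> - W s \<omega>)\<^sup>2 - (t - s)) * ((W t' \<omega> - W s' \<omega>)\<^sup>2 - (t' - s')))"
    using indep_var_integrable[OF ind2 mX mY(1)] unfolding X_def Y_def .
  show "(\<integral>\<omega>. ((W t \<omega> - W s \<omega>)\<^sup>2 - (t - s)) * ((W t' \<omega> - W s' \<omega>)\<^sup>2 - (t' - s')) \<partial>M) = 0"
    using indep_var_lebesgue_integral[OF ind2 mX mY(1)] mY(2) unfolding X_def Y_def by simp
qed

text \<open>Mixed terms vanish by orthogonality. Each diagonal term is 3/n^2 - 2/n^2 + 1/n^2 =
  2/n^2, and there are n of them with weights at most 1.\<close>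

lemma weighted_quadratic_variation_second_moment:
  assumes BM: "std_brownian_motion M F W" and n: "n \<ge> 1" and a: "\<And>i. i < n \<Longrightarrow> \<bar>a i\<bar> \<le> 1"
  defines "Y \<equiv> \<lambda>\<omega>. \<Sum>i<n. a i * ((W (real (Suc i) / real n) \<omega> - W (real i / real n) \<omega>)\<^sup>2 - 1 / real n)"
  shows "Y \<in> borel_measurable M" "integrable M (\<lambda>\<omega>. (Y \<omega>)\<^sup>2)" "(\<integral>\<omega>. (Y \<omega>)\<^sup>2 \<partial>M) \<le> 2 / real n"
proof -
  interpret prob_space M using BM by (simp add: std_brownian_motion_def)
  define Z where "Z i \<omega> = (W (real (Suc i) / real n) \<omega> - W (real i / real n) \<omega>)\<^sup>2 - 1 / real n" for i \<omega>
  have step: "real (Suc i) / real n - real i / real n = 1 / real n" for i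
    by (simp add: diff_divide_distrib[symmetric])
  have lt: "real i / real n < real (Suc i) / real n" for i using n by (simp add: divide_strict_right_mono)
  have le1: "real (Suc i) / real n \<le> 1" if "i < n" for i using that by simp
  have Zm: "Z i \<in> borel_measurable M" if "i < n" for i
    unfolding Z_def using that le1[OF that]
    by (intro borel_measurable_diff borel_measurable_power std_brownian_motion_measurable[OF BM]) auto
  show "Y \<in> borel_measurable M"
    unfolding Y_def Z_def[symmetric] using Zm by (intro borel_measurable_sum borel_measurable_times) auto
  have diag: "integrable M (\<lambda>\<omega>. Z i \<omega> * Z i \<omega>) \<and> (\<integral>\<omega>. Z i \<omega> * Z i \<omega> \<partial>M) = 2 / (real n)\<^sup>2" if i: "i < n" for i
  proof -
    note m = std_brownian_motion_increment_moments[OF BM _ lt[of i] le1[OF i], unfolded step, simplified]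
    have eq: "Z i \<omega> * Z i \<omega> = (W (real (Suc i) / real n) \<omega> - W (real i / real n) \<omega>)^4
        - (2 / real n) * (W (real (Suc i) / real n) \<omega> - W (real i / real n) \<omega>)^2 + 1 / (real n)\<^sup>2" for \<omega>
      unfolding Z_def by (simp add: power2_eq_square power4_eq_xxxx algebra_simps)
    show ?thesis unfolding eq using m by (simp add: prob_space power2_eq_square)
  qed
  have off: "integrable M (\<lambda>\<omega>. Z i \<omega> * Z j \<omega>) \<and> (\<integral>\<omega>. Z i \<omega> * Z j \<omega> \<partial>M) = 0" if ij: "i < j" "j < n" for i j
  proof -
    have "real (Suc i) / real n \<le> real j / real n" using ij by (intro divide_right_mono) auto
    from std_brownian_motion_centred_squares_orthogonal[OF BM _ lt[of i] this lt[of j] le1[OF ij(2)]]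
    show ?thesis unfolding Z_def step by simp
  qed
  have all: "integrable M (\<lambda>\<omega>. Z i \<omega> * Z j \<omega>) \<and> (\<integral>\<omega>. Z i \<omega> * Z j \<omega> \<partial>M) = (if i = j then 2 / (real n)\<^sup>2 else 0)"
    if "i < n" "j < n" for i j
    using diag[of i] off[of i j] off[of j i] that by (cases i j rule: linorder_cases) (auto simp: mult.commute)
  have sq: "(Y \<omega>)\<^sup>2 = (\<Sum>i<n. \<Sum>j<n. a i * a j * (Z i \<omega> * Z j \<omega>))" for \<omega>
  proof -
    have "Y \<omega> = (\<Sum>i<n. a i * Z i \<omega>)" by (simp add: Y_def Z_def)
    then show ?thesis by (simp add: power2_eq_square sum_product ac_simps)
  qed
  show "integrable M (\<lambda>\<omega>. (Y \<omega>)\<^sup>2)"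
    unfolding sq using all by (intro Bochner_Integration.integrable_sum integrable_mult_right) auto
  have "(\<integral>\<omega>. (Y \<omega>)\<^sup>2 \<partial>M) = (\<Sum>i<n. \<Sum>j<n. a i * a j * (\<integral>\<omega>. Z i \<omega> * Z j \<omega> \<partial>M))"
    unfolding sq using all
    by (subst Bochner_Integration.integral_sum; (intro Bochner_Integration.integrable_sum integrable_mult_right)?; simp)+
  also have "\<dots> = (\<Sum>i<n. \<Sum>j<n. if i = j then a i * a j * (2 / (real n)\<^sup>2) else 0)"
    using all by (intro sum.cong) auto
  also have "\<dots> = (\<Sum>i<n. (a i)\<^sup>2 * (2 / (real n)\<^sup>2))"
    by (simp add: sum.delta power2_eq_square)
  also have "\<dots> \<le> (\<Sum>i<n. 1 * (2 / (real n)\<^sup>2))"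
    using a by (intro sum_mono mult_right_mono) (auto simp: abs_square_le_1)
  also have "\<dots> = 2 / real n" using n by (simp add: power2_eq_square)
  finally show "(\<integral>\<omega>. (Y \<omega>)\<^sup>2 \<partial>M) \<le> 2 / real n" .
qed

text \<open>The quantifier over \<open>h\<close> stands inside the almost-sure statement because the
  weights used later depend on the outcome. A countable family of Bernstein polynomials costs one
  null set; the passage to all continuous \<open>h\<close> is then deterministic, as the functionals
  are bounded in the sup norm along the path.\<close>

lemma quadratic_variation_AE_limit:
  fixes n :: "nat \<Rightarrow> nat"
  assumes BM: "std_brownian_motion M F W" and n: "\<And>m. n m \<ge> 2 ^ m"
  shows "AE \<omega> in M. \<forall>h. continuous_on {0..1} h \<longrightarrow>
     (\<lambda>m. \<Sum>i<n m. h (real i / real (n m)) * (W (real (Suc i) / real (n m)) \<omega> - W (real i / real (n m)) \<omega>)\<^sup>2)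
        \<longlonglongrightarrow> integral {0..1} h"
proof -
  have n1: "n m \<ge> 1" for m using n[of m] order_trans[of 1 "2 ^ m" "n m"] by simp
  have nlim: "filterlim n at_top sequentially" by (rule filterlim_at_top_of_ge_power2[OF n])
  define Y where "Y N j m \<omega> = (\<Sum>i<n m. Bernstein N j (real i / real (n m)) *
     ((W (real (Suc i) / real (n m)) \<omega> - W (real i / real (n m)) \<omega>)\<^sup>2 - 1 / real (n m)))" for N j m \<omega>
  \<comment> \<open>Bernstein polynomials are nonnegative and sum to 1, so they meet the weight
    bound of the second-moment estimate.\<close>
  have Bb: "\<bar>Bernstein N j x\<bar> \<le> 1" if "j \<le> N" "x \<in> {0..1}" for N j x
  proof -
    have "Bernstein N j x \<le> (\<Sum>j\<le>N. Bernstein N j x)"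
      using that Bernstein_nonneg[of x] by (intro member_le_sum) auto
    then show ?thesis using Bernstein_nonneg[of x N j] that by (simp add: sum_Bernstein)
  qed
  have "AE \<omega> in M. (\<lambda>m. Y N j m \<omega>) \<longlonglongrightarrow> 0" if j: "j \<le> N" for N j
  proof (rule AE_tendsto_0_of_summable_second_moments[where b = "\<lambda>m. 2 * (1 / 2) ^ m"])
    fix m
    note q = weighted_quadratic_variation_second_moment[OF BM n1[of m],
        of "\<lambda>i. Bernstein N j (real i / real (n m))", OF Bb[OF j]]
    show "Y N j m \<in> borel_measurable M" "integrable M (\<lambda>\<omega>. (Y N j m \<omega>)\<^sup>2)"
      using q(1,2) unfolding Y_def by auto
    have "real (n m) \<ge> real (2 ^ m)" using n[of m] by (simp only: of_nat_le_iff)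
    then have "2 / real (n m) \<le> 2 / 2 ^ m" by (intro divide_left_mono) (auto intro!: mult_pos_pos simp: less_le_trans[of 0 "2 ^ m"])
    then show "(\<integral>\<omega>. (Y N j m \<omega>)\<^sup>2 \<partial>M) \<le> 2 * (1 / 2) ^ m"
      using q(3) unfolding Y_def by (simp add: power_divide)
  qed (intro summable_mult summable_geometric, simp)
  then have "AE \<omega> in M. \<forall>N. \<forall>j\<in>{..N}. (\<lambda>m. Y N j m \<omega>) \<longlonglongrightarrow> 0"
    by (intro AE_all_countable[THEN iffD2] allI AE_ball_countable[THEN iffD2] ballI) auto
  then show ?thesis
  proof eventually_elim
    case (elim \<omega>)
    define D where "D m i = W (real (Suc i) / real (n m)) \<omega> - W (real i / real (n m)) \<omega>" for m i
    define L where "L m h = (\<Sum>i<n m. h (real i / real (n m)) * ((D m i)\<^sup>2 - 1 / real (n m)))" for m and h :: "real \<Rightarrow> real"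
    have LB: "(\<lambda>m. L m (Bernstein N j)) \<longlonglongrightarrow> 0" if "j \<le> N" for N j
      using elim that unfolding L_def Y_def D_def by simp
    have L1: "L m (\<lambda>_. 1) = (\<Sum>i<n m. (D m i)\<^sup>2) - 1" for m
      using n1[of m] by (simp add: L_def sum_subtractf)
    \<comment> \<open>The constant weight is among the polynomials; it yields convergence, hence
      boundedness, of the total quadratic variation.\<close>
    have "L m (Bernstein 0 0) = L m (\<lambda>_. 1)" for m by (simp add: L_def Bernstein_def)
    then have "(\<lambda>m. (\<Sum>i<n m. (D m i)\<^sup>2) - 1) \<longlonglongrightarrow> 0" using LB[of 0 0] by (simp add: L1)
    then have "(\<lambda>m. (\<Sum>i<n m. (D m i)\<^sup>2) - 1 + 1) \<longlonglongrightarrow> 0 + 1" by (intro tendsto_add tendsto_const)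
    then have "Bseq (\<lambda>m. \<Sum>i<n m. (D m i)\<^sup>2)" by (intro convergent_imp_Bseq convergentI) simp
    then obtain CQ where CQ: "CQ > 0" "\<And>m. \<bar>\<Sum>i<n m. (D m i)\<^sup>2\<bar> \<le> CQ" unfolding Bseq_def by auto
    have L0: "(\<lambda>m. L m h) \<longlonglongrightarrow> 0" if h: "continuous_on {0..1} h" for h
    proof (rule LIMSEQ_I)
      fix e :: real assume e: "e > 0"
      define e' where "e' = e / (2 * (CQ + 1))"
      have e': "e' > 0" using e CQ by (simp add: e'_def)
      obtain N where N: "\<And>x. x \<in> {0..1} \<Longrightarrow> \<bar>h x - (\<Sum>j\<le>N. h (real j / real N) * Bernstein N j x)\<bar> < e'"
        using Bernstein_Weierstrass[OF h e'] by blast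
      define g where "g x = (\<Sum>j\<le>N. h (real j / real N) * Bernstein N j x)" for x
      have Lg: "L m g = (\<Sum>j\<le>N. h (real j / real N) * L m (Bernstein N j))" for m
        unfolding L_def g_def sum_distrib_right sum_distrib_left
        by (subst sum.swap) (simp add: mult.assoc)
      have "(\<lambda>m. L m g) \<longlonglongrightarrow> (\<Sum>j\<le>N. h (real j / real N) * 0)"
        unfolding Lg by (intro tendsto_intros LB) auto
      then have "(\<lambda>m. L m g) \<longlonglongrightarrow> 0" by simp
      from LIMSEQ_D[OF this, of "e / 2"] e obtain m0 where m0: "\<And>m. m \<ge> m0 \<Longrightarrow> \<bar>L m g\<bar> < e / 2" by auto
      have "\<bar>L m h\<bar> < e" if "m \<ge> m0" for m
      proof -
        have "L m h - L m g = (\<Sum>i<n m. (h (real i / real (n m)) - g (real i / real (n m))) * ((D m i)\<^sup>2 - 1 / real (n m)))"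
          unfolding L_def by (simp add: sum_subtractf[symmetric] left_diff_distrib)
        then have "\<bar>L m h - L m g\<bar> \<le> (\<Sum>i<n m. e' * ((D m i)\<^sup>2 + 1 / real (n m)))"
        proof (simp only:, intro abs_sum_le)
          fix i assume i: "i < n m"
          have "\<bar>(h (real i / real (n m)) - g (real i / real (n m)))\<bar> \<le> e'"
            unfolding g_def using N[of "real i / real (n m)"] i by auto
          moreover have "\<bar>(D m i)\<^sup>2 - 1 / real (n m)\<bar> \<le> (D m i)\<^sup>2 + 1 / real (n m)"
            using abs_triangle_ineq4[of "(D m i)\<^sup>2" "1 / real (n m)"] by simp
          ultimately show "\<bar>(h (real i / real (n m)) - g (real i / real (n m))) * ((D m i)\<^sup>2 - 1 / real (n m))\<bar>
              \<le> e' * ((D m i)\<^sup>2 + 1 / real (n m))"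
            unfolding abs_mult using e' by (intro mult_mono) auto
        qed
        also have "\<dots> = e' * ((\<Sum>i<n m. (D m i)\<^sup>2) + 1)"
          using n1[of m] by (simp add: sum_distrib_left[symmetric] sum.distrib)
        also have "\<dots> \<le> e' * (CQ + 1)" using CQ(2)[of m] e' by (intro mult_left_mono) auto
        also have "\<dots> = e / 2" using CQ by (simp add: e'_def divide_simps)
        finally show ?thesis using m0[OF that] by linarith
      qed
      then show "\<exists>no. \<forall>m\<ge>no. norm (L m h - 0) < e" by auto
    qed
    show ?case
    proof (intro allI impI)
      fix h :: "real \<Rightarrow> real" assume h: "continuous_on {0..1} h"
      have "(\<lambda>m. L m h + (\<Sum>i<n m. h (real i / real (n m))) / real (n m)) \<longlonglongrightarrow> 0 + integral {0..1} h"
        by (intro tendsto_add L0 h filterlim_compose[OF riemann_sum_tendsto_integral[OF h] nlim])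
      moreover have "L m h + (\<Sum>i<n m. h (real i / real (n m))) / real (n m) = (\<Sum>i<n m. h (real i / real (n m)) * (D m i)\<^sup>2)" for m
        unfolding L_def by (simp add: right_diff_distrib sum_subtractf sum_divide_distrib)
      ultimately show "(\<lambda>m. \<Sum>i<n m. h (real i / real (n m)) * (W (real (Suc i) / real (n m)) \<omega> - W (real i / real (n m)) \<omega>)\<^sup>2)
        \<longlonglongrightarrow> integral {0..1} h" by (simp add: D_def)
    qed
  qed
qed

section \<open>Measurability and versions\<close>

text \<open>A subsequence whose deviations exceed (1/2)^r with probability at most (1/2)^r converges
  almost surely by Borel-Cantelli, and its limit must be \<open>y\<close>. This identifies a Wiener
  integral with a pathwise limit.\<close>

lemma conv_in_prob_AE_limit_unique:
  fixes Y :: "nat \<Rightarrow> 'a \<Rightarrow> real"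
  assumes M: "prob_space M" and Y: "\<And>m. Y m \<in> borel_measurable M" and Z: "Z \<in> borel_measurable M"
    and conv: "conv_in_prob M Y Z" and lim: "AE \<omega> in M. (\<lambda>m. Y m \<omega>) \<longlonglongrightarrow> y \<omega>"
  shows "AE \<omega> in M. Z \<omega> = y \<omega>"
proof -
  interpret prob_space M by fact
  note [measurable] = Y Z
  have "\<exists>m\<ge>r. measure M {\<omega>\<in>space M. \<bar>Y m \<omega> - Z \<omega>\<bar> > (1/2)^r} \<le> (1/2)^r" for r :: nat
  proof -
    have "(\<lambda>m. measure M {\<omega>\<in>space M. \<bar>Y m \<omega> - Z \<omega>\<bar> > (1/2)^r}) \<longlonglongrightarrow> 0"
      using conv unfolding conv_in_prob_def by simp
    then have "eventually (\<lambda>m. measure M {\<omega>\<in>space M. \<bar>Y m \<omega> - Z \<omega>\<bar> > (1/2)^r} < (1/2)^r) sequentially"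
      by (rule order_tendstoD) simp
    then obtain N where "\<And>m. m \<ge> N \<Longrightarrow> measure M {\<omega>\<in>space M. \<bar>Y m \<omega> - Z \<omega>\<bar> > (1/2)^r} < (1/2)^r"
      unfolding eventually_sequentially by blast
    then show ?thesis by (intro exI[of _ "max r N"]) (auto intro: less_imp_le)
  qed
  then obtain \<phi> where \<phi>: "\<And>r. \<phi> r \<ge> r" "\<And>r. measure M {\<omega>\<in>space M. \<bar>Y (\<phi> r) \<omega> - Z \<omega>\<bar> > (1/2)^r} \<le> (1/2)^r"
    by metis
  have \<phi>lim: "filterlim \<phi> at_top sequentially"
    by (rule filterlim_at_top_mono[OF filterlim_ident]) (simp add: \<phi>(1))
  have "AE \<omega> in M. eventually (\<lambda>r. \<omega> \<in> space M - {\<omega>\<in>space M. \<bar>Y (\<phi> r) \<omega> - Z \<omega>\<bar> > (1/2)^r}) sequentially"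
  proof (rule borel_cantelli_AE1)
    show "summable (\<lambda>r. measure M {\<omega>\<in>space M. \<bar>Y (\<phi> r) \<omega> - Z \<omega>\<bar> > (1/2)^r})"
      by (rule summable_comparison_test'[of "\<lambda>r. (1/2)^r" 0]) (use \<phi>(2) in auto)
  qed (auto simp: emeasure_eq_measure)
  then show ?thesis
    using lim
  proof eventually_elim
    case (elim \<omega>)
    have "(\<lambda>r. Y (\<phi> r) \<omega> - Z \<omega>) \<longlonglongrightarrow> 0"
    proof (rule Lim_null_comparison)
      show "eventually (\<lambda>r. norm (Y (\<phi> r) \<omega> - Z \<omega>) \<le> (1/2)^r) sequentially"
        using elim(1) by eventually_elim auto
      show "(\<lambda>r. (1/2::real)^r) \<longlonglongrightarrow> 0" by (rule LIMSEQ_power_zero) simp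
    qed
    moreover have "(\<lambda>r. Y (\<phi> r) \<omega> - Z \<omega>) \<longlonglongrightarrow> y \<omega> - Z \<omega>"
      by (intro tendsto_intros filterlim_compose[OF elim(2) \<phi>lim])
    ultimately show ?case using LIMSEQ_unique by fastforce
  qed
qed

text \<open>Zeroing the paths on a measurable null set makes every path continuous and start at 0,
  so pathwise constructions are available for all outcomes and not just almost all.\<close>

lemma std_brownian_motion_continuous_modification:
  assumes BM: "std_brownian_motion M F W"
  obtains B where "\<And>\<omega>. continuous_on {0..1} (\<lambda>t. B t \<omega>)" "\<And>\<omega>. B 0 \<omega> = 0"
    "\<And>t. t \<in> {0..1} \<Longrightarrow> B t \<in> borel_measurable M" "AE \<omega> in M. \<forall>t. B t \<omega> = W t \<omega>"
proof -
  have "AE \<omega> in M. W 0 \<omega> = 0 \<and> continuous_on {0..1} (\<lambda>t. W t \<omega>)"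
    using BM unfolding std_brownian_motion_def by auto
  then obtain N where N: "{\<omega>\<in>space M. \<not> (W 0 \<omega> = 0 \<and> continuous_on {0..1} (\<lambda>t. W t \<omega>))} \<subseteq> N"
    "emeasure M N = 0" "N \<in> sets M" by (rule AE_E)
  define B where "B t \<omega> = (if \<omega> \<in> space M - N then W t \<omega> else 0)" for t \<omega>
  show ?thesis
  proof (rule that[of B])
    show "continuous_on {0..1} (\<lambda>t. B t \<omega>)" "B 0 \<omega> = 0" for \<omega>
      using N(1) by (cases "\<omega> \<in> space M - N"; auto simp: B_def)+
    show "B t \<in> borel_measurable M" if "t \<in> {0..1}" for t
      unfolding B_def using std_brownian_motion_measurable[OF BM that] N(3)
      by (intro measurable_If_set) auto
    have "AE \<omega> in M. \<omega> \<notin> N" using N(2,3) by (intro AE_not_in) auto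
    then show "AE \<omega> in M. \<forall>t. B t \<omega> = W t \<omega>"
      using AE_space by eventually_elim (auto simp: B_def)
  qed
qed

lemma floor_approx_tendsto: "(\<lambda>m. of_int \<lfloor>real (Suc m) * t\<rfloor> / real (Suc m)) \<longlonglongrightarrow> t"
proof -
  have "(\<lambda>m. of_int \<lfloor>real (Suc m) * t\<rfloor> / real (Suc m) - t) \<longlonglongrightarrow> 0"
  proof (rule Lim_null_comparison)
    have "norm (of_int \<lfloor>real (Suc m) * t\<rfloor> / real (Suc m) - t) \<le> 1 / real (Suc m)" for m
    proof -
      have "of_int \<lfloor>real (Suc m) * t\<rfloor> / real (Suc m) - t = (of_int \<lfloor>real (Suc m) * t\<rfloor> - real (Suc m) * t) / real (Suc m)"
        by (simp add: field_simps)
      moreover have "\<bar>of_int \<lfloor>real (Suc m) * t\<rfloor> - real (Suc m) * t\<bar> \<le> 1" by linarith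
      ultimately show ?thesis by (simp add: abs_divide divide_right_mono del: of_nat_Suc)
    qed
    then show "\<forall>\<^sub>F m in sequentially. norm (of_int \<lfloor>real (Suc m) * t\<rfloor> / real (Suc m) - t) \<le> 1 / real (Suc m)" by simp
    show "(\<lambda>m. 1 / real (Suc m)) \<longlonglongrightarrow> 0" by (rule LIMSEQ_Suc[OF lim_1_over_n])
  qed
  then show ?thesis by (rule LIM_zero_cancel)
qed

text \<open>Rounding both arguments down to multiples of 1/(m + 1) leaves countably many sections,
  each measurable; continuity makes the rounded functions converge pointwise.\<close>

lemma caratheodory_measurable:
  fixes g :: "real \<Rightarrow> real \<Rightarrow> 'a \<Rightarrow> real"
  assumes meas: "\<And>t u. g t u \<in> borel_measurable M"
    and cont: "\<And>\<omega>. \<omega> \<in> space M \<Longrightarrow> continuous_on UNIV (\<lambda>(t, u). g t u \<omega>)"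
  shows "(\<lambda>((t, u), \<omega>). g t u \<omega>) \<in> borel_measurable ((lborel \<Otimes>\<^sub>M lborel) \<Otimes>\<^sub>M M)"
proof -
  define q where "q m t = of_int \<lfloor>real (Suc m) * t\<rfloor> / real (Suc m)" for m and t :: real
  have "(\<lambda>z. g (fst (fst z)) (snd (fst z)) (snd z)) \<in> borel_measurable ((lborel \<Otimes>\<^sub>M lborel) \<Otimes>\<^sub>M M)"
  proof (rule borel_measurable_LIMSEQ_real)
    fix z :: "(real \<times> real) \<times> 'a" assume "z \<in> space ((lborel \<Otimes>\<^sub>M lborel) \<Otimes>\<^sub>M M)"
    then have "snd z \<in> space M" by (auto simp: space_pair_measure)
    from cont[OF this] have c: "isCont (\<lambda>p. g (fst p) (snd p) (snd z)) (fst z)"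
      unfolding case_prod_beta by (simp only: continuous_on_eq_continuous_at open_UNIV) blast
    have "(\<lambda>m. (q m (fst (fst z)), q m (snd (fst z)))) \<longlonglongrightarrow> (fst (fst z), snd (fst z))"
      unfolding q_def by (intro tendsto_Pair floor_approx_tendsto)
    then have l: "(\<lambda>m. (q m (fst (fst z)), q m (snd (fst z)))) \<longlonglongrightarrow> fst z" by simp
    from isCont_tendsto_compose[OF c l] show "(\<lambda>m. g (q m (fst (fst z))) (q m (snd (fst z))) (snd z)) \<longlonglongrightarrow> g (fst (fst z)) (snd (fst z)) (snd z)"
      by simp
  next
    fix m
    have "(\<lambda>z. (\<lambda>(i, j) z. g (of_int i / real (Suc m)) (of_int j / real (Suc m)) (snd z))
        (\<lfloor>real (Suc m) * fst (fst z)\<rfloor>, \<lfloor>real (Suc m) * snd (fst z)\<rfloor>) z)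
      \<in> borel_measurable ((lborel \<Otimes>\<^sub>M lborel) \<Otimes>\<^sub>M M)"
    proof (rule measurable_compose_countable)
      fix ij :: "int \<times> int"
      show "(\<lambda>z. (\<lambda>(i, j) z. g (of_int i / real (Suc m)) (of_int j / real (Suc m)) (snd z)) ij z)
          \<in> borel_measurable ((lborel \<Otimes>\<^sub>M lborel) \<Otimes>\<^sub>M M)"
        unfolding case_prod_beta by (rule measurable_compose[OF measurable_snd meas])
      show "(\<lambda>z. (\<lfloor>real (Suc m) * fst (fst z)\<rfloor>, \<lfloor>real (Suc m) * snd (fst z)\<rfloor>))
          \<in> measurable ((lborel \<Otimes>\<^sub>M lborel) \<Otimes>\<^sub>M M) (count_space UNIV)"
        by measurable
    qed
    then show "(\<lambda>z. g (q m (fst (fst z))) (q m (snd (fst z))) (snd z)) \<in> borel_measurable ((lborel \<Otimes>\<^sub>M lborel) \<Otimes>\<^sub>M M)"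
      by (simp add: q_def)
  qed
  then show ?thesis by (simp add: case_prod_beta')
qed

text \<open>The bridge from the Lebesgue integrals of the definitions to the gauge integrals of the
  pathwise analysis, which also absorbs exceptional null sets.\<close>

lemma set_lebesgue_integral_eq_integral_AE:
  fixes f g :: "real \<Rightarrow> real"
  assumes f: "(\<lambda>u. indicator {a..b} u * f u) \<in> borel_measurable borel" and g: "continuous_on {a..b} g"
    and eq: "AE u in lborel. u \<in> {a..b} \<longrightarrow> f u = g u"
  shows "set_lebesgue_integral lborel {a..b} f = integral {a..b} g"
proof -
  have "set_lebesgue_integral lborel {a..b} f = set_lebesgue_integral lborel {a..b} g"
    unfolding set_lebesgue_integral_def
  proof (rule integral_cong_AE)
    show "(\<lambda>x. indicator {a..b} x *\<^sub>R f x) \<in> borel_measurable lborel" using f by simp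
    show "(\<lambda>x. indicator {a..b} x *\<^sub>R g x) \<in> borel_measurable lborel"
      using borel_measurable_continuous_on_indicator[OF _ g] by simp
    show "AE x in lborel. indicator {a..b} x *\<^sub>R f x = indicator {a..b} x *\<^sub>R g x"
      using eq by eventually_elim (auto simp: indicator_def)
  qed
  also have "\<dots> = integral {a..b} g"
    by (rule set_borel_integral_eq_integral(2)[OF borel_integrable_atLeastAtMost'[OF g]])
  finally show ?thesis .
qed

text \<open>No measurability of the integrand is assumed: the integral is 0 where it does not exist, and where it
  does exist it is a difference of two monotone functions of the upper limit.\<close>

lemma borel_measurable_integral_upper_limit:
  fixes h :: "real \<Rightarrow> real"
  shows "(\<lambda>x. if t < x then set_lebesgue_integral lborel {t..x} h else 0) \<in> borel_measurable borel"
proof -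
  define A where "A = {x. t < x \<and> set_integrable lborel {t..x} h}"
  define P where "P f x = set_lebesgue_integral lborel {t..x} (\<lambda>u. max 0 (f u))" for f :: "real \<Rightarrow> real" and x
  have sub: "set_integrable lborel {t..x} h" if "set_integrable lborel {t..y} h" "x \<le> y" for x y
    using that by (intro set_integrable_subset[OF that(1)]) auto
  \<comment> \<open>Failure of integrability persists as the upper limit grows, so its indicator is
    monotone, which makes \<open>A\<close> a Borel set.\<close>
  have "mono (\<lambda>x. if t < x \<and> \<not> set_integrable lborel {t..x} h then 1 else 0 :: real)"
    by (rule monoI) (auto dest: sub)
  then have [measurable]: "(\<lambda>x. if t < x \<and> \<not> set_integrable lborel {t..x} h then 1 else 0 :: real) \<in> borel_measurable borel"
    by (rule borel_measurable_mono)
  have "A = {x \<in> space borel. t < x \<and> (if t < x \<and> \<not> set_integrable lborel {t..x} h then 1 else 0 :: real) = 0}"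
    unfolding A_def by auto
  also have "\<dots> \<in> sets borel" by measurable
  finally have A: "A \<in> sets borel" .
  have pint: "integrable lborel (\<lambda>u. indicator {t..x} u *\<^sub>R max 0 (c * h u))" if "x \<in> A" for x c
  proof -
    have "integrable lborel (\<lambda>u. indicator {t..x} u *\<^sub>R h u)" using that by (simp add: A_def set_integrable_def)
    then have "integrable lborel (\<lambda>u. max 0 (c * (indicator {t..x} u *\<^sub>R h u)))"
      by (intro integrable_max integrable_mult_right) auto
    moreover have "max 0 (c * (indicator {t..x} u *\<^sub>R h u)) = indicator {t..x} u *\<^sub>R max 0 (c * h u)" for u
      by (auto simp: indicator_def)
    ultimately show ?thesis by simp
  qed
  \<comment> \<open>Used with c = 1 and c = -1, which give the integrals of the positive and the
    negative part.\<close>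
  have mono: "mono_on A (P (\<lambda>u. c * h u))" for c
  proof (rule mono_onI)
    fix x y assume xy: "x \<in> A" "y \<in> A" "x \<le> y"
    show "P (\<lambda>u. c * h u) x \<le> P (\<lambda>u. c * h u) y"
      unfolding P_def set_lebesgue_integral_def
      using xy by (intro integral_mono pint) (auto simp: indicator_def)
  qed
  have "(\<lambda>x. P (\<lambda>u. 1 * h u) x - P (\<lambda>u. - 1 * h u) x) \<in> borel_measurable (restrict_space borel A)"
    by (intro borel_measurable_diff borel_measurable_mono_on_fnc mono)
  then have m: "(\<lambda>x. indicator A x *\<^sub>R (P (\<lambda>u. 1 * h u) x - P (\<lambda>u. - 1 * h u) x)) \<in> borel_measurable borel"
    using A by (subst (asm) borel_measurable_restrict_space_iff) auto
  have "(if t < x then set_lebesgue_integral lborel {t..x} h else 0)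
      = indicator A x *\<^sub>R (P (\<lambda>u. 1 * h u) x - P (\<lambda>u. - 1 * h u) x)" for x
  proof (cases "x \<in> A")
    case True
    have d: "P (\<lambda>u. 1 * h u) x - P (\<lambda>u. - 1 * h u) x
       = (\<integral>u. indicator {t..x} u *\<^sub>R max 0 (1 * h u) - indicator {t..x} u *\<^sub>R max 0 (- 1 * h u) \<partial>lborel)"
      unfolding P_def set_lebesgue_integral_def
      by (intro Bochner_Integration.integral_diff[symmetric] pint True)
    have mm: "i *\<^sub>R max 0 (1 * c) - i *\<^sub>R max 0 (- 1 * c) = i *\<^sub>R c" for i c :: real
      by (cases "c \<ge> 0") auto
    have "P (\<lambda>u. 1 * h u) x - P (\<lambda>u. - 1 * h u) x = set_lebesgue_integral lborel {t..x} h"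
      unfolding d mm set_lebesgue_integral_def ..
    moreover have "t < x" "indicator A x = (1::real)" using True by (auto simp: A_def)
    ultimately show ?thesis by simp
  next
    case False
    then have "set_lebesgue_integral lborel {t..x} h = 0" if "t < x"
      using that unfolding A_def set_lebesgue_integral_def set_integrable_def
      by (intro not_integrable_integral_eq) blast
    then show ?thesis using False by simp
  qed
  from measurable_cong[THEN iffD2, OF this m] show ?thesis .
qed

section \<open>Passage to the continuous version\<close>

lemma H1_continuous_kernel:
  fixes \<Theta> :: "'p::euclidean_space set"
  assumes "H1 \<Theta> k"
  shows "continuous_on (\<Theta> \<times> {0..1}) (\<lambda>(\<xi>, s). k \<xi> s)"
proof -
  obtain S g where S: "\<Theta> \<times> {0..1} \<subseteq> S" "C22_on S g" "\<forall>\<xi>\<in>\<Theta>. \<forall>t\<in>{0..1}. g (\<xi>, t) = k \<xi> t"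
    using assms unfolding H1_def by blast
  have "adm_word ([] :: 'p option list)" by (simp add: adm_word_def)
  then have "continuous_on S (iter_pd [] g)" using S(2) unfolding C22_on_def by blast
  then have "continuous_on (\<Theta> \<times> {0..1}) g" using S(1) continuous_on_subset by simp
  then show ?thesis by (rule continuous_on_eq) (use S(3) in auto)
qed

text \<open>The word \<open>[None]\<close> is the single time derivative. It exists two-sidedly on
  an open neighbourhood, so also at the end points of the unit interval, and is then restricted
  there, where \<open>g\<close> and \<open>k\<close> agree.\<close>

lemma H1_derivative:
  fixes \<Theta> :: "'p::euclidean_space set"
  assumes "H1 \<Theta> k" and \<theta>: "\<theta> \<in> \<Theta>"
  obtains k' where "continuous_on {0..1} k'"
    "\<And>s. s \<in> {0..1} \<Longrightarrow> (k \<theta> has_real_derivative k' s) (at s within {0..1})"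
proof -
  obtain S g where S: "\<Theta> \<times> {0..1} \<subseteq> S" "C22_on S g" "\<forall>\<xi>\<in>\<Theta>. \<forall>t\<in>{0..1}. g (\<xi>, t) = k \<xi> t"
    using assms unfolding H1_def by blast
  have adm: "adm_word ([None] :: 'p option list)" by (simp add: adm_word_def)
  then have c: "continuous_on S (iter_pd [None] g)" using S(2) unfolding C22_on_def by blast
  have d: "(\<lambda>h. iter_pd [] g (x + h *\<^sub>R pdir None)) differentiable (at 0)" if "x \<in> S" for x
    using S(2) adm that unfolding C22_on_def by blast
  define k' where "k' s = pd None g (\<theta>, s)" for s
  show ?thesis
  proof (rule that[of k'])
    have "continuous_on {0..1} (\<lambda>s. iter_pd [None] g (\<theta>, s))"
      using S(1) \<theta> by (intro continuous_on_compose2[OF c] continuous_intros) auto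
    then show "continuous_on {0..1} k'" by (simp add: k'_def[abs_def])
    fix s :: real assume s: "s \<in> {0..1}"
    have "(\<theta>, s) \<in> S" using S(1) \<theta> s by auto
    from d[OF this] have "(\<lambda>h. g (\<theta>, h + s)) differentiable (at 0)"
      by (simp add: pdir_def add.commute)
    then have "((\<lambda>h. g (\<theta>, h + s)) has_real_derivative deriv (\<lambda>h. g (\<theta>, h + s)) 0) (at 0)"
      using real_differentiableE DERIV_imp_deriv by metis
    then have "((\<lambda>h. g (\<theta>, h + s)) has_real_derivative k' s) (at 0)"
      by (simp add: k'_def pd_def pdir_def add.commute)
    then have "((\<lambda>r. g (\<theta>, r)) has_real_derivative k' s) (at s)"
      using DERIV_shift[of "\<lambda>r. g (\<theta>, r)" "k' s" 0 s] by simp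
    then have "((\<lambda>r. g (\<theta>, r)) has_real_derivative k' s) (at s within {0..1})"
      by (rule has_field_derivative_at_within)
    then show "(k \<theta> has_real_derivative k' s) (at s within {0..1})"
      by (rule has_field_derivative_transform_within[OF _ zero_less_one s]) (use S(3) \<theta> in auto)
  qed
qed

section \<open>The contrast and its limit computed from the continuous version\<close>

context volatility_path
begin

lemma Iint_eq_J:
  assumes V: "(\<lambda>u. V t u \<omega>) \<in> borel_measurable borel" and t: "t \<in> {0..1}" and x: "x \<in> {0..1}"
    and ae: "AE u in lborel. t \<le> u \<and> u \<le> 1 \<longrightarrow> V t u \<omega> = v t u"
  shows "Iint V t x \<omega> = J t x"
proof (cases "t < x")
  case True
  have "set_lebesgue_integral lborel {t..x} (\<lambda>u. V t u \<omega>) = integral {t..x} (v t)"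
  proof (rule set_lebesgue_integral_eq_integral_AE)
    show "(\<lambda>u. indicator {t..x} u * V t u \<omega>) \<in> borel_measurable borel" using V by simp
    show "continuous_on {t..x} (v t)" using t x by (intro continuous_on_subset[OF cont_v_section[OF t]]) auto
    show "AE u in lborel. u \<in> {t..x} \<longrightarrow> V t u \<omega> = v t u" using ae by eventually_elim (use x in auto)
  qed
  then show ?thesis using True by (simp add: Iint_def J_def)
qed (simp add: Iint_def J_def max_absorb1)

lemma sig_eq_\<sigma>:
  assumes V: "(\<lambda>u. V t u \<omega>) \<in> borel_measurable borel" and t: "t \<in> {0..1}" and x: "x \<in> {0..1}"
    and ae: "AE u in lborel. t \<le> u \<and> u \<le> 1 \<longrightarrow> V t u \<omega> = v t u" and \<xi>: "\<xi> \<in> \<Theta>"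
  shows "sig \<kappa> V \<xi> t x \<omega> = \<sigma> \<xi> t x"
proof (cases "t < x")
  case True
  have "continuous_on {0..1} (\<kappa> \<xi>)" by (rule continuous_on_section[OF cont_\<kappa> \<xi>])
  then have ck: "(\<lambda>s. \<kappa> \<xi> (clamp01 s)) \<in> borel_measurable borel"
    by (intro borel_measurable_continuous_onI continuous_on_clamp01)
  have "set_lebesgue_integral lborel {t..x} (\<lambda>u. \<kappa> \<xi> (u - t) * V t u \<omega>) = integral {t..x} (\<lambda>u. \<kappa> \<xi> (max 0 (u - t)) * v t u)"
  proof (rule set_lebesgue_integral_eq_integral_AE)
    \<comment> \<open>The kernel is known to be continuous on the unit interval only; clamping its
      argument gives a Borel function on the line that agrees with it on the range of
      integration.\<close>
    have "(\<lambda>u. indicator {t..x} u * (\<kappa> \<xi> (clamp01 (u - t)) * V t u \<omega>)) \<in> borel_measurable borel"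
      by (intro borel_measurable_times V measurable_compose[OF _ ck]) auto
    moreover have "indicator {t..x} u * (\<kappa> \<xi> (clamp01 (u - t)) * V t u \<omega>) = indicator {t..x} u * (\<kappa> \<xi> (u - t) * V t u \<omega>)" for u
      using t x by (cases "u \<in> {t..x}") (auto simp: clamp01_eq)
    ultimately show "(\<lambda>u. indicator {t..x} u * (\<kappa> \<xi> (u - t) * V t u \<omega>)) \<in> borel_measurable borel" by simp
    show "continuous_on {t..x} (\<lambda>u. \<kappa> \<xi> (max 0 (u - t)) * v t u)"
      using t x by (intro continuous_on_subset[OF cont_kv_section[OF \<xi> t]]) auto
    show "AE u in lborel. u \<in> {t..x} \<longrightarrow> \<kappa> \<xi> (u - t) * V t u \<omega> = \<kappa> \<xi> (max 0 (u - t)) * v t u"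
      using ae by eventually_elim (use x in \<open>auto simp: max_absorb2\<close>)
  qed
  then show ?thesis using True by (simp add: sig_def \<sigma>_def)
qed (simp add: sig_def \<sigma>_def max_absorb1)

lemma sig_hat_eq_\<sigma>h:
  assumes V: "(\<lambda>u. V t u \<omega>) \<in> borel_measurable borel" and t: "t \<in> {0..1}"
    and ae: "AE u in lborel. t \<le> u \<and> u \<le> 1 \<longrightarrow> V t u \<omega> = v t u"
    and grid: "T d 0 = 0 \<and> T d d \<le> 1 \<and> (\<forall>j<d. T d j < T d (Suc j))" and j: "j \<le> d"
  shows "sig_hat \<kappa> V T d \<xi> t j \<omega> = \<sigma>h T d \<xi> t j"
  unfolding sig_hat_def \<sigma>h_def One_nat_def sum.atLeast1_atMost_eq
proof (rule sum.cong[OF refl])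
  fix l assume "l \<in> {..<j}"
  then have l: "Suc l \<le> d" "T d l < T d (Suc l)" using j grid by auto
  have T: "T d l \<in> {0..1}" "T d (Suc l) \<in> {0..1}"
    using grid_in_unit_interval[OF grid, of l] grid_in_unit_interval[OF grid, of "Suc l"] l by auto
  have I: "Iint V t (T d (Suc l)) \<omega> = J t (T d (Suc l))" "Iint V t (T d l) \<omega> = J t (T d l)"
    using Iint_eq_J[where V = V and \<omega> = \<omega>, OF V t _ ae] T by auto
  show "\<kappa> \<xi> (T d (Suc l) - t) * (Iint V t (T d (Suc l)) \<omega> - Iint V t (T d (Suc l - Suc 0)) \<omega>)
      = \<kappa> \<xi> (max 0 (T d (Suc l) - t)) * (J t (T d (Suc l)) - J t (T d l))"
  proof (cases "T d (Suc l) \<ge> t")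
    case False
    with l have "J t (T d (Suc l)) = 0" "J t (T d l) = 0" by (auto simp: J_def max_absorb1)
    then show ?thesis by (simp add: I)
  qed (simp add: I max_absorb2)
qed

text \<open>For fixed \<open>n\<close> only the times i/n enter, so agreement almost everywhere in u
  at these finitely many times is enough. The time i = n is included because increments also use
  right end points.\<close>

lemma Und_eq_U:
  assumes V: "\<And>t. (\<lambda>u. V t u \<omega>) \<in> borel_measurable borel"
    and ae: "\<And>i. i \<le> n \<Longrightarrow> AE u in lborel. real i / real n \<le> u \<and> u \<le> 1 \<longrightarrow> V (real i / real n) u \<omega> = v (real i / real n) u"
    and grid: "T d 0 = 0 \<and> T d d \<le> 1 \<and> (\<forall>j<d. T d j < T d (Suc j))"
    and n: "n \<ge> 1" and d: "d \<ge> 1"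
  shows "Und \<kappa> V T \<epsilon> n d \<xi> \<omega> = U T \<epsilon> n d \<xi>"
proof -
  have p: "real i / real n \<in> {0..1}" if "i \<le> n" for i using that n by (auto simp: field_simps)
  have T: "T d (Suc j) \<in> {0..1}" if "j < d" for j using grid_in_unit_interval[OF grid, of "Suc j"] that by auto
  have summand: "Feps \<epsilon> d (\<lambda>j. sig_hat \<kappa> V T d \<xi> (real i / real n) j \<omega>)
          (\<lambda>j. (Iint V (real (Suc i) / real n) (T d j) \<omega> - Iint V (real i / real n) (T d j) \<omega>) / sqrt (1 / real n))
     = ln ((\<Sum>j<d. (\<sigma>h T d \<xi> (real i / real n) (Suc j))\<^sup>2) / real d + \<epsilon>)
      + ((\<Sum>j<d. real n * (J (real (Suc i) / real n) (T d (Suc j)) - J (real i / real n) (T d (Suc j)))\<^sup>2) / real d + \<epsilon>)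
       / ((\<Sum>j<d. (\<sigma>h T d \<xi> (real i / real n) (Suc j))\<^sup>2) / real d + \<epsilon>)" if i: "i < n" for i
  proof -
    have i': "i \<le> n" "Suc i \<le> n" using i by auto
    have a: "sqnorm d (\<lambda>j. sig_hat \<kappa> V T d \<xi> (real i / real n) j \<omega>) = (\<Sum>j<d. (\<sigma>h T d \<xi> (real i / real n) (Suc j))\<^sup>2)"
      unfolding sqnorm_def One_nat_def sum.atLeast1_atMost_eq
      by (intro sum.cong refl arg_cong[where f = "\<lambda>x. x\<^sup>2"] sig_hat_eq_\<sigma>h V p ae grid i') auto
    have b: "sqnorm d (\<lambda>j. (Iint V (real (Suc i) / real n) (T d j) \<omega> - Iint V (real i / real n) (T d j) \<omega>) / sqrt (1 / real n))
        = (\<Sum>j<d. real n * (J (real (Suc i) / real n) (T d (Suc j)) - J (real i / real n) (T d (Suc j)))\<^sup>2)"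
      unfolding sqnorm_def One_nat_def sum.atLeast1_atMost_eq
    proof (rule sum.cong[OF refl])
      fix j assume "j \<in> {..<d}"
      then have j: "j < d" by simp
      show "((Iint V (real (Suc i) / real n) (T d (Suc j)) \<omega> - Iint V (real i / real n) (T d (Suc j)) \<omega>) / sqrt (1 / real n))\<^sup>2
        = real n * (J (real (Suc i) / real n) (T d (Suc j)) - J (real i / real n) (T d (Suc j)))\<^sup>2"
        unfolding Iint_eq_J[where V = V and \<omega> = \<omega>, OF V p[OF i'(1)] T[OF j] ae[OF i'(1)]] Iint_eq_J[where V = V and \<omega> = \<omega>, OF V p[OF i'(2)] T[OF j] ae[OF i'(2)]]
        using n by (simp add: power_divide)
    qed
    have r: "(x + \<epsilon> * c) / (y + \<epsilon> * c) = (x / c + \<epsilon>) / (y / c + \<epsilon>)" if "c > 0" for x y c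
    proof -
      have "x / c + \<epsilon> = (x + \<epsilon> * c) / c" "y / c + \<epsilon> = (y + \<epsilon> * c) / c" using that by (auto simp: field_simps)
      then show ?thesis using that by simp
    qed
    show ?thesis unfolding Feps_def a b using d by (subst r) auto
  qed
  show ?thesis
    unfolding Und_def U_def One_nat_def sum.atLeast1_atMost_eq using summand by simp
qed

text \<open>At almost every time t the path \<open>V t\<close> agrees with \<open>v t\<close> almost
  everywhere, and there the inner integrals coincide. The exceptional times drop out of the outer
  integral once its integrand is known to be measurable, and this is where the work lies.\<close>

lemma Ulim_eq_integral:
  assumes V: "(\<lambda>(t, u). V t u \<omega>) \<in> borel_measurable (borel \<Otimes>\<^sub>M borel)"
    and ae: "AE t in lborel. AE u in lborel. 0 \<le> t \<and> t \<le> u \<and> u \<le> 1 \<longrightarrow> V t u \<omega> = v t u"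
    and grid: "\<And>d. d \<ge> 1 \<Longrightarrow> T d 0 = 0 \<and> T d d \<le> 1 \<and> (\<forall>j<d. T d j < T d (Suc j))"
    and H4: "H4 \<mu> T" and eps: "\<epsilon> > 0" and \<xi>: "\<xi> \<in> \<Theta>"
  shows "Ulim \<kappa> V \<mu> \<theta> \<epsilon> \<xi> \<omega>
    = integral {0..1} (\<lambda>t. ln (S \<mu> \<xi> t + \<epsilon>) + (S \<mu> \<theta> t + \<epsilon>) / (S \<mu> \<xi> t + \<epsilon>))"
proof -
  interpret mu: prob_space \<mu> using H4_D(1)[OF H4] .
  have smu: "sets \<mu> = sets borel" by (rule H4_D(2)[OF H4])
  have V': "(\<lambda>u. V t u \<omega>) \<in> borel_measurable borel" for t
    using measurable_compose[OF measurable_Pair1'[of t borel borel] V] by simp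
  define R where "R \<zeta> t = (\<integral>x. (sig \<kappa> V \<zeta> t x \<omega>)\<^sup>2 \<partial>\<mu>)" for \<zeta> t
  have sigm: "(\<lambda>x. (sig \<kappa> V \<zeta> t x \<omega>)\<^sup>2) \<in> borel_measurable \<mu>" for \<zeta> t
  proof -
    have "(\<lambda>x. (sig \<kappa> V \<zeta> t x \<omega>)\<^sup>2) \<in> borel_measurable borel"
      unfolding sig_def by (intro borel_measurable_power borel_measurable_integral_upper_limit)
    then show ?thesis using measurable_cong_sets[OF smu refl] by blast
  qed
  \<comment> \<open>On the unit square \<open>sig\<close> equals \<open>G\<close>, an integral of a
    jointly measurable function with clamped kernel argument; integrating its square over x gives a
    Borel function of t.\<close>
  have Rm: "\<exists>r. r \<in> borel_measurable borel \<and> (\<forall>t\<in>{0..1}. R \<zeta> t = r t)" if \<zeta>: "\<zeta> \<in> \<Theta>" for \<zeta>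
  proof -
    have "continuous_on {0..1} (\<kappa> \<zeta>)" by (rule continuous_on_section[OF cont_\<kappa> \<zeta>])
    then have ck[measurable]: "(\<lambda>s. \<kappa> \<zeta> (clamp01 s)) \<in> borel_measurable borel"
      by (intro borel_measurable_continuous_onI continuous_on_clamp01)
    define f where "f p u = (if 0 \<le> fst p \<and> fst p < snd p \<and> snd p \<le> 1 \<and> fst p \<le> u \<and> u \<le> snd p
       then \<kappa> \<zeta> (clamp01 (u - fst p)) * V (fst p) u \<omega> else 0)" for p :: "real \<times> real" and u
    define G where "G p = (\<integral>u. f p u \<partial>lborel)" for p
    have Vp: "(\<lambda>q. V (fst (fst q)) (snd q) \<omega>) \<in> borel_measurable ((borel \<Otimes>\<^sub>M borel) \<Otimes>\<^sub>M lborel)"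
    proof -
      have "(\<lambda>q. (fst (fst q), snd q)) \<in> measurable ((borel \<Otimes>\<^sub>M borel) \<Otimes>\<^sub>M lborel) (borel \<Otimes>\<^sub>M borel)" by measurable
      from measurable_compose[OF this V] show ?thesis by simp
    qed
    have kp: "(\<lambda>q. \<kappa> \<zeta> (clamp01 (snd q - fst (fst q)))) \<in> borel_measurable ((borel \<Otimes>\<^sub>M borel) \<Otimes>\<^sub>M lborel)"
      by (rule measurable_compose[OF _ ck]) measurable
    have "(\<lambda>q. f (fst q) (snd q)) \<in> borel_measurable ((borel \<Otimes>\<^sub>M borel) \<Otimes>\<^sub>M lborel)"
      unfolding f_def by (intro measurable_If borel_measurable_times Vp kp) measurable
    then have Gm: "G \<in> borel_measurable (borel \<Otimes>\<^sub>M borel)"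
      unfolding G_def[abs_def] by (intro lborel.borel_measurable_lebesgue_integral) (simp add: case_prod_beta')
    have Gs: "sig \<kappa> V \<zeta> t x \<omega> = G (t, x)" if "t \<in> {0..1}" "x \<in> {0..1}" for t x
    proof (cases "t < x")
      case True
      then show ?thesis
        unfolding sig_def G_def f_def set_lebesgue_integral_def using that
        by (auto intro!: Bochner_Integration.integral_cong simp: indicator_def clamp01_eq)
    qed (simp add: sig_def G_def f_def)
    have Gm2: "(\<lambda>q. (G (fst q, snd q))\<^sup>2) \<in> borel_measurable (borel \<Otimes>\<^sub>M \<mu>)"
    proof -
      have "G \<in> borel_measurable (borel \<Otimes>\<^sub>M \<mu>)"
        using Gm measurable_cong_sets[OF sets_pair_measure_cong[OF refl smu] refl] by blast
      then show ?thesis by simp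
    qed
    define r where "r t = (\<integral>x. (G (t, x))\<^sup>2 \<partial>\<mu>)" for t
    have "r \<in> borel_measurable borel"
      unfolding r_def[abs_def] using Gm2 by (intro mu.borel_measurable_lebesgue_integral) (simp add: case_prod_beta')
    moreover have "R \<zeta> t = r t" if t: "t \<in> {0..1}" for t
      unfolding R_def r_def
    proof (rule integral_cong_AE[OF sigm])
      show "(\<lambda>x. (G (t, x))\<^sup>2) \<in> borel_measurable \<mu>"
        using measurable_compose[OF measurable_Pair1'[of t borel \<mu>] Gm2] by simp
      show "AE x in \<mu>. (sig \<kappa> V \<zeta> t x \<omega>)\<^sup>2 = (G (t, x))\<^sup>2"
        using H4_D(3)[OF H4] by eventually_elim (simp add: Gs[OF t])
    qed
    ultimately show ?thesis by blast
  qed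
  have RS: "R \<zeta> t = S \<mu> \<zeta> t" if \<zeta>: "\<zeta> \<in> \<Theta>" and t: "t \<in> {0..1}"
    and aet: "AE u in lborel. 0 \<le> t \<and> t \<le> u \<and> u \<le> 1 \<longrightarrow> V t u \<omega> = v t u" for \<zeta> t
    unfolding R_def S_def
  proof (rule integral_cong_AE[OF sigm])
    have "continuous_on {0..1} (\<lambda>x. (\<sigma> \<zeta> t x)\<^sup>2)"
      using continuous_on_section[OF cont_\<sigma>, of "(\<zeta>, t)"] \<zeta> t by (auto intro!: continuous_intros)
    then show "(\<lambda>x. (\<sigma> \<zeta> t (clamp01 x))\<^sup>2) \<in> borel_measurable \<mu>"
      by (intro borel_measurable_integrable integrable_clamp01[where h = "\<lambda>x. (\<sigma> \<zeta> t x)\<^sup>2"] H4_D(1,2)[OF H4])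
    have "AE u in lborel. t \<le> u \<and> u \<le> 1 \<longrightarrow> V t u \<omega> = v t u" using aet by eventually_elim (use t in auto)
    then have "sig \<kappa> V \<zeta> t x \<omega> = \<sigma> \<zeta> t x" if "x \<in> {0..1}" for x
      using sig_eq_\<sigma>[where V = V and \<omega> = \<omega>, OF V' t that _ \<zeta>] by simp
    then show "AE x in \<mu>. (sig \<kappa> V \<zeta> t x \<omega>)\<^sup>2 = (\<sigma> \<zeta> t (clamp01 x))\<^sup>2"
      using H4_D(3)[OF H4] by (auto elim!: eventually_mono simp: clamp01_eq simp del: atLeastAtMost_iff)
  qed
  obtain r1 where r1: "r1 \<in> borel_measurable borel" "\<forall>t\<in>{0..1}. R \<xi> t = r1 t" using Rm[OF \<xi>] by blast
  obtain r2 where r2: "r2 \<in> borel_measurable borel" "\<forall>t\<in>{0..1}. R \<theta> t = r2 t" using Rm[OF \<theta>] by blast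
  have "set_lebesgue_integral lborel {0..1} (\<lambda>t. ln (R \<xi> t + \<epsilon>) + (R \<theta> t + \<epsilon>) / (R \<xi> t + \<epsilon>))
     = integral {0..1} (\<lambda>t. ln (S \<mu> \<xi> t + \<epsilon>) + (S \<mu> \<theta> t + \<epsilon>) / (S \<mu> \<xi> t + \<epsilon>))"
  proof (rule set_lebesgue_integral_eq_integral_AE)
    have "(\<lambda>t. indicator {0..1} t * (ln (r1 t + \<epsilon>) + (r2 t + \<epsilon>) / (r1 t + \<epsilon>))) \<in> borel_measurable borel"
      using r1(1) r2(1) by measurable
    moreover have "indicator {0..1} t * (ln (r1 t + \<epsilon>) + (r2 t + \<epsilon>) / (r1 t + \<epsilon>))
        = indicator {0..1} t * (ln (R \<xi> t + \<epsilon>) + (R \<theta> t + \<epsilon>) / (R \<xi> t + \<epsilon>))" for t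
      using r1(2) r2(2) by (auto simp: indicator_def)
    ultimately show "(\<lambda>t. indicator {0..1} t * (ln (R \<xi> t + \<epsilon>) + (R \<theta> t + \<epsilon>) / (R \<xi> t + \<epsilon>))) \<in> borel_measurable borel"
      by simp
    have "continuous_on (\<Theta> \<times> {0..1}) (\<lambda>p. S \<mu> (fst p) (snd p))" by (rule cont_S[OF H4 grid])
    then have "continuous_on {0..1} (S \<mu> \<zeta>)" if "\<zeta> \<in> \<Theta>" for \<zeta>
      using continuous_on_section[of \<Theta> "{0..1}" "S \<mu>" \<zeta>] that by (simp add: case_prod_beta')
    moreover have "S \<mu> \<zeta> t + \<epsilon> > 0" for \<zeta> t using S_nonneg[of \<mu> \<zeta> t] eps by simp
    moreover from this have "S \<mu> \<zeta> t + \<epsilon> \<noteq> 0" for \<zeta> t using less_imp_neq by metis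
    ultimately show "continuous_on {0..1} (\<lambda>t. ln (S \<mu> \<xi> t + \<epsilon>) + (S \<mu> \<theta> t + \<epsilon>) / (S \<mu> \<xi> t + \<epsilon>))"
      using \<xi> \<theta> by (intro continuous_intros) auto
    show "AE t in lborel. t \<in> {0..1} \<longrightarrow> ln (R \<xi> t + \<epsilon>) + (R \<theta> t + \<epsilon>) / (R \<xi> t + \<epsilon>)
        = ln (S \<mu> \<xi> t + \<epsilon>) + (S \<mu> \<theta> t + \<epsilon>) / (S \<mu> \<xi> t + \<epsilon>)"
      using ae
    proof eventually_elim
      case (elim t)
      show ?case
      proof
        assume "t \<in> {0..1}"
        then have "R \<xi> t = S \<mu> \<xi> t" "R \<theta> t = S \<mu> \<theta> t" using RS[OF _ _ elim] \<xi> \<theta> by auto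
        then show "ln (R \<xi> t + \<epsilon>) + (R \<theta> t + \<epsilon>) / (R \<xi> t + \<epsilon>)
            = ln (S \<mu> \<xi> t + \<epsilon>) + (S \<mu> \<theta> t + \<epsilon>) / (S \<mu> \<xi> t + \<epsilon>)" by simp
      qed
    qed
  qed
  then show ?thesis by (simp add: Ulim_def R_def Let_def)
qed

end

text \<open>The supremum over \<open>\<Theta>\<close> is dominated by a measurable quantity via the Cauchy property on a countable
  dense subset, so neither the supremum nor the limit needs to be measurable.\<close>

lemma AE_uniform_limit_imp_outer_probability:
  fixes U :: "nat \<Rightarrow> 'p::{metric_space, second_countable_topology} \<Rightarrow> 'a \<Rightarrow> real"
  assumes M: "prob_space M" and meas: "\<And>m \<xi>. \<xi> \<in> \<Theta> \<Longrightarrow> U m \<xi> \<in> borel_measurable M"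
    and cont: "\<And>m \<omega>. \<omega> \<in> space M \<Longrightarrow> continuous_on \<Theta> (\<lambda>\<xi>. U m \<xi> \<omega>)"
    and lim: "AE \<omega> in M. uniform_limit \<Theta> (\<lambda>m \<xi>. U m \<xi> \<omega>) (\<lambda>\<xi>. L \<xi> \<omega>) sequentially"
    and \<eta>: "\<eta> > 0" and \<delta>: "\<delta> > 0"
  shows "\<exists>m. \<exists>A\<in>sets M. {\<omega>\<in>space M. \<exists>\<xi>\<in>\<Theta>. \<bar>U m \<xi> \<omega> - L \<xi> \<omega>\<bar> > \<eta>} \<subseteq> A \<and> measure M A < \<delta>"
proof -
  interpret prob_space M by fact
  obtain D where D: "countable D" "D \<subseteq> \<Theta>" "\<Theta> \<subseteq> closure D" by (rule separable)
  \<comment> \<open>A Cauchy defect beyond index m: measurable because \<open>D\<close> is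
    countable, decreasing in m, and with null intersection. The threshold is \<eta>/2 because a late
    term within \<eta>/2 of the limit is more than \<eta>/2 from a term that misses it by
    \<eta>.\<close>
  define E where "E m = {\<omega>\<in>space M. \<exists>\<xi>\<in>D. \<exists>l\<ge>m. \<exists>l'\<ge>m. \<bar>U l \<xi> \<omega> - U l' \<xi> \<omega>\<bar> > \<eta> / 2}" for m
  obtain N where N: "{\<omega>\<in>space M. \<not> uniform_limit \<Theta> (\<lambda>m \<xi>. U m \<xi> \<omega>) (\<lambda>\<xi>. L \<xi> \<omega>) sequentially} \<subseteq> N"
    "emeasure M N = 0" "N \<in> sets M" using lim by (rule AE_E)
  have E: "E m \<in> sets M" for m
  proof -
    have "{\<omega>\<in>space M. \<bar>U l \<xi> \<omega> - U l' \<xi> \<omega>\<bar> > \<eta> / 2} \<in> sets M" if "\<xi> \<in> D" for \<xi> l l'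
    proof -
      have [measurable]: "U l \<xi> \<in> borel_measurable M" for l using meas that D by auto
      show ?thesis by measurable
    qed
    then have "(\<Union>\<xi>\<in>D. \<Union>l\<in>{m..}. \<Union>l'\<in>{m..}. {\<omega>\<in>space M. \<bar>U l \<xi> \<omega> - U l' \<xi> \<omega>\<bar> > \<eta> / 2}) \<in> sets M"
      using D(1) by (intro sets.countable_UN') auto
    moreover have "E m = (\<Union>\<xi>\<in>D. \<Union>l\<in>{m..}. \<Union>l'\<in>{m..}. {\<omega>\<in>space M. \<bar>U l \<xi> \<omega> - U l' \<xi> \<omega>\<bar> > \<eta> / 2})"
      unfolding E_def by auto
    ultimately show ?thesis by simp
  qed
  have "decseq E" unfolding decseq_def E_def by (auto intro: order_trans)
  then have "(\<lambda>m. measure M (E m)) \<longlonglongrightarrow> measure M (\<Inter>m. E m)"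
    using E by (intro finite_Lim_measure_decseq) auto
  moreover have "measure M (\<Inter>m. E m) = 0"
  proof -
    have "(\<Inter>m. E m) \<subseteq> N"
    proof
      fix \<omega> assume w: "\<omega> \<in> (\<Inter>m. E m)"
      then have sp: "\<omega> \<in> space M" by (auto simp: E_def)
      show "\<omega> \<in> N"
      proof (rule ccontr)
        assume "\<omega> \<notin> N"
        then have "uniform_limit \<Theta> (\<lambda>m \<xi>. U m \<xi> \<omega>) (\<lambda>\<xi>. L \<xi> \<omega>) sequentially" using N(1) sp by blast
        from uniform_limitD[OF this, of "\<eta> / 4"] \<eta>
        obtain m where m: "\<And>l \<xi>. l \<ge> m \<Longrightarrow> \<xi> \<in> \<Theta> \<Longrightarrow> \<bar>U l \<xi> \<omega> - L \<xi> \<omega>\<bar> < \<eta> / 4"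
          unfolding eventually_sequentially dist_real_def by auto
        from w obtain \<xi> l l' where x: "\<xi> \<in> D" "l \<ge> m" "l' \<ge> m" "\<bar>U l \<xi> \<omega> - U l' \<xi> \<omega>\<bar> > \<eta> / 2"
          unfolding E_def by blast
        from x(1) D(2) have "\<xi> \<in> \<Theta>" by auto
        from m[OF x(2) this] m[OF x(3) this] x(4) show False by linarith
      qed
    qed
    then have "emeasure M (\<Inter>m. E m) \<le> emeasure M N" using N(3) by (rule emeasure_mono)
    then show ?thesis using N(2) by (simp add: measure_def)
  qed
  ultimately have "eventually (\<lambda>m. measure M (E m) < \<delta>) sequentially"
    using \<delta> order_tendstoD(2) by fastforce
  then obtain m where m: "measure M (E m) < \<delta>" unfolding eventually_sequentially by blast
  have "{\<omega>\<in>space M. \<exists>\<xi>\<in>\<Theta>. \<bar>U m \<xi> \<omega> - L \<xi> \<omega>\<bar> > \<eta>} \<subseteq> E m \<union> N"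
  proof
    fix \<omega> assume "\<omega> \<in> {\<omega>\<in>space M. \<exists>\<xi>\<in>\<Theta>. \<bar>U m \<xi> \<omega> - L \<xi> \<omega>\<bar> > \<eta>}"
    then obtain \<xi> where w: "\<omega> \<in> space M" and \<xi>: "\<xi> \<in> \<Theta>" and big: "\<bar>U m \<xi> \<omega> - L \<xi> \<omega>\<bar> > \<eta>" by auto
    show "\<omega> \<in> E m \<union> N"
    proof (cases "\<omega> \<in> N")
      case False
      then have "uniform_limit \<Theta> (\<lambda>m \<xi>. U m \<xi> \<omega>) (\<lambda>\<xi>. L \<xi> \<omega>) sequentially" using N(1) w by blast
      from uniform_limitD[OF this, of "\<eta> / 2"] \<eta>
      obtain m' where m': "\<And>l \<xi>. l \<ge> m' \<Longrightarrow> \<xi> \<in> \<Theta> \<Longrightarrow> \<bar>U l \<xi> \<omega> - L \<xi> \<omega>\<bar> < \<eta> / 2"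
        unfolding eventually_sequentially dist_real_def by auto
      define l where "l = max m m'"
      have "\<bar>U l \<xi> \<omega> - L \<xi> \<omega>\<bar> < \<eta> / 2" using m'[OF _ \<xi>, of l] by (simp add: l_def)
      then have gt: "\<bar>U m \<xi> \<omega> - U l \<xi> \<omega>\<bar> > \<eta> / 2" using big by linarith
      \<comment> \<open>The inequality is strict and both functions are continuous in the parameter,
        so it persists at a nearby point of the countable set.\<close>
      obtain x where x: "\<And>i. x i \<in> D" "x \<longlonglongrightarrow> \<xi>" using D(3) \<xi> closure_sequential by blast
      have "continuous_on \<Theta> (\<lambda>\<xi>. \<bar>U m \<xi> \<omega> - U l \<xi> \<omega>\<bar>)" by (intro continuous_intros cont w)
      then have "(\<lambda>i. \<bar>U m (x i) \<omega> - U l (x i) \<omega>\<bar>) \<longlonglongrightarrow> \<bar>U m \<xi> \<omega> - U l \<xi> \<omega>\<bar>"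
      proof (rule continuous_on_tendsto_compose[OF _ x(2) \<xi>])
        have "x i \<in> \<Theta>" for i using x(1) D(2) by blast
        then show "eventually (\<lambda>i. x i \<in> \<Theta>) sequentially" by simp
      qed
      then have "eventually (\<lambda>i. \<bar>U m (x i) \<omega> - U l (x i) \<omega>\<bar> > \<eta> / 2) sequentially"
        using gt by (rule order_tendstoD)
      then obtain i where "\<bar>U m (x i) \<omega> - U l (x i) \<omega>\<bar> > \<eta> / 2" unfolding eventually_sequentially by blast
      moreover have "l \<ge> m" by (simp add: l_def)
      ultimately show ?thesis using w x(1)[of i] unfolding E_def by blast
    qed simp
  qed
  moreover have "measure M (E m \<union> N) < \<delta>"
  proof -
    have "measure M (E m \<union> N) \<le> measure M (E m) + measure M N" by (rule measure_Un_le) (use E N in auto)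
    also have "measure M N = 0" using N(2) by (simp add: measure_def)
    finally show ?thesis using m by simp
  qed
  ultimately show ?thesis using E N(3) by blast
qed

section \<open>Regularity of the contrast, and identification of \<open>V\<close> with its
  continuous version\<close>

lemma Und_measurable:
  assumes V: "(\<lambda>((t, u), \<omega>). V t u \<omega>) \<in> borel_measurable ((lborel \<Otimes>\<^sub>M lborel) \<Otimes>\<^sub>M M)"
  shows "Und k V T \<epsilon> n d \<xi> \<in> borel_measurable M"
proof -
  have I[measurable]: "Iint V t x \<in> borel_measurable M" for t x
  proof -
    have "(\<lambda>q. ((t, snd q), fst q)) \<in> measurable (M \<Otimes>\<^sub>M lborel) ((lborel \<Otimes>\<^sub>M lborel) \<Otimes>\<^sub>M M)" by measurable
    from measurable_compose[OF this V]
    have [measurable]: "(\<lambda>q. V t (snd q) (fst q)) \<in> borel_measurable (M \<Otimes>\<^sub>M lborel)" by simp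
    have "(\<lambda>(\<omega>, u). indicator {t..x} u *\<^sub>R V t u \<omega>) \<in> borel_measurable (M \<Otimes>\<^sub>M lborel)"
      unfolding case_prod_beta' by measurable
    then have "(\<lambda>\<omega>. \<integral>u. indicator {t..x} u *\<^sub>R V t u \<omega> \<partial>lborel) \<in> borel_measurable M"
      by (rule lborel.borel_measurable_lebesgue_integral)
    then show ?thesis unfolding Iint_def[abs_def] set_lebesgue_integral_def by (cases "t < x") auto
  qed
  show ?thesis unfolding Und_def[abs_def] Feps_def sqnorm_def sig_hat_def by measurable
qed

text \<open>Continuity in \<xi> lets a countable dense set control the supremum. Maturities before t
  lead to negative kernel arguments, where the kernel is constantly 0 in \<xi>.\<close>

lemma Und_continuous:
  assumes k: "continuous_on (\<Theta> \<times> {0..1}) (\<lambda>(\<xi>, s). k \<xi> s)" and k_neg: "\<And>\<xi> t. t < 0 \<Longrightarrow> k \<xi> t = 0"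
    and grid: "T d 0 = 0 \<and> T d d \<le> 1 \<and> (\<forall>j<d. T d j < T d (Suc j))" and d: "d \<ge> 1" and eps: "\<epsilon> > 0"
  shows "continuous_on \<Theta> (\<lambda>\<xi>. Und k V T \<epsilon> n d \<xi> \<omega>)"
proof -
  have ks: "continuous_on \<Theta> (\<lambda>\<xi>. k \<xi> s)" if "s \<le> 1" for s
  proof (cases "s < 0")
    case False
    have "continuous_on \<Theta> (\<lambda>\<xi>. (\<lambda>(\<xi>, s). k \<xi> s) (\<xi>, s))"
      using False that by (intro continuous_on_compose2[OF k] continuous_intros) auto
    then show ?thesis by simp
  qed (simp add: k_neg)
  have sh: "continuous_on \<Theta> (\<lambda>\<xi>. sig_hat k V T d \<xi> t j \<omega>)" if "j \<le> d" "t \<ge> 0" for j t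
    unfolding sig_hat_def
  proof (intro continuous_intros ks)
    fix l assume "l \<in> {1..j}"
    then show "T d l - t \<le> 1" using grid_in_unit_interval[OF grid, of l] that by auto
  qed
  have sq: "continuous_on \<Theta> (\<lambda>\<xi>. sqnorm d (\<lambda>j. sig_hat k V T d \<xi> t j \<omega>))" if "t \<ge> 0" for t
    unfolding sqnorm_def using that by (intro continuous_intros sh) auto
  have nn: "sqnorm d f \<ge> 0" for f by (simp add: sqnorm_def sum_nonneg)
  have pos: "sqnorm d f / real d + \<epsilon> > 0" "sqnorm d f + \<epsilon> * real d > 0" for f
    using nn[of f] eps d by (auto intro!: add_nonneg_pos)
  have nz: "sqnorm d f / real d + \<epsilon> \<noteq> 0" "sqnorm d f + \<epsilon> * real d \<noteq> 0" "real d \<noteq> 0" for f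
    using pos[of f] d by auto
  show ?thesis
    unfolding Und_def Feps_def using pos nz by (intro continuous_intros sq ballI) auto
qed

text \<open>Measurability of the pathwise integral is read off from the Riemann sums: they involve
  finitely many values of the path and converge for every outcome.\<close>

lemma (in C1_kernel) fvar_measurable:
  assumes cont: "\<And>\<omega>. continuous_on {0..1} (\<lambda>t. B t \<omega>)" and B0: "\<And>\<omega>. B 0 \<omega> = 0"
    and meas: "\<And>t. t \<in> {0..1} \<Longrightarrow> B t \<in> borel_measurable M"
    and t: "0 \<le> t" "t \<le> u" "u \<le> 1"
  shows "(\<lambda>\<omega>. fvar (\<lambda>s. B s \<omega>) t u) \<in> borel_measurable M"
proof -
  have mem: "t * real i / real m \<in> {0..1}" if "i \<le> m" for i m
    using t that by (intro uniform_partition_in_unit_interval) auto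
  define I where "I = 1/2 * integral {0..t} (\<lambda>s. (k (max 0 (u - s)))\<^sup>2)"
  have "(\<lambda>\<omega>. expo (\<lambda>s. B s \<omega>) t u + I) \<in> borel_measurable M"
  proof (rule borel_measurable_LIMSEQ_real)
    show "(\<lambda>m. \<Sum>i<m. k (u - t * real i / real m) * (B (t * real (Suc i) / real m) \<omega> - B (t * real i / real m) \<omega>))
        \<longlonglongrightarrow> expo (\<lambda>s. B s \<omega>) t u + I" for \<omega>
      unfolding I_def by (rule expo_riemann_limit[OF cont B0 t])
    fix m
    show "(\<lambda>\<omega>. \<Sum>i<m. k (u - t * real i / real m) * (B (t * real (Suc i) / real m) \<omega> - B (t * real i / real m) \<omega>)) \<in> borel_measurable M"
      by (intro borel_measurable_sum borel_measurable_times borel_measurable_diff borel_measurable_const meas mem) auto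
  qed
  then have "(\<lambda>\<omega>. V0 u * exp ((expo (\<lambda>s. B s \<omega>) t u + I) - I)) \<in> borel_measurable M"
    by (intro borel_measurable_times borel_measurable_const borel_measurable_exp[THEN measurable_compose[rotated]] borel_measurable_diff)
  then show ?thesis by (simp add: fvar_def)
qed

text \<open>The same sums converge in probability to the Wiener integral, by definition, and almost
  surely to the expression obtained by parts; the two limits must coincide almost surely.\<close>

lemma (in C1_kernel) wiener_exponential_AE_eq_fvar:
  assumes BM: "std_brownian_motion M F W"
    and cont: "\<And>\<omega>. continuous_on {0..1} (\<lambda>t. B t \<omega>)" and B0: "\<And>\<omega>. B 0 \<omega> = 0"
    and BW: "AE \<omega> in M. \<forall>t. B t \<omega> = W t \<omega>"
    and t: "0 \<le> t" "t \<le> u" "u \<le> 1"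
    and Z: "wiener_integral M W (\<lambda>s. k (u - s)) t Z"
    and X: "AE \<omega> in M. X \<omega> = V0 u * exp (Z \<omega> - 1/2 * set_lebesgue_integral lborel {0..t} (\<lambda>s. (k (u - s))\<^sup>2))"
  shows "AE \<omega> in M. X \<omega> = fvar (\<lambda>s. B s \<omega>) t u"
proof -
  have mem: "t * real i / real m \<in> {0..1}" if "i \<le> m" for i m
    using t that by (intro uniform_partition_in_unit_interval) auto
  have u: "u \<in> {0..1}" using t by auto
  have ck: "continuous_on {0..t} (\<lambda>s. (k (max 0 (u - s)))\<^sup>2)"
    using t by (intro continuous_intros continuous_on_subset[OF cont_trunc_section[OF cont_k u]]) auto
  have "set_lebesgue_integral lborel {0..t} (\<lambda>s. (k (u - s))\<^sup>2) = integral {0..t} (\<lambda>s. (k (max 0 (u - s)))\<^sup>2)"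
  proof (rule set_lebesgue_integral_eq_integral_AE[OF _ ck])
    have "(\<lambda>s. indicator {0..t} s *\<^sub>R (k (max 0 (u - s)))\<^sup>2) \<in> borel_measurable borel"
      by (rule borel_measurable_continuous_on_indicator[OF _ ck]) simp
    moreover have "indicator {0..t} s *\<^sub>R (k (max 0 (u - s)))\<^sup>2 = indicator {0..t} s * (k (u - s))\<^sup>2" for s
      using t by (cases "s \<in> {0..t}") (auto simp: max_absorb2)
    ultimately show "(\<lambda>s. indicator {0..t} s * (k (u - s))\<^sup>2) \<in> borel_measurable borel" by (simp only:)
    show "AE s in lborel. s \<in> {0..t} \<longrightarrow> (k (u - s))\<^sup>2 = (k (max 0 (u - s)))\<^sup>2"
      using t by (intro AE_I2) (auto simp: max_absorb2)
  qed
  note I = this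
  have "AE \<omega> in M. Z \<omega> = expo (\<lambda>s. B s \<omega>) t u + 1/2 * integral {0..t} (\<lambda>s. (k (max 0 (u - s)))\<^sup>2)"
  proof (rule conv_in_prob_AE_limit_unique[where Y = "\<lambda>m \<omega>. \<Sum>i<m. k (u - t * real i / real m) *
       (W (t * real (Suc i) / real m) \<omega> - W (t * real i / real m) \<omega>)"])
    show "prob_space M" using BM by (simp add: std_brownian_motion_def)
    show "Z \<in> borel_measurable M" using Z by (simp add: wiener_integral_def)
    show "conv_in_prob M (\<lambda>m \<omega>. \<Sum>i<m. k (u - t * real i / real m) *
       (W (t * real (Suc i) / real m) \<omega> - W (t * real i / real m) \<omega>)) Z"
      using Z by (simp add: wiener_integral_def)
    show "(\<lambda>\<omega>. \<Sum>i<m. k (u - t * real i / real m) *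
       (W (t * real (Suc i) / real m) \<omega> - W (t * real i / real m) \<omega>)) \<in> borel_measurable M" for m
      by (intro borel_measurable_sum borel_measurable_times borel_measurable_diff borel_measurable_const
          std_brownian_motion_measurable[OF BM] mem) auto
    show "AE \<omega> in M. (\<lambda>m. \<Sum>i<m. k (u - t * real i / real m) *
       (W (t * real (Suc i) / real m) \<omega> - W (t * real i / real m) \<omega>))
        \<longlonglongrightarrow> expo (\<lambda>s. B s \<omega>) t u + 1/2 * integral {0..t} (\<lambda>s. (k (max 0 (u - s)))\<^sup>2)"
      using BW
    proof eventually_elim
      case (elim \<omega>)
      then show ?case using expo_riemann_limit[OF cont[of \<omega>] B0[of \<omega>] t] by simp
    qed
  qed
  with X show ?thesis
    by eventually_elim (simp add: I fvar_def)
qed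

text \<open>The null set in \<open>eq\<close> depends on (t, u), whereas integrals over u need
  agreement for one outcome at almost all u. Fubini exchanges the two: at fixed t for the times of
  the contrast, and at almost every t for the limit.\<close>

lemma (in prob_space) AE_AE_eq_continuous_version:
  fixes V :: "real \<Rightarrow> real \<Rightarrow> 'a \<Rightarrow> real"
  assumes V: "(\<lambda>((t, u), \<omega>). V t u \<omega>) \<in> borel_measurable ((lborel \<Otimes>\<^sub>M lborel) \<Otimes>\<^sub>M M)"
    and vm: "\<And>t u. 0 \<le> t \<Longrightarrow> t \<le> u \<Longrightarrow> u \<le> 1 \<Longrightarrow> (\<lambda>\<omega>. v \<omega> t u) \<in> borel_measurable M"
    and vc: "\<And>\<omega>. continuous_on ({0..1} \<times> {0..1}) (\<lambda>(t, u). v \<omega> t u)"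
    and eq: "\<And>t u. 0 \<le> t \<Longrightarrow> t \<le> u \<Longrightarrow> u \<le> 1 \<Longrightarrow> AE \<omega> in M. V t u \<omega> = v \<omega> t u"
  shows "AE \<omega> in M. AE u in lborel. 0 \<le> t \<and> t \<le> u \<and> u \<le> 1 \<longrightarrow> V t u \<omega> = v \<omega> t u"
    and "AE \<omega> in M. AE t in lborel. AE u in lborel. 0 \<le> t \<and> t \<le> u \<and> u \<le> 1 \<longrightarrow> V t u \<omega> = v \<omega> t u"
proof -
  \<comment> \<open>Clamping maps the plane into the triangle 0 \<le> t \<le> u \<le> 1, where
    \<open>v\<close> is known to be measurable, and makes \<open>g\<close> continuous
    everywhere.\<close>
  define g where "g t u \<omega> = v \<omega> (clamp01 t) (max (clamp01 t) (clamp01 u))" for t u \<omega>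
  have geq: "g t u \<omega> = v \<omega> t u" if "0 \<le> t" "t \<le> u" "u \<le> 1" for t u \<omega>
    using that by (simp add: g_def clamp01_eq max_absorb2)
  have "(\<lambda>((t, u), \<omega>). g t u \<omega>) \<in> borel_measurable ((lborel \<Otimes>\<^sub>M lborel) \<Otimes>\<^sub>M M)"
  proof (rule caratheodory_measurable)
    show "g t u \<in> borel_measurable M" for t u
      unfolding g_def by (rule vm) auto
    fix \<omega>
    have "continuous_on UNIV (\<lambda>p. (\<lambda>(t, u). v \<omega> t u) (clamp01 (fst p), max (clamp01 (fst p)) (clamp01 (snd p))))"
      by (rule continuous_on_compose2[OF vc]) (auto intro!: continuous_intros)
    then show "continuous_on UNIV (\<lambda>(t, u). g t u \<omega>)" by (simp add: g_def case_prod_beta')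
  qed
  then have gm: "(\<lambda>q. g (fst (fst q)) (snd (fst q)) (snd q)) \<in> borel_measurable ((lborel \<Otimes>\<^sub>M lborel) \<Otimes>\<^sub>M M)"
    by (simp add: case_prod_beta')
  have Vm: "(\<lambda>q. V (fst (fst q)) (snd (fst q)) (snd q)) \<in> borel_measurable ((lborel \<Otimes>\<^sub>M lborel) \<Otimes>\<^sub>M M)"
    using V by (simp add: case_prod_beta')
  define P where "P p \<omega> \<longleftrightarrow> (0 \<le> fst p \<and> fst p \<le> snd p \<and> snd p \<le> 1 \<longrightarrow> V (fst p) (snd p) \<omega> = g (fst p) (snd p) \<omega>)" for p \<omega>
  have AEP: "AE \<omega> in M. P p \<omega>" for p
  proof (cases "0 \<le> fst p \<and> fst p \<le> snd p \<and> snd p \<le> 1")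
    case True
    then show ?thesis using eq[of "fst p" "snd p"] unfolding P_def by (auto simp: geq)
  qed (auto simp: P_def)
  have Pm: "Measurable.pred ((lborel \<Otimes>\<^sub>M lborel) \<Otimes>\<^sub>M M) (\<lambda>q. P (fst q) (snd q))"
    unfolding P_def using gm Vm by measurable

  interpret LLM: pair_sigma_finite "lborel \<Otimes>\<^sub>M lborel :: (real \<times> real) measure" M
    by (rule pair_sigma_finite.intro) (auto intro: lborel_pair.P.sigma_finite_measure_axioms sigma_finite_measure_axioms)
  interpret LM: pair_sigma_finite lborel M ..
  have "AE \<omega> in M. AE p in lborel \<Otimes>\<^sub>M lborel. P p \<omega>"
    using AEP Pm by (subst LLM.AE_commute[symmetric]) (auto simp: pred_def)
  then show "AE \<omega> in M. AE t in lborel. AE u in lborel. 0 \<le> t \<and> t \<le> u \<and> u \<le> 1 \<longrightarrow> V t u \<omega> = v \<omega> t u"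
  proof eventually_elim
    case (elim \<omega>)
    from lborel_pair.AE_pair[OF elim] show ?case
      by eventually_elim (auto elim!: eventually_mono simp: P_def geq)
  qed
  have "(\<lambda>q. ((t, fst q), snd q)) \<in> measurable (lborel \<Otimes>\<^sub>M M) ((lborel \<Otimes>\<^sub>M lborel) \<Otimes>\<^sub>M M)" by measurable
  from measurable_compose[OF this Pm]
  have "Measurable.pred (lborel \<Otimes>\<^sub>M M) (\<lambda>q. P (t, fst q) (snd q))" by simp
  then have "AE \<omega> in M. AE u in lborel. P (t, u) \<omega>"
    using AEP by (subst LM.AE_commute[symmetric]) (auto simp: pred_def)
  then show "AE \<omega> in M. AE u in lborel. 0 \<le> t \<and> t \<le> u \<and> u \<le> 1 \<longrightarrow> V t u \<omega> = v \<omega> t u"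
    by eventually_elim (auto elim!: eventually_mono simp: P_def geq)
qed

text \<open>Uniform convergence is expressed through measurable sets \<open>A\<close> covering the
  exceptional events, that is, in outer probability, which coincides with the usual notion whenever
  the supremum is measurable.\<close>

theorem mainTheorem8:
  fixes M :: "'a measure" and F :: "real \<Rightarrow> 'a measure" and W :: "real \<Rightarrow> 'a \<Rightarrow> real"
    and \<Theta> :: "'p::euclidean_space set" and k :: "'p \<Rightarrow> real \<Rightarrow> real" and \<theta> :: 'p
    and V0 :: "real \<Rightarrow> real" and V :: "real \<Rightarrow> real \<Rightarrow> 'a \<Rightarrow> real"
    and T :: "nat \<Rightarrow> nat \<Rightarrow> real" and \<mu> :: "real measure" and \<epsilon> :: real
  assumes Theta: "compact \<Theta>" "convex \<Theta>"
    and BM: "std_brownian_motion M F W"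
    and k_neg: "\<And>\<xi> t. t < 0 \<Longrightarrow> k \<xi> t = 0"
    and theta: "\<theta> \<in> \<Theta>"
    and V0: "continuous_on {0..1} V0" "\<And>u. u \<in> {0..1} \<Longrightarrow> V0 u > 0"
    and V_meas: "(\<lambda>((t, u), \<omega>). V t u \<omega>) \<in> borel_measurable ((lborel \<Otimes>\<^sub>M lborel) \<Otimes>\<^sub>M M)"
    and V_def: "\<And>t u. 0 \<le> t \<Longrightarrow> t \<le> u \<Longrightarrow> u \<le> 1 \<Longrightarrow>
        \<exists>Z. wiener_integral M W (\<lambda>s. k \<theta> (u - s)) t Z \<and>
            (AE \<omega> in M. V t u \<omega> =
               V0 u * exp (Z \<omega> - 1/2 * set_lebesgue_integral lborel {0..t} (\<lambda>s. (k \<theta> (u - s))\<^sup>2)))"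
    and V_zero: "\<And>t u \<omega>. t > u \<Longrightarrow> V t u \<omega> = 0"
    and grid: "\<And>d. d \<ge> 1 \<Longrightarrow> T d 0 = 0 \<and> T d d \<le> 1 \<and> (\<forall>j<d. T d j < T d (Suc j))"
    and H1: "H1 \<Theta> k"
    and H4: "H4 \<mu> T"
    and eps: "\<epsilon> > 0"
  shows "\<forall>\<eta>>0. \<forall>\<delta>>0. \<exists>N. \<forall>n\<ge>N. \<forall>d\<ge>N. \<exists>A\<in>sets M.
           {\<omega>\<in>space M. \<exists>\<xi>\<in>\<Theta>. \<bar>Und k V T \<epsilon> n d \<xi> \<omega> - Ulim k V \<mu> \<theta> \<epsilon> \<xi> \<omega>\<bar> > \<eta>} \<subseteq> A
           \<and> measure M A < \<delta>"
proof (rule ccontr)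
  assume "\<not> ?thesis"
  then obtain \<eta> \<delta> where \<eta>: "\<eta> > 0" and \<delta>: "\<delta> > 0" and bad: "\<And>N. \<exists>n\<ge>N. \<exists>d\<ge>N. \<forall>A\<in>sets M.
      {\<omega>\<in>space M. \<exists>\<xi>\<in>\<Theta>. \<bar>Und k V T \<epsilon> n d \<xi> \<omega> - Ulim k V \<mu> \<theta> \<epsilon> \<xi> \<omega>\<bar> > \<eta>} \<subseteq> A
        \<longrightarrow> \<not> measure M A < \<delta>"
    by (auto simp: not_less)
  let ?Bad = "\<lambda>n d. {\<omega>\<in>space M. \<exists>\<xi>\<in>\<Theta>. \<bar>Und k V T \<epsilon> n d \<xi> \<omega> - Ulim k V \<mu> \<theta> \<epsilon> \<xi> \<omega>\<bar> > \<eta>}"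
  \<comment> \<open>Requesting bad pairs beyond 2^m makes both indices diverge and the second-moment
    bounds 2 / n m summable.\<close>
  obtain n d where n: "\<And>m. n m \<ge> 2 ^ m" and d: "\<And>m. d m \<ge> 2 ^ m" and bad': "\<And>m A. A \<in> sets M \<Longrightarrow>
      ?Bad (n m) (d m) \<subseteq> A
        \<Longrightarrow> \<not> measure M A < \<delta>"
  proof -
    have "\<forall>m. \<exists>nd. fst nd \<ge> 2 ^ m \<and> snd nd \<ge> 2 ^ m \<and> (\<forall>A\<in>sets M.
      ?Bad (fst nd) (snd nd) \<subseteq> A
        \<longrightarrow> \<not> measure M A < \<delta>)"
    proof
      fix m :: nat
      from bad[of "2 ^ m"] obtain a b where ab: "a \<ge> 2 ^ m" "b \<ge> 2 ^ m" "\<forall>A\<in>sets M.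
        ?Bad a b \<subseteq> A
          \<longrightarrow> \<not> measure M A < \<delta>" by blast
      then show "\<exists>nd. fst nd \<ge> 2 ^ m \<and> snd nd \<ge> 2 ^ m \<and> (\<forall>A\<in>sets M.
        ?Bad (fst nd) (snd nd) \<subseteq> A
          \<longrightarrow> \<not> measure M A < \<delta>)"
        by (intro exI[of _ "(a, b)"]) simp
    qed
    from choice[OF this] obtain nd where "\<forall>m. fst (nd m) \<ge> 2 ^ m \<and> snd (nd m) \<ge> 2 ^ m \<and> (\<forall>A\<in>sets M.
      ?Bad (fst (nd m)) (snd (nd m)) \<subseteq> A
        \<longrightarrow> \<not> measure M A < \<delta>)" by blast
    then show ?thesis using that[of "\<lambda>m. fst (nd m)" "\<lambda>m. snd (nd m)"] by simp
  qed
  have pow1: "(1::nat) \<le> 2 ^ m" for m by simp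
  have n1: "n m \<ge> 1" and d1: "d m \<ge> 1" for m
    using order_trans[OF pow1 n] order_trans[OF pow1 d] by blast+

  interpret prob_space M using BM by (simp add: std_brownian_motion_def)
  obtain B where B: "\<And>\<omega>. continuous_on {0..1} (\<lambda>t. B t \<omega>)" "\<And>\<omega>. B 0 \<omega> = 0"
    "\<And>t. t \<in> {0..1} \<Longrightarrow> B t \<in> borel_measurable M" "AE \<omega> in M. \<forall>t. B t \<omega> = W t \<omega>"
    by (rule std_brownian_motion_continuous_modification[OF BM]) (rule that)
  obtain k' where k': "continuous_on {0..1} k'"
    "\<And>s. s \<in> {0..1} \<Longrightarrow> (k \<theta> has_real_derivative k' s) (at s within {0..1})"
    by (rule H1_derivative[OF H1 theta]) (rule that)
  interpret C1_kernel "k \<theta>" k' V0 using k' V0(1) by unfold_locales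
  define v where "v \<omega> = fvar (\<lambda>s. B s \<omega>)" for \<omega>
  have ck: "continuous_on (\<Theta> \<times> {0..1}) (\<lambda>(\<xi>, s). k \<xi> s)" by (rule H1_continuous_kernel[OF H1])
  have path: "\<exists>C. volatility_path \<Theta> k \<theta> (v \<omega>) (\<lambda>s. B s \<omega>) C" for \<omega>
  proof -
    obtain C where C: "\<And>t t' u. 0 \<le> t \<Longrightarrow> t \<le> t' \<Longrightarrow> t' \<le> u \<Longrightarrow> u \<le> 1 \<Longrightarrow>
       \<bar>fvar (\<lambda>s. B s \<omega>) t' u - fvar (\<lambda>s. B s \<omega>) t u - k \<theta> (u - t) * fvar (\<lambda>s. B s \<omega>) t u * (B t' \<omega> - B t \<omega>)\<bar>
         \<le> C * ((B t' \<omega> - B t \<omega>)\<^sup>2 + (t' - t))"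
      by (rule fvar_increment[OF B(1)[of \<omega>]]) (rule that)
    have "volatility_path \<Theta> k \<theta> (v \<omega>) (\<lambda>s. B s \<omega>) C"
      unfolding v_def
      by (rule volatility_path.intro[OF Theta(1) theta ck cont_fvar[OF B(1)] B(1) C])
    then show ?thesis ..
  qed
  have vc: "continuous_on ({0..1} \<times> {0..1}) (\<lambda>(t, u). v \<omega> t u)" for \<omega>
    unfolding v_def by (rule cont_fvar[OF B(1)])
  have vm: "(\<lambda>\<omega>. v \<omega> t u) \<in> borel_measurable M" if "0 \<le> t" "t \<le> u" "u \<le> 1" for t u
    unfolding v_def by (rule fvar_measurable[OF B(1-3) that])
  have veq: "AE \<omega> in M. V t u \<omega> = v \<omega> t u" if t: "0 \<le> t" "t \<le> u" "u \<le> 1" for t u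
    using V_def[OF t] wiener_exponential_AE_eq_fvar[OF BM B(1,2,4) t] unfolding v_def by blast
  note ver = AE_AE_eq_continuous_version[OF V_meas vm vc veq]
  \<comment> \<open>The countably many times i/j contain the partition points of all step numbers,
    so one null set serves the whole subsequence.\<close>
  have "AE \<omega> in M. \<forall>i j::nat. AE u in lborel. 0 \<le> real i / real j \<and> real i / real j \<le> u \<and> u \<le> 1 \<longrightarrow>
      V (real i / real j) u \<omega> = v \<omega> (real i / real j) u"
    unfolding AE_all_countable by (intro allI ver(1))
  moreover have "AE \<omega> in M. AE t in lborel. AE u in lborel. 0 \<le> t \<and> t \<le> u \<and> u \<le> 1 \<longrightarrow> V t u \<omega> = v \<omega> t u"
    by (rule ver(2))
  ultimately have "AE \<omega> in M. uniform_limit \<Theta> (\<lambda>m \<xi>. Und k V T \<epsilon> (n m) (d m) \<xi> \<omega>)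
      (\<lambda>\<xi>. Ulim k V \<mu> \<theta> \<epsilon> \<xi> \<omega>) sequentially"
    using quadratic_variation_AE_limit[OF BM n] B(4) AE_space
  proof eventually_elim
    case (elim \<omega>)
    obtain C where "volatility_path \<Theta> k \<theta> (v \<omega>) (\<lambda>s. B s \<omega>) C" using path by blast
    then interpret vp: volatility_path \<Theta> k \<theta> "v \<omega>" "\<lambda>s. B s \<omega>" C .
    have "(\<lambda>p. (p, \<omega>)) \<in> measurable (lborel \<Otimes>\<^sub>M lborel) ((lborel \<Otimes>\<^sub>M lborel) \<Otimes>\<^sub>M M)"
      using elim(5) by (rule measurable_Pair2')
    from measurable_compose[OF this V_meas]
    have Vt: "(\<lambda>(t, u). V t u \<omega>) \<in> borel_measurable (borel \<Otimes>\<^sub>M borel)"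
      by (simp add: case_prod_beta' cong: measurable_cong_sets sets_pair_measure_cong)
    have Vu: "(\<lambda>u. V t u \<omega>) \<in> borel_measurable borel" for t
      using measurable_compose[OF measurable_Pair1'[of t borel borel] Vt] by simp
    have "uniform_limit \<Theta> (\<lambda>m. vp.U T \<epsilon> (n m) (d m))
       (\<lambda>\<xi>. integral {0..1} (\<lambda>t. ln (vp.S \<mu> \<xi> t + \<epsilon>) + (vp.S \<mu> \<theta> t + \<epsilon>) / (vp.S \<mu> \<xi> t + \<epsilon>))) sequentially"
    proof (rule vp.U_uniform_limit[OF H4 grid eps])
      show "filterlim n at_top sequentially" "filterlim d at_top sequentially"
        by (rule filterlim_at_top_of_ge_power2[OF n], rule filterlim_at_top_of_ge_power2[OF d])
      show "(\<lambda>m. \<Sum>i<n m. h (real i / real (n m)) * (B (real (Suc i) / real (n m)) \<omega> - B (real i / real (n m)) \<omega>)\<^sup>2)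
          \<longlonglongrightarrow> integral {0..1} h" if "continuous_on {0..1} h" for h
        using elim(3)[rule_format, OF that] elim(4) by simp
    qed
    moreover have "vp.U T \<epsilon> (n m) (d m) \<xi> = Und k V T \<epsilon> (n m) (d m) \<xi> \<omega>" for m \<xi>
    proof (rule vp.Und_eq_U[where V = V and \<omega> = \<omega> and T = T, symmetric, OF Vu _ grid[OF d1[of m]] n1 d1])
      fix i
      show "AE u in lborel. real i / real (n m) \<le> u \<and> u \<le> 1 \<longrightarrow> V (real i / real (n m)) u \<omega> = v \<omega> (real i / real (n m)) u"
        using elim(1)[rule_format, of i "n m"] by simp
    qed
    moreover have "Ulim k V \<mu> \<theta> \<epsilon> \<xi> \<omega>
        = integral {0..1} (\<lambda>t. ln (vp.S \<mu> \<xi> t + \<epsilon>) + (vp.S \<mu> \<theta> t + \<epsilon>) / (vp.S \<mu> \<xi> t + \<epsilon>))" if "\<xi> \<in> \<Theta>" for \<xi>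
      by (rule vp.Ulim_eq_integral[where V = V and \<omega> = \<omega>, OF Vt elim(2) grid H4 eps that])
    ultimately show ?case by (subst uniform_limit_cong'[where g = "\<lambda>m. vp.U T \<epsilon> (n m) (d m)"]) auto
  qed
  note unif = this
  have uc: "continuous_on \<Theta> (\<lambda>\<xi>. Und k V T \<epsilon> (n m) (d m) \<xi> \<omega>)" for m \<omega>
    by (rule Und_continuous[where T = T and k = k, OF ck k_neg grid[OF d1[of m]] d1 eps])
  \<comment> \<open>Almost sure uniform convergence yields some m whose exceptional event has a
    cover of measure below \<delta>, which the choice of the bad pairs forbids for every m.\<close>
  have "\<exists>m. \<exists>A\<in>sets M. ?Bad (n m) (d m) \<subseteq> A \<and> measure M A < \<delta>"
    by (rule AE_uniform_limit_imp_outer_probability[OF prob_space_axioms Und_measurable[OF V_meas] uc unif \<eta> \<delta>])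
  then obtain m A where "A \<in> sets M" "measure M A < \<delta>"
    "?Bad (n m) (d m) \<subseteq> A"
    by (elim exE bexE conjE) (rule that)
  then show False using bad'[of A m] by simp
qed

end
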